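(* Every hereditary class of graphs of unbounded tree-width that is $KKW$-free is infinitely defined.
   Context: Graphs are finite, simple and undirected. A class of graphs is hereditary if it is closed under taking induced subgraphs. For every hereditary class $\mathcal C$ there is a unique (up to isomorphism) set of minimal forbidden induced subgraphs, i.e. graphs not in $\mathcal C$ all of whose proper induced subgraphs are in $\mathcal C$; $\mathcal C$ is infinitely defined if this set is infinite (and finitely defined otherwise). A class has unbounded tree-width if there is no constant bounding the tree-width of all its members. The $(m\times n)$-wall is the graph with vertex set $\{(x,y): 0\le x\le 2n+1,\ 0\le y\le m\}$ (integers $x,y$) and edges $(x,y)(x+1,y)$ whenever both are vertices, and $(x,y)(x,y+1)$ whenever both are vertices and $x+y\equiv 0\pmod 2$. A subdivision of a graph is obtained by inserting new degree-2 vertices on some of its edges. A hereditary class is $KKW$-free if there exists $t\in\mathbb N$ such that the class does not contain the complete graph $K_t$, the complete bipartite graph $K_{t,t}$, any subdivision of the $(t\times t)$-wall, or the line graph of any subdivision of the $(t\times t)$-wall. *)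

theory Defs
  imports "Graph_Theory.Graph_Theory"
begin

text \<open>
  A finite simple undirected graph is a \<^locale>\<open>pair_graph\<close>: a finite, loop-free, symmetric
  digraph whose arcs are pairs, so that an undirected edge corresponds to two opposite arcs.
  Classes of graphs consist of graphs on subsets of \<^typ>\<open>nat\<close> and are closed under isomorphism;
  every finite graph has an isomorphic copy of this kind.
\<close>

definition graph_iso :: "'a pair_pre_digraph \<Rightarrow> 'b pair_pre_digraph \<Rightarrow> bool" where
  "graph_iso G H \<longleftrightarrow> pair_graph G \<and> pair_graph H \<and> digraph_iso (with_proj G) (with_proj H)"

definition graph_class :: "nat pair_pre_digraph set \<Rightarrow> bool" where
  "graph_class C \<longleftrightarrow>
     (\<forall>G\<in>C. pair_graph G) \<and> (\<forall>G\<in>C. \<forall>H :: nat pair_pre_digraph. graph_iso G H \<longrightarrow> H \<in> C)"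

definition hereditary :: "nat pair_pre_digraph set \<Rightarrow> bool" where
  "hereditary C \<longleftrightarrow> graph_class C \<and>
     (\<forall>G\<in>C. \<forall>H. induced_subgraph (with_proj H) (with_proj G) \<longrightarrow> H \<in> C)"

definition minimal_forbidden :: "nat pair_pre_digraph set \<Rightarrow> nat pair_pre_digraph set" where
  "minimal_forbidden C =
     {G. pair_graph G \<and> G \<notin> C \<and>
         (\<forall>H. induced_subgraph (with_proj H) (with_proj G) \<and> H \<noteq> G \<longrightarrow> H \<in> C)}"

text \<open>
  Minimal forbidden induced subgraphs are counted up to isomorphism, since
  \<^const>\<open>minimal_forbidden\<close> contains every copy of each of them.
\<close>

definition infinitely_defined :: "nat pair_pre_digraph set \<Rightarrow> bool" where
  "infinitely_defined C \<longleftrightarrow> infinite (minimal_forbidden C // {(G, H). graph_iso G H})"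

text \<open>
  The library predicate \<^const>\<open>tree\<close> is about digraphs: it counts the walk $u, v, u$ along the two
  arcs of an edge as a cycle, so no graph with an edge satisfies it. In a \<^locale>\<open>pair_graph\<close> the
  directed cycles of length at least 3 are exactly the (oriented) undirected cycles.
\<close>

definition undirected_tree :: "'a pair_pre_digraph \<Rightarrow> bool" where
  "undirected_tree T \<longleftrightarrow> pair_graph T \<and> connected (with_proj T) \<and>
     \<not> (\<exists>p. pre_digraph.cycle (with_proj T) p \<and> 3 \<le> length p)"

definition tree_decomposition ::
    "'a pair_pre_digraph \<Rightarrow> 't pair_pre_digraph \<Rightarrow> ('t \<Rightarrow> 'a set) \<Rightarrow> bool" where
  "tree_decomposition G T B \<longleftrightarrow> undirected_tree T \<and>
     (\<Union>t\<in>pverts T. B t) = pverts G \<and>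
     (\<forall>(u, v)\<in>parcs G. \<exists>t\<in>pverts T. u \<in> B t \<and> v \<in> B t) \<and>
     (\<forall>v\<in>pverts G. connected (with_proj T \<restriction> {t \<in> pverts T. v \<in> B t}))"

text \<open>
  On the graph without vertices the truncated subtraction gives tree-width 0 rather than -1;
  this does not affect whether the tree-width of a class is bounded.
\<close>

definition decomposition_width :: "'t pair_pre_digraph \<Rightarrow> ('t \<Rightarrow> 'a set) \<Rightarrow> nat" where
  "decomposition_width T B = Max ((\<lambda>t. card (B t)) ` pverts T) - 1"

definition tree_width :: "'a pair_pre_digraph \<Rightarrow> nat" where
  "tree_width G = (LEAST w. \<exists>(T :: nat pair_pre_digraph) B.
     tree_decomposition G T B \<and> decomposition_width T B = w)"

definition unbounded_tree_width :: "nat pair_pre_digraph set \<Rightarrow> bool" where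
  "unbounded_tree_width C \<longleftrightarrow> \<not> (\<exists>k. \<forall>G\<in>C. tree_width G \<le> k)"

definition wall :: "nat \<Rightarrow> nat \<Rightarrow> (nat \<times> nat) pair_pre_digraph" where
  "wall m n =
     (let V = {(x, y). x \<le> 2 * n + 1 \<and> y \<le> m};
          E = {((x, y), (x + 1, y)) | x y. (x, y) \<in> V \<and> (x + 1, y) \<in> V} \<union>
              {((x, y), (x, y + 1)) | x y. (x, y) \<in> V \<and> (x, y + 1) \<in> V \<and> even (x + y)}
      in \<lparr> pverts = V, parcs = E \<union> E\<inverse> \<rparr>)"

definition edge_sets :: "'a pair_pre_digraph \<Rightarrow> 'a set set" where
  "edge_sets G = {{u, v} | u v. (u, v) \<in> parcs G}"

definition line_graph :: "'a pair_pre_digraph \<Rightarrow> 'a set pair_pre_digraph" where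
  "line_graph G = \<lparr> pverts = edge_sets G,
     parcs = {(e, f). e \<in> edge_sets G \<and> f \<in> edge_sets G \<and> e \<noteq> f \<and> e \<inter> f \<noteq> {}} \<rparr>"

definition KKW_free :: "nat pair_pre_digraph set \<Rightarrow> bool" where
  "KKW_free C \<longleftrightarrow> (\<exists>t :: nat. \<forall>G\<in>C.
     \<not> K\<^bsub>t\<^esub> (with_proj G) \<and>
     \<not> K\<^bsub>t,t\<^esub> (with_proj G) \<and>
     \<not> (\<exists>H. subdivision_pair (wall t t) H \<and> graph_iso H G) \<and>
     \<not> (\<exists>H. subdivision_pair (wall t t) H \<and> graph_iso (line_graph H) G))"

end

theory Submission
  imports Defs "HOL-Library.Ramsey"
begin

text \<open>
  A finitely defined class that excludes a long subdivision of a wall also excludes a bounded part of it. When the edges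
  of the wall are subdivided often enough, such a part misses an inner vertex of every edge, and is therefore an
  induced subgraph of a disjoint union of tripods, that is, of claws with subdivided edges. In the same way the class
  excludes an induced subgraph of a disjoint union of line graphs of tripods. The theorem thus reduces to a statement of
  Lozin and Razgon: in a graph without large cliques and without large induced complete bipartite subgraphs, large tree-width forces many disjoint
  long tripods, or line graphs of tripods, without edges between them.
  
  By Ramsey's theorem, excluding cliques and induced bicliques excludes bicliques as subgraphs (\<open>nobiclique_class\<close>).
  If the tree-width is large, the usual recursive construction of a tree-decomposition gets stuck
  (\<open>linked_or_decomposable\<close>) and leaves an induced subgraph with a set \<open>W\<close> that cannot be split by small separators. For
  every small separator \<open>Y\<close> this singles out the component \<open>\<beta> Y\<close> that contains most of \<open>W\<close> (\<open>linked_tangled\<close>).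
  
  Call a vertex rich if it cannot be cut off from this main component by a bounded number of other vertices. Suppose first that
  there are many rich vertices. If many of them are pairwise joined by short walks that avoid any given bounded set, then
  they are the branch vertices of a subdivided complete graph, which can be made induced by Ramsey's theorem since bicliques are absent
  (\<open>close_many\<close>), and it contains all the claws (\<open>subdivided_clique_many\<close>). Otherwise many of them are pairwise far
  apart after the deletion of a bounded set, and each is the centre of a claw (\<open>far_many\<close>).
  
  If there are few rich vertices, they are deleted. Every remaining vertex, and hence every bounded set and every ball
  of bounded radius around it, can be cut off by a separator of bounded size that is disjoint from it (\<open>region\<close>). One then finds
  three vertices of \<open>W\<close> none of which is cut off by a ball around the other two, joins them through the main component, and extracts a tripod or its line
  graph from a minimal connection (\<open>thin_tripod\<close>, \<open>three_legs\<close>). This tripod is cut off by a bounded separator, and the argument is repeated in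
  the main component outside (\<open>many_tripods\<close>).
\<close>

section \<open>Consequences of the Ramsey theorem\<close>

text \<open>
  The hypergraph Ramsey theorem for colourings of increasing \<open>r\<close>-tuples with an arbitrary finite
  set of colours. Adjacency patterns between tuples of vertices are used as colours below, so that a
  homogeneous set is one in which all tuples of indices see the same pattern.
\<close>
lemma ramsey_tuples:
  assumes "finite (X :: 'c set)"
  shows "\<exists>N. \<forall>F :: nat list \<Rightarrow> 'c. (\<forall>xs. F xs \<in> X) \<longrightarrow>
    (\<exists>(e :: nat \<Rightarrow> nat) c. strict_mono_on {..<M} e \<and> e ` {..<M} \<subseteq> {..<N::nat} \<and>
      (\<forall>ps. sorted_wrt (<) ps \<and> length ps = r \<and> set ps \<subseteq> {..<M} \<longrightarrow> F (map e ps) = c))"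
proof -
  obtain N where N: "partn_lst {..<N::nat} (replicate (card X) M) r" using ramsey_full[of "replicate (card X) M" r] by blast
  obtain h where h: "bij_betw h X {..<card X}"
    using ex_bij_betw_finite_nat[OF assms] unfolding lessThan_atLeast0 by blast
  show ?thesis
  proof (intro exI[of _ N] allI impI)
    fix F :: "nat list \<Rightarrow> 'c" assume F: "\<forall>xs. F xs \<in> X"
    let ?f = "\<lambda>T. h (F (sorted_list_of_set T))"
    have "h y < card X" if "y \<in> X" for y using h that unfolding bij_betw_def by blast
    then have "?f \<in> nsets {..<N} r \<rightarrow> {..<length (replicate (card X) M)}" using F by simp
    then obtain i where "i < length (replicate (card X) M)" "monochromatic {..<N} (replicate (card X) M ! i) r ?f i"
      using bspec[OF N[unfolded partn_lst_def], of ?f] by blast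
    then have i: "i < card X" "monochromatic {..<N} M r ?f i" by simp_all
    then obtain H where H: "H \<in> nsets {..<N} M" "?f ` nsets H r \<subseteq> {i}"
      unfolding monochromatic_def by blast
    have finH: "finite H" "card H = M" "H \<subseteq> {..<N}" using H(1) by (auto simp: nsets_def)
    define e where "e = (\<lambda>k. sorted_list_of_set H ! k)"
    have e1: "strict_mono_on {..<M} e"
      unfolding strict_mono_on_def e_def
      using sorted_wrt_nth_less[OF strict_sorted_list_of_set[of H]] finH(2) by simp
    have e2: "e ` {..<M} = H"
    proof -
      have "length (sorted_list_of_set H) = M" using finH by simp
      then have "e ` {..<M} = set (sorted_list_of_set H)" by (auto simp: set_conv_nth e_def)
      then show ?thesis using finH by simp
    qed
    obtain c where c: "c \<in> X" "h c = i" 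
    proof -
      have "i \<in> h ` X" using h i(1) unfolding bij_betw_def by simp
      then show thesis using that by blast
    qed
    have "F (map e ps) = c" if ps: "sorted_wrt (<) ps" "length ps = r" "set ps \<subseteq> {..<M}" for ps
    proof -
      have s: "sorted_wrt (<) (map e ps)"
        unfolding sorted_wrt_map
        by (rule sorted_wrt_mono_rel[OF _ ps(1)]) (use ps(3) strict_mono_onD[OF e1] in blast)
      have sl: "sorted_list_of_set (set (map e ps)) = map e ps"
        using s by (simp add: sorted_list_of_set.idem_if_sorted_distinct strict_sorted_iff del: set_map)
      have "card (set (map e ps)) = r" using s ps(2) by (simp add: distinct_card strict_sorted_iff del: set_map)
      moreover have "set (map e ps) \<subseteq> H" using e2 ps(3) by auto
      ultimately have "set (map e ps) \<in> nsets H r" by (auto simp: nsets_def)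
      then have "?f (set (map e ps)) \<in> {i}" using H(2) by blast
      then have "h (F (map e ps)) = i" using sl by simp
      then show ?thesis using c F inj_onD[of h X "F (map e ps)" c] h by (simp add: bij_betw_def)
    qed
    then have "\<forall>ps. sorted_wrt (<) ps \<and> length ps = r \<and> set ps \<subseteq> {..<M} \<longrightarrow> F (map e ps) = c" by simp
    moreover have "e ` {..<M} \<subseteq> {..<N}" using e2 finH(3) by simp
    ultimately show "\<exists>(e :: nat \<Rightarrow> nat) c. strict_mono_on {..<M} e \<and> e ` {..<M} \<subseteq> {..<N::nat} \<and>
      (\<forall>ps. sorted_wrt (<) ps \<and> length ps = r \<and> set ps \<subseteq> {..<M} \<longrightarrow> F (map e ps) = c)"
      using e1 by (intro exI[of _ e] exI[of _ c] conjI)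
  qed
qed

text \<open>
  If every pair of points is assigned a small set, then some large set \<open>X\<close> avoids the sets of all its own
  pairs: in a homogeneous set of triples, whichever of the three positions were caught by the set of
  the other two, one could fix those two and let the third run through more than \<open>c\<close> points.
\<close>
lemma free_set:
  "\<exists>N. \<forall>(W::'a set) (f :: 'a set \<Rightarrow> 'a set). N \<le> card W \<longrightarrow> (\<forall>P. finite (f P) \<and> card (f P) \<le> c) \<longrightarrow>
     (\<exists>X\<subseteq>W. finite X \<and> card X = m \<and> (\<forall>u\<in>X. \<forall>v\<in>X. \<forall>w\<in>X. u \<noteq> v \<and> w \<noteq> u \<and> w \<noteq> v \<longrightarrow> w \<notin> f {u, v}))"
proof -
  \<comment> \<open>Besides the set of size \<open>m\<close>, there is room for \<open>c + 1\<close> values of one position and two fixed ones.\<close>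
  let ?M = "m + c + 3"
  obtain N where N: "\<forall>F :: nat list \<Rightarrow> bool \<times> bool \<times> bool. (\<forall>xs. F xs \<in> UNIV) \<longrightarrow>
    (\<exists>(e :: nat \<Rightarrow> nat) c. strict_mono_on {..<?M} e \<and> e ` {..<?M} \<subseteq> {..<N::nat} \<and>
      (\<forall>ps. sorted_wrt (<) ps \<and> length ps = 3 \<and> set ps \<subseteq> {..<?M} \<longrightarrow> F (map e ps) = c))"
    using ramsey_tuples[of "UNIV :: (bool \<times> bool \<times> bool) set" ?M 3, OF finite] by blast
  show ?thesis
  proof (intro exI[of _ "Suc N"] allI impI)
    fix W :: "'a set" and f :: "'a set \<Rightarrow> 'a set" assume W: "Suc N \<le> card W" and f: "\<forall>P. finite (f P) \<and> card (f P) \<le> c"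
    have "finite W" using W card.infinite by fastforce
    then obtain h where h: "bij_betw h {..<card W} W"
      using ex_bij_betw_nat_finite lessThan_atLeast0 by metis
    then have hinj: "inj_on h {..<N}" and hW: "h ` {..<N} \<subseteq> W"
      using W by (auto simp: bij_betw_def intro: inj_on_subset)
    obtain e col where e: "strict_mono_on {..<?M} e" "e ` {..<?M} \<subseteq> {..<N::nat}"
      and col: "\<And>x y z. x < y \<Longrightarrow> y < z \<Longrightarrow> z < ?M \<Longrightarrow>
        (h (e x) \<in> f {h (e y), h (e z)}, h (e y) \<in> f {h (e x), h (e z)}, h (e z) \<in> f {h (e x), h (e y)}) = col"
    proof -
      let ?F = "\<lambda>xs. (h (xs!0) \<in> f {h (xs!1), h (xs!2)}, h (xs!1) \<in> f {h (xs!0), h (xs!2)}, h (xs!2) \<in> f {h (xs!0), h (xs!1)})"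
      obtain e col where *: "strict_mono_on {..<?M} e" "e ` {..<?M} \<subseteq> {..<N::nat}"
        "\<forall>ps. sorted_wrt (<) ps \<and> length ps = 3 \<and> set ps \<subseteq> {..<?M} \<longrightarrow> ?F (map e ps) = col"
        using N[rule_format, of ?F] by auto
      have "(h (e x) \<in> f {h (e y), h (e z)}, h (e y) \<in> f {h (e x), h (e z)}, h (e z) \<in> f {h (e x), h (e y)}) = col"
        if "x < y" "y < z" "z < ?M" for x y z
        using *(3)[rule_format, of "[x,y,z]"] that by (simp add: numeral_2_eq_2)
      with * that show thesis by blast
    qed
    let ?g = "\<lambda>i. h (e i)"
    have ginj: "inj_on ?g {..<?M}"
      using comp_inj_on[OF strict_mono_on_imp_inj_on[OF e(1)] inj_on_subset[OF hinj e(2)]] by (simp add: comp_def)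
    have big: False if "\<And>i. i < Suc c \<Longrightarrow> ?g (i + k) \<in> f P" "k \<le> 2" for k P
    proof -
      have "inj_on ?g ((\<lambda>i. i + k) ` {..<Suc c})"
        by (rule inj_on_subset[OF ginj]) (use that(2) in auto)
      then have "card (?g ` (\<lambda>i. i + k) ` {..<Suc c}) = Suc c"
        by (subst card_image) (auto simp: card_image)
      moreover have "?g ` (\<lambda>i. i + k) ` {..<Suc c} \<subseteq> f P" using that(1) by auto
      ultimately show False using f card_mono[of "f P"] by (metis Suc_n_not_le_n order_trans)
    qed
    obtain a b d where abd: "col = (a,b,d)" by (cases col) auto
    have na: "\<not> a"
    proof
      assume a
      show False by (rule big[of 0 "{?g (c+1), ?g (c+2)}"]) (use \<open>a\<close> col[of _ "c+1" "c+2"] abd in auto)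
    qed
    have nb: "\<not> b"
    proof
      assume b
      show False by (rule big[of 1 "{?g 0, ?g (c+2)}"]) (use \<open>b\<close> col[of 0 _ "c+2"] abd in auto)
    qed
    have nd: "\<not> d"
    proof
      assume d
      show False by (rule big[of 2 "{?g 0, ?g 1}"]) (use \<open>d\<close> col[of 0 1] abd in auto)
    qed
    let ?X = "?g ` {..<m}"
    have free: "?g w \<notin> f {?g u, ?g v}" if "u < v" "w \<noteq> u" "w \<noteq> v" "u < ?M" "v < ?M" "w < ?M" for u v w
    proof -
      have "w < u \<or> (u < w \<and> w < v) \<or> v < w" using that by linarith
      then consider "w < u" | "u < w" "w < v" | "v < w" by blast
      then show ?thesis
      proof cases
        case 1 then show ?thesis using col[of w u v] abd na that(1,5) by simp
      next
        case 2 then show ?thesis using col[of u w v] abd nb that(5) by simp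
      next
        case 3 then show ?thesis using col[of u v w] abd nd that(6,1) by simp
      qed
    qed
    have "w \<notin> f {u, v}" if "u \<in> ?X" "v \<in> ?X" "w \<in> ?X" "u \<noteq> v" "w \<noteq> u" "w \<noteq> v" for u v w
    proof -
      obtain i j k where ijk: "u = ?g i" "v = ?g j" "w = ?g k" "i < m" "j < m" "k < m"
        using \<open>u \<in> ?X\<close> \<open>v \<in> ?X\<close> \<open>w \<in> ?X\<close> by auto
      consider "i < j" | "j < i" using ijk \<open>u \<noteq> v\<close> by fastforce
      then show ?thesis
        
      proof cases
        case 1
        then show ?thesis using free[of i j k] ijk that(4-6) by auto
      next
        case 2
        then show ?thesis using free[of j i k] ijk that(4-6) by (auto simp: insert_commute)
      qed
    qed
    moreover have "card ?X = m" by (subst card_image) (auto intro: inj_on_subset[OF ginj])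
    moreover have "?X \<subseteq> W"
    proof -
      have "e ` {..<m} \<subseteq> {..<N}" using e(2) by (auto simp: image_subset_iff)
      then show ?thesis using hW by (auto simp: image_subset_iff)
    qed
    ultimately show "\<exists>X\<subseteq>W. finite X \<and> card X = m \<and> (\<forall>u\<in>X. \<forall>v\<in>X. \<forall>w\<in>X. u \<noteq> v \<and> w \<noteq> u \<and> w \<noteq> v \<longrightarrow> w \<notin> f {u, v})"
      by (intro exI[of _ ?X]) blast
  qed
qed

section \<open>Connected sets and induced paths\<close>

locale sgraph =
  fixes E :: "'a \<Rightarrow> 'a \<Rightarrow> bool"
  assumes sym: "E x y \<Longrightarrow> E y x" and irrefl: "\<not> E x x"
begin

definition walk :: "'a list \<Rightarrow> bool" where
  "walk xs \<longleftrightarrow> xs \<noteq> [] \<and> successively E xs"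

text \<open>
  The subgraph induced by the set is connected; the empty set counts as connected.
\<close>
definition conn :: "'a set \<Rightarrow> bool" where
  "conn S \<longleftrightarrow> (\<forall>x\<in>S. \<forall>y\<in>S. \<exists>xs. walk xs \<and> hd xs = x \<and> last xs = y \<and> set xs \<subseteq> S)"

definition ipath :: "'a list \<Rightarrow> bool" where
  "ipath xs \<longleftrightarrow> distinct xs \<and>
     (\<forall>i<length xs. \<forall>j<length xs. E (xs ! i) (xs ! j) \<longleftrightarrow> j = Suc i \<or> i = Suc j)"

text \<open>
  Disjoint and without edges in between, so that the two sets induce a disjoint union of graphs.
\<close>
definition apart :: "'a set \<Rightarrow> 'a set \<Rightarrow> bool" where
  "apart A B \<longleftrightarrow> (\<forall>a\<in>A. \<forall>b\<in>B. a \<noteq> b \<and> \<not> E a b)"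

lemma apart_sym: "apart A B \<Longrightarrow> apart B A"
  by (auto simp: apart_def dest: sym)

lemma apart_mono: "apart A B \<Longrightarrow> A' \<subseteq> A \<Longrightarrow> B' \<subseteq> B \<Longrightarrow> apart A' B'"
  by (auto simp: apart_def)

lemma E_commute: "E x y \<longleftrightarrow> E y x" using sym by blast

lemma walk_append: "walk xs \<Longrightarrow> walk ys \<Longrightarrow> E (last xs) (hd ys) \<Longrightarrow> walk (xs @ ys)"
  by (auto simp: walk_def successively_append_iff)

lemma walk_join:
  assumes "walk xs" "walk ys" "last xs = hd ys"
  shows "walk (xs @ tl ys)" "hd (xs @ tl ys) = hd xs" "last (xs @ tl ys) = last ys"
proof -
  obtain y ys' where ys: "ys = y # ys'" using assms(2) by (cases ys) (auto simp: walk_def)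
  show "walk (xs @ tl ys)" "hd (xs @ tl ys) = hd xs" "last (xs @ tl ys) = last ys"
    using assms by (auto simp: walk_def successively_append_iff ys successively_Cons)
qed

lemma walk_rev: "walk xs \<Longrightarrow> walk (rev xs)"
  by (auto simp: walk_def intro: successively_mono sym)

lemma conn_walk: "conn S \<Longrightarrow> x \<in> S \<Longrightarrow> y \<in> S \<Longrightarrow> \<exists>xs. walk xs \<and> hd xs = x \<and> last xs = y \<and> set xs \<subseteq> S"
  unfolding conn_def by blast

lemma connI_center:
  assumes "\<And>y. y \<in> S \<Longrightarrow> \<exists>xs. walk xs \<and> hd xs = c \<and> last xs = y \<and> set xs \<subseteq> S"
  shows "conn S"
  unfolding conn_def
proof (intro ballI)
  fix x y assume xy: "x \<in> S" "y \<in> S"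
  obtain xs ys where 1: "walk xs" "hd xs = c" "last xs = x" "set xs \<subseteq> S"
    and 2: "walk ys" "hd ys = c" "last ys = y" "set ys \<subseteq> S"
    using assms xy by meson
  have r: "walk (rev xs)" "hd (rev xs) = x" "last (rev xs) = c"
    using walk_rev 1 by (auto simp: walk_def hd_rev last_rev)
  have "set (rev xs @ tl ys) \<subseteq> S" using 1(4) 2(4) by (cases ys) auto
  then show "\<exists>xs. walk xs \<and> hd xs = x \<and> last xs = y \<and> set xs \<subseteq> S"
    using walk_join[OF r(1) 2(1)] r 2 by metis
qed

lemma walk_take_conn: "walk xs \<Longrightarrow> i < length xs \<Longrightarrow> walk (take (Suc i) xs) \<and> hd (take (Suc i) xs) = hd xs \<and> last (take (Suc i) xs) = xs ! i"
  unfolding walk_def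
  by (auto simp: take_Suc_conv_app_nth hd_append last_conv_nth successively_conv_nth nth_append
        hd_conv_nth less_Suc_eq)

lemma conn_set_walk: "walk xs \<Longrightarrow> conn (set xs)"
proof (rule connI_center[of _ "hd xs"])
  fix y assume w: "walk xs" and "y \<in> set xs"
  then obtain i where "i < length xs" "xs ! i = y" by (auto simp: in_set_conv_nth)
  then show "\<exists>ys. walk ys \<and> hd ys = hd xs \<and> last ys = y \<and> set ys \<subseteq> set xs"
    using walk_take_conn[OF w, of i] set_take_subset[of "Suc i" xs] by metis
qed

lemma conn_sing: "conn {x}"
  using conn_set_walk[of "[x]"] by (simp add: walk_def)

lemma conn_Un:
  assumes A: "conn A" and B: "conn B" and ab: "a \<in> A" "b \<in> B" "a = b \<or> E a b"
  shows "conn (A \<union> B)"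
proof (rule connI_center[of _ a])
  fix y assume "y \<in> A \<union> B"
  then show "\<exists>xs. walk xs \<and> hd xs = a \<and> last xs = y \<and> set xs \<subseteq> A \<union> B"
  proof
    assume "y \<in> A" then show ?thesis using conn_walk[OF A ab(1), of y] by blast
  next
    assume "y \<in> B"
    then obtain ys where ys: "walk ys" "hd ys = b" "last ys = y" "set ys \<subseteq> B"
      using conn_walk[OF B ab(2)] by blast
    show ?thesis
    proof (cases "a = b")
      case True then show ?thesis using ys by auto
    next
      case False
      then have "walk ([a] @ ys)" using ys ab(3) by (intro walk_append) (auto simp: walk_def)
      moreover have "set ([a] @ ys) \<subseteq> A \<union> B" using ys ab by auto
      moreover have "last ([a] @ ys) = y" using ys by (auto simp: walk_def)
      ultimately show ?thesis by (intro exI[of _ "[a] @ ys"]) auto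
    qed
  qed
qed

text \<open>
  The induction principle for connected sets: what contains one vertex of \<open>S\<close> and is closed under
  edges into \<open>S\<close> contains all of \<open>S\<close>. It is how connectivity is used to trap a set on one side of a
  separator.
\<close>
lemma conn_closed:
  assumes "conn S" "x \<in> S" "x \<in> D" and cl: "\<And>u v. u \<in> D \<Longrightarrow> v \<in> S \<Longrightarrow> E u v \<Longrightarrow> v \<in> D"
  shows "S \<subseteq> D"
proof
  fix y assume "y \<in> S"
  then obtain xs where xs: "walk xs" "hd xs = x" "last xs = y" "set xs \<subseteq> S"
    using assms conn_walk by meson
  have "\<forall>z\<in>set xs. z \<in> D" if "walk xs" "hd xs \<in> D" "set xs \<subseteq> S" for xs
    using that
  proof (induction xs)
    case (Cons z zs)
    then show ?case by (cases zs) (auto simp: walk_def intro: cl)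
  qed simp
  then have "last xs \<in> D" using xs assms(3) by (metis last_in_set walk_def)
  then show "y \<in> D" using xs by simp
qed

text \<open>
  A walk of least length from \<open>X\<close> to \<open>T\<close> has no chords and no repetitions, since either would allow a
  shortcut, and it meets \<open>X\<close> and \<open>T\<close> only in its ends. Choosing \<open>T\<close> as the set of neighbours of a vertex
  controls the adjacency of that vertex to the path.
\<close>
lemma geodesic:
  assumes "walk xs" "hd xs \<in> X" "last xs \<in> T"
  obtains ys where "walk ys" "hd ys \<in> X" "last ys \<in> T" "set ys \<subseteq> set xs" "ipath ys" "length ys \<le> length xs"
    "\<And>i. Suc i < length ys \<Longrightarrow> ys ! i \<notin> T" "\<And>i. 0 < i \<Longrightarrow> i < length ys \<Longrightarrow> ys ! i \<notin> X"
proof -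
  let ?P = "\<lambda>ys. walk ys \<and> hd ys \<in> X \<and> last ys \<in> T \<and> set ys \<subseteq> set xs"
  obtain ys where ys: "?P ys" and min: "\<And>zs. ?P zs \<Longrightarrow> length ys \<le> length zs"
    using ex_has_least_nat[of ?P xs length] assms by blast
  have ne: "ys \<noteq> []" and suc: "successively E ys" using ys by (auto simp: walk_def)
  have tk: "successively E (take k ys)" "successively E (drop k ys)" for k
    using suc by (metis append_take_drop_id successively_append_iff)+
  have skip: False if ij: "Suc i < j" "j < length ys" "E (ys!i) (ys!j)" for i j
  proof -
    let ?z = "take (Suc i) ys @ drop j ys"
    have "walk (take (Suc i) ys)" "last (take (Suc i) ys) = ys ! i"
      using walk_take_conn[of ys i] ys ij by auto
    moreover have "walk (drop j ys)" "hd (drop j ys) = ys ! j"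
      using ij tk by (auto simp: walk_def hd_drop_conv_nth)
    ultimately have "walk ?z" using ij by (intro walk_append) auto
    moreover have "hd ?z = hd ys" "last ?z = last ys" using ij ne by (auto simp: hd_append last_append hd_take)
    moreover have "set ?z \<subseteq> set xs" using ys set_take_subset[of "Suc i" ys] set_drop_subset[of j ys] by auto
    ultimately have "length ys \<le> length ?z" using min ys by metis
    then show False using ij by auto
  qed
  have dist: False if ij: "i < j" "j < length ys" "ys!i = ys!j" for i j
  proof -
    let ?z = "take i ys @ drop j ys"
    have "walk ?z"
    proof (cases i)
      case 0 then show ?thesis using ij tk by (auto simp: walk_def)
    next
      case (Suc k)
      have "E (ys!k) (ys!i)" using suc ij(1,2) Suc by (simp add: successively_conv_nth)
      then have "E (ys!k) (ys!j)" using ij by simp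
      moreover have "walk (take (Suc k) ys)" "last (take (Suc k) ys) = ys ! k"
        using walk_take_conn[of ys k] ys ij Suc by auto
      moreover have "walk (drop j ys)" "hd (drop j ys) = ys ! j"
        using ij tk by (auto simp: walk_def hd_drop_conv_nth)
      ultimately show ?thesis unfolding Suc by (intro walk_append) simp_all
    qed
    moreover have "hd ?z = hd ys" using ij ne by (cases i) (auto simp: hd_append hd_take hd_drop_conv_nth hd_conv_nth)
    moreover have "last ?z = last ys" using ij by (auto simp: last_append)
    moreover have "set ?z \<subseteq> set xs" using ys set_take_subset[of i ys] set_drop_subset[of j ys] by auto
    ultimately have "length ys \<le> length ?z" using min ys by metis
    then show False using ij by auto
  qed
  have 1: "ipath ys" unfolding ipath_def
  proof (intro conjI allI impI)
    show "distinct ys" unfolding distinct_conv_nth using dist by (metis linorder_neqE_nat)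
  next
    fix i j assume ij: "i < length ys" "j < length ys"
    show "E (ys ! i) (ys ! j) \<longleftrightarrow> j = Suc i \<or> i = Suc j"
    proof
      assume e: "E (ys ! i) (ys ! j)"
      show "j = Suc i \<or> i = Suc j"
      proof (rule ccontr)
        assume "\<not> ?thesis"
        then consider "Suc i < j" | "Suc j < i" | "i = j" by linarith
        then show False using skip[of i j] skip[of j i] e ij sym irrefl by cases auto
      qed
    next
      assume "j = Suc i \<or> i = Suc j"
      then show "E (ys ! i) (ys ! j)" using suc ij sym by (auto simp: successively_conv_nth)
    qed
  qed
  have 2: "ys ! i \<notin> T" if "Suc i < length ys" for i
  proof
    assume "ys ! i \<in> T"
    then have "?P (take (Suc i) ys)"
      using walk_take_conn[of ys i] ys that set_take_subset[of "Suc i" ys] by auto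
    then have "length ys \<le> length (take (Suc i) ys)" by (rule min)
    then show False using that by simp
  qed
  have 3: "ys ! i \<notin> X" if "0 < i" "i < length ys" for i
  proof
    assume "ys ! i \<in> X"
    then have "?P (drop i ys)"
      using ys that tk set_drop_subset[of i ys] by (auto simp: walk_def hd_drop_conv_nth)
    then have "length ys \<le> length (drop i ys)" by (rule min)
    then show False using that by simp
  qed
  have "length ys \<le> length xs" using min[of xs] assms by blast
  then show thesis using that[of ys] ys 1 2 3 by blast
qed

lemma ipath_walk: "ipath xs \<Longrightarrow> xs \<noteq> [] \<Longrightarrow> walk xs"
  by (auto simp: ipath_def walk_def successively_conv_nth)

lemma ipath_nthE: "ipath xs \<Longrightarrow> i < length xs \<Longrightarrow> j < length xs \<Longrightarrow> E (xs ! i) (xs ! j) \<longleftrightarrow> j = Suc i \<or> i = Suc j"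
  by (auto simp: ipath_def)

lemma ipath_take: "ipath xs \<Longrightarrow> ipath (take k xs)"
  by (auto simp: ipath_def)

lemma ipath_drop: "ipath xs \<Longrightarrow> ipath (drop k xs)"
  by (auto simp: ipath_def)

lemma ipath_rev: "ipath xs \<Longrightarrow> ipath (rev xs)"
  unfolding ipath_def by (auto simp: rev_nth)

lemma ipath_append:
  assumes "ipath xs" "ipath ys" "set xs \<inter> set ys = {}"
    and "\<And>i j. i < length xs \<Longrightarrow> j < length ys \<Longrightarrow> E (xs ! i) (ys ! j) \<longleftrightarrow> Suc i = length xs \<and> j = 0"
  shows "ipath (xs @ ys)"
proof -
  have "E ((xs @ ys) ! i) ((xs @ ys) ! j) \<longleftrightarrow> j = Suc i \<or> i = Suc j"
    if "i < length (xs @ ys)" "j < length (xs @ ys)" for i j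
  proof -
    consider "i < length xs" "j < length xs" | "i < length xs" "j \<ge> length xs"
      | "i \<ge> length xs" "j < length xs" | "i \<ge> length xs" "j \<ge> length xs" by linarith
    then show ?thesis
    proof cases
      case 1 then show ?thesis using assms(1) by (simp add: nth_append ipath_nthE)
    next
      case 2 then show ?thesis using assms(4)[of i "j - length xs"] that by (auto simp: nth_append)
    next
      case 3 then show ?thesis using assms(4)[of j "i - length xs"] that E_commute by (auto simp: nth_append)
    next
      case 4 then show ?thesis using ipath_nthE[OF assms(2), of "i - length xs" "j - length xs"] that
        by (auto simp: nth_append)
    qed
  qed
  then show ?thesis using assms(1-3) by (auto simp: ipath_def)
qed

lemma ipath_Cons:
  assumes "ipath ys" "y \<notin> set ys" "\<And>j. j < length ys \<Longrightarrow> E y (ys ! j) \<longleftrightarrow> j = 0"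
  shows "ipath (y # ys)"
  using ipath_append[of "[y]" ys] assms irrefl by (auto simp: ipath_def)

section \<open>Tripods and their line graphs\<close>

text \<open>
  The tripod with three legs of length \<open>p\<close>, i.e. the claw whose edges are replaced by paths of \<open>p\<close> edges,
  as an induced subgraph with vertex set \<open>A\<close>.
\<close>
definition claw :: "nat \<Rightarrow> 'a set \<Rightarrow> bool" where
  "claw p A \<longleftrightarrow> (\<exists>c L. (\<forall>i<3. length (L i) = p \<and> ipath (c # L i)) \<and>
     (\<forall>i<3. \<forall>j<3. i \<noteq> j \<longrightarrow> apart (set (L i)) (set (L j))) \<and>
     A = insert c (\<Union>i<3::nat. set (L i)))"

text \<open>
  The line graph of a tripod: a triangle with a path attached to each corner. Each of the three paths has
  \<open>p\<close> vertices, the corner included.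
\<close>
definition line_claw :: "nat \<Rightarrow> 'a set \<Rightarrow> bool" where
  "line_claw p A \<longleftrightarrow> (\<exists>L. (\<forall>i<3. length (L i) = p \<and> ipath (L i)) \<and>
     (\<forall>i<3. \<forall>j<3. i \<noteq> j \<longrightarrow> (\<forall>a<p. \<forall>b<p. L i ! a \<noteq> L j ! b \<and> (E (L i ! a) (L j ! b) \<longleftrightarrow> a = 0 \<and> b = 0))) \<and>
     A = (\<Union>i<3::nat. set (L i)))"

definition tripod :: "nat \<Rightarrow> 'a set \<Rightarrow> bool" where
  "tripod p A \<longleftrightarrow> claw p A \<or> line_claw p A"

definition has_tripods :: "nat \<Rightarrow> nat \<Rightarrow> 'a set \<Rightarrow> bool" where
  "has_tripods p m V \<longleftrightarrow> (\<exists>A. (\<forall>i<m. A i \<subseteq> V \<and> tripod p (A i)) \<and> (\<forall>i<m. \<forall>j<m. i \<noteq> j \<longrightarrow> apart (A i) (A j)))"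

lemma all_less_3: "(\<forall>i<3. P i) \<longleftrightarrow> P 0 \<and> P 1 \<and> P (2::nat)"
  by (auto simp: numeral_3_eq_3 numeral_2_eq_2 less_Suc_eq)

lemma UN_less_3: "(\<Union>i<3::nat. F i) = F 0 \<union> F 1 \<union> F 2"
  by (auto simp: numeral_3_eq_3 numeral_2_eq_2 less_Suc_eq)

lemma clawI:
  assumes "ipath (c # l0)" "ipath (c # l1)" "ipath (c # l2)"
    and "p \<le> length l0" "p \<le> length l1" "p \<le> length l2"
    and "apart (set l0) (set l1)" "apart (set l0) (set l2)" "apart (set l1) (set l2)"
  shows "\<exists>A. claw p A \<and> A \<subseteq> insert c (set l0 \<union> set l1 \<union> set l2)"
proof -
  let ?L = "\<lambda>i. take p ([l0,l1,l2] ! i)"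
  have ip: "ipath (c # take p l)" if "ipath (c # l)" for l using ipath_take[OF that, of "Suc p"] by simp
  have an: "apart (set (take p l)) (set (take p l'))" if "apart (set l) (set l')" for l l'
    using that apart_mono set_take_subset by metis
  have "claw p (insert c (\<Union>i<3. set (?L i)))"
    unfolding claw_def
    by (rule exI[of _ c], rule exI[of _ ?L]) (use assms ip an apart_sym in \<open>auto simp: all_less_3\<close>)
  moreover have "insert c (\<Union>i<3. set (?L i)) \<subseteq> insert c (set l0 \<union> set l1 \<union> set l2)"
    using set_take_subset[of p l0] set_take_subset[of p l1] set_take_subset[of p l2]
    by (simp add: UN_less_3) blast
  ultimately show ?thesis by blast
qed

lemma line_clawI:
  assumes "ipath l0" "ipath l1" "ipath l2"
    and "p \<le> length l0" "p \<le> length l1" "p \<le> length l2"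
    and "\<And>a b. a < length l0 \<Longrightarrow> b < length l1 \<Longrightarrow> l0!a \<noteq> l1!b \<and> (E (l0!a) (l1!b) \<longleftrightarrow> a = 0 \<and> b = 0)"
    and "\<And>a b. a < length l0 \<Longrightarrow> b < length l2 \<Longrightarrow> l0!a \<noteq> l2!b \<and> (E (l0!a) (l2!b) \<longleftrightarrow> a = 0 \<and> b = 0)"
    and "\<And>a b. a < length l1 \<Longrightarrow> b < length l2 \<Longrightarrow> l1!a \<noteq> l2!b \<and> (E (l1!a) (l2!b) \<longleftrightarrow> a = 0 \<and> b = 0)"
  shows "\<exists>A. line_claw p A \<and> A \<subseteq> set l0 \<union> set l1 \<union> set l2"
proof -
  let ?L = "\<lambda>i. take p ([l0,l1,l2] ! i)"
  have r: "\<forall>a<p. \<forall>b<p. take p l' ! a \<noteq> take p l ! b \<and> (E (take p l' ! a) (take p l ! b) \<longleftrightarrow> a = 0 \<and> b = 0)"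
    "\<forall>a<p. \<forall>b<p. take p l ! a \<noteq> take p l' ! b \<and> (E (take p l ! a) (take p l' ! b) \<longleftrightarrow> a = 0 \<and> b = 0)"
    if "\<And>a b. a < length l \<Longrightarrow> b < length l' \<Longrightarrow> l!a \<noteq> l'!b \<and> (E (l!a) (l'!b) \<longleftrightarrow> a = 0 \<and> b = 0)"
      "p \<le> length l" "p \<le> length l'" for l l'
    using that E_commute by (auto, metis order_less_le_trans)+
  have "line_claw p (\<Union>i<3. set (?L i))"
    unfolding line_claw_def
    by (rule exI[of _ ?L]) (use assms(1-6) r[OF assms(7)] r[OF assms(8)] r[OF assms(9)] in
        \<open>simp add: all_less_3 ipath_take\<close>)
  moreover have "(\<Union>i<3. set (?L i)) \<subseteq> set l0 \<union> set l1 \<union> set l2"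
    using set_take_subset[of p l0] set_take_subset[of p l1] set_take_subset[of p l2]
    by (simp add: UN_less_3) blast
  ultimately show ?thesis by blast
qed

lemma conn_geodesic:
  assumes "conn S" "x \<in> S" "x \<in> X" "t \<in> S" "t \<in> T"
  obtains ys where "ys \<noteq> []" "ipath ys" "set ys \<subseteq> S" "hd ys \<in> X" "last ys \<in> T"
    "\<And>z. z \<in> set ys \<Longrightarrow> z \<in> X \<Longrightarrow> z = hd ys" "\<And>z. z \<in> set ys \<Longrightarrow> z \<in> T \<Longrightarrow> z = last ys"
proof -
  obtain xs where xs: "walk xs" "hd xs = x" "last xs = t" "set xs \<subseteq> S"
    using conn_walk[OF assms(1,2,4)] by blast
  obtain ys where ys: "walk ys" "hd ys \<in> X" "last ys \<in> T" "set ys \<subseteq> set xs" "ipath ys"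
    and T: "\<And>i. Suc i < length ys \<Longrightarrow> ys ! i \<notin> T" and X: "\<And>i. 0 < i \<Longrightarrow> i < length ys \<Longrightarrow> ys ! i \<notin> X"
    using geodesic[OF xs(1), of X T] xs(2,3) assms(3,5) by metis
  have ne: "ys \<noteq> []" using ys(1) by (simp add: walk_def)
  show thesis
  proof (rule that[of ys])
    fix z assume "z \<in> set ys" "z \<in> X"
    then obtain i where "i < length ys" "z = ys ! i" by (auto simp: in_set_conv_nth)
    then have "i = 0" using X[of i] \<open>z \<in> X\<close> by auto
    then show "z = hd ys" using \<open>z = ys ! i\<close> ne by (simp add: hd_conv_nth)
  next
    fix z assume "z \<in> set ys" "z \<in> T"
    then obtain i where "i < length ys" "z = ys ! i" by (auto simp: in_set_conv_nth)
    then have "i = length ys - 1" using T[of i] \<open>z \<in> T\<close> by fastforce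
    then show "z = last ys" using \<open>z = ys ! i\<close> ne by (simp add: last_conv_nth)
  qed (use ne ys xs in auto)
qed

lemma ipath_append_set:
  assumes "ipath xs" "ipath ys" "xs \<noteq> []" "ys \<noteq> []" "set xs \<inter> set ys = {}" "E (last xs) (hd ys)"
    and "\<And>x y. x \<in> set xs \<Longrightarrow> y \<in> set ys \<Longrightarrow> E x y \<Longrightarrow> x = last xs \<and> y = hd ys"
  shows "ipath (xs @ ys)"
proof (rule ipath_append[OF assms(1,2,5)])
  fix i j assume ij: "i < length xs" "j < length ys"
  have d: "distinct xs" "distinct ys" using assms by (auto simp: ipath_def)
  have l: "xs ! i = last xs \<longleftrightarrow> Suc i = length xs"
    using d ij assms(3) nth_eq_iff_index_eq[OF d(1), of i "length xs - 1"] by (auto simp: last_conv_nth)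
  have h: "ys ! j = hd ys \<longleftrightarrow> j = 0"
    using d ij assms(4) nth_eq_iff_index_eq[OF d(2), of j 0] by (auto simp: hd_conv_nth)
  show "E (xs ! i) (ys ! j) \<longleftrightarrow> Suc i = length xs \<and> j = 0"
  proof
    assume "E (xs ! i) (ys ! j)"
    then show "Suc i = length xs \<and> j = 0" using assms(7)[OF nth_mem[OF ij(1)] nth_mem[OF ij(2)]] l h by blast
  next
    assume "Suc i = length xs \<and> j = 0"
    then have "xs ! i = last xs" "ys ! j = hd ys" using l h by auto
    then show "E (xs ! i) (ys ! j)" using assms(6) by simp
  qed
qed

lemma set_tl_subset: "set (tl xs) \<subseteq> set xs"
  by (cases xs) auto

lemma hd_notin_set_tl: "distinct xs \<Longrightarrow> xs \<noteq> [] \<Longrightarrow> hd xs \<notin> set (tl xs)"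
  by (cases xs) auto

text \<open>
  A path that ends next to the middle part of an induced path \<open>Q\<close> creates a tripod, whatever the neighbours of its last vertex \<open>y\<close>
  on \<open>Q\<close> are. Let \<open>a\<close> and \<open>b\<close> be the first and the last of them. If \<open>a = b\<close>, the tripod is centred at that
  vertex; if they are consecutive, there is a triangle, hence the line graph of a tripod; otherwise
  \<open>y\<close> is itself the centre of a tripod, and what lies on \<open>Q\<close> between \<open>a\<close> and \<open>b\<close> is discarded.
\<close>
lemma spider:
  assumes Q: "ipath Q" and M: "ipath (y # rest)" and disj: "set (y # rest) \<inter> set Q = {}"
    and rest: "\<And>x q. x \<in> set rest \<Longrightarrow> q \<in> set Q \<Longrightarrow> \<not> E x q"
    and k0: "k0 < length Q" "E y (Q ! k0)"
    and rng: "\<And>k. k < length Q \<Longrightarrow> E y (Q ! k) \<Longrightarrow> p \<le> k \<and> k + p < length Q"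
    and len: "p \<le> length rest"
  shows "\<exists>A. tripod p A \<and> A \<subseteq> set Q \<union> set (y # rest)"
proof -
  let ?n = "length Q"
  define K where "K = {k. k < ?n \<and> E y (Q ! k)}"
  have K: "finite K" "K \<noteq> {}" using k0 by (auto simp: K_def)
  define a b where "a = Min K" and "b = Max K"
  have a: "a < ?n" "E y (Q ! a)" and b: "b < ?n" "E y (Q ! b)" and "a \<le> b"
  proof -
    have "a \<in> K" "b \<in> K" using Min_in[OF K] Max_in[OF K] by (auto simp: a_def b_def)
    then show "a < ?n" "E y (Q ! a)" "b < ?n" "E y (Q ! b)" by (auto simp: K_def)
    show "a \<le> b" unfolding b_def by (rule Max_ge[OF K(1) \<open>a \<in> K\<close>])
  qed
  have bd: "a \<le> k \<and> k \<le> b" if "k < ?n" "E y (Q ! k)" for k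
    using Min_le[OF K(1), of k] Max_ge[OF K(1), of k] that by (auto simp: a_def b_def K_def)
  have pa: "p \<le> a" and pb: "b + p < ?n" using rng a b by auto
  let ?l = "rev (take (Suc a) Q)" and ?r = "drop b Q"
  have il: "ipath ?l" and ir: "ipath ?r" using Q ipath_take ipath_drop ipath_rev by blast+
  have lenl: "length ?l = Suc a" using a by simp
  have lenr: "length ?r = ?n - b" by simp
  have ln: "?l ! i = Q ! (a - i)" if "i < Suc a" for i
    using that a by (simp add: rev_nth)
  have rn: "?r ! i = Q ! (b + i)" if "i < ?n - b" for i using that b by simp
  have Qne: "Q ! i \<noteq> Q ! j" if "i < ?n" "j < ?n" "i \<noteq> j" for i j
    using Q that by (simp add: ipath_def nth_eq_iff_index_eq)
  have yQ: "y \<notin> set Q" using disj by auto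
  have sl: "set ?l \<subseteq> set Q" "set ?r \<subseteq> set Q" by (auto dest: in_set_takeD in_set_dropD)
  have QM: "Q ! i \<noteq> (y # rest) ! j" "E (Q ! i) ((y # rest) ! j) \<longleftrightarrow> j = 0 \<and> E y (Q ! i)"
    if "i < ?n" "j < length (y # rest)" for i j
  proof -
    show "Q ! i \<noteq> (y # rest) ! j" using disj nth_mem[OF that(1)] nth_mem[OF that(2)] by auto
    show "E (Q ! i) ((y # rest) ! j) \<longleftrightarrow> j = 0 \<and> E y (Q ! i)"
    proof (cases j)
      case 0 then show ?thesis using E_commute by auto
    next
      case (Suc j')
      then have "rest ! j' \<in> set rest" using that by auto
      then show ?thesis using rest[of "rest ! j'" "Q ! i"] that Suc sym by auto
    qed
  qed
  consider "a = b" | "b = Suc a" | "Suc a < b" using \<open>a \<le> b\<close> by linarith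
  then show ?thesis
  proof cases
    case 1
    let ?c = "Q ! a" and ?l0 = "rev (take a Q)" and ?l1 = "drop (Suc a) Q"
    have "ipath (?c # ?l0)" using il a by (simp add: take_Suc_conv_app_nth)
    moreover have "ipath (?c # ?l1)" using ir 1 a by (simp add: Cons_nth_drop_Suc)
    moreover have "ipath (?c # y # rest)"
    proof (rule ipath_Cons[OF M])
      show "?c \<notin> set (y # rest)" using disj nth_mem[OF a(1)] by auto
      fix j assume "j < length (y # rest)"
      then show "E ?c ((y # rest) ! j) \<longleftrightarrow> j = 0" using QM[OF a(1)] a by auto
    qed
    moreover have "apart (set ?l0) (set ?l1)"
      unfolding apart_def
    proof (intro ballI)
      fix u v assume "u \<in> set ?l0" "v \<in> set ?l1"
      then obtain i j where "u = Q ! i" "i < a" "v = Q ! j" "a < j" "j < ?n"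
        by (auto simp: in_set_conv_nth)
      then show "u \<noteq> v \<and> \<not> E u v" using Qne[of i j] ipath_nthE[OF Q, of i j] by auto
    qed
    moreover have "apart (set l) (set (y # rest))" if "set l \<subseteq> set Q - {?c}" for l
      unfolding apart_def
    proof (intro ballI)
      fix u v assume u: "u \<in> set l" and v: "v \<in> set (y # rest)"
      have "u \<in> set Q" using u that by blast
      then obtain i where i: "u = Q ! i" "i < ?n" by (auto simp: in_set_conv_nth)
      obtain j where j: "v = (y # rest) ! j" "j < length (y # rest)" using v by (metis in_set_conv_nth)
      have "i \<noteq> a" using i u that by auto
      then have "\<not> E y (Q ! i)" using bd[of i] i 1 by auto
      then show "u \<noteq> v \<and> \<not> E u v" using QM[of i j] i j by auto
    qed
    moreover have "set ?l0 \<subseteq> set Q - {?c}" "set ?l1 \<subseteq> set Q - {?c}"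
    proof -
      have "distinct Q" using Q by (simp add: ipath_def)
      then have "distinct (take a Q @ Q ! a # drop (Suc a) Q)" by (simp add: id_take_nth_drop[OF a(1), symmetric])
      then show "set ?l0 \<subseteq> set Q - {?c}" "set ?l1 \<subseteq> set Q - {?c}" by (auto dest: in_set_takeD in_set_dropD)
    qed
    ultimately have "\<exists>A. claw p A \<and> A \<subseteq> insert ?c (set ?l0 \<union> set ?l1 \<union> set (y # rest))"
      using pa pb a len 1 by (intro clawI) auto
    moreover have "insert ?c (set ?l0 \<union> set ?l1 \<union> set (y # rest)) \<subseteq> set Q \<union> set (y # rest)"
      using a by (auto dest: in_set_takeD in_set_dropD)
    ultimately show ?thesis unfolding tripod_def by blast
  next
    case 2
    have "\<exists>A. line_claw p A \<and> A \<subseteq> set ?l \<union> set ?r \<union> set (y # rest)"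
    proof (rule line_clawI[OF il ir M])
      show "p \<le> length ?l" "p \<le> length ?r" "p \<le> length (y # rest)" using pa pb lenl lenr len by auto
    next
      fix i j assume "i < length ?l" "j < length ?r"
      then have ij: "i < Suc a" "j < ?n - b" using lenl by auto
      show "?l ! i \<noteq> ?r ! j \<and> E (?l ! i) (?r ! j) = (i = 0 \<and> j = 0)"
        using ij ln[OF ij(1)] rn[OF ij(2)] Qne[of "a - i" "b + j"] ipath_nthE[OF Q, of "a - i" "b + j"] a b 2 by auto
    next
      fix i j assume ij0: "i < length ?l" "j < length (y # rest)"
      then have ij: "i < Suc a" using lenl by auto
      have "E y (Q ! (a - i)) \<longleftrightarrow> i = 0" using bd[of "a - i"] less_imp_diff_less[OF a(1), of i] a ij by (cases "i = 0") auto
      then show "?l ! i \<noteq> (y # rest) ! j \<and> E (?l ! i) ((y # rest) ! j) = (i = 0 \<and> j = 0)"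
        unfolding ln[OF ij] using QM[of "a - i" j] a ij ij0 by auto
    next
      fix i j assume ij0: "i < length ?r" "j < length (y # rest)"
      then have ij: "i < ?n - b" by auto
      have bi: "b + i < ?n" using ij by simp
      have "E y (Q ! (b + i)) \<longleftrightarrow> i = 0" using bd[of "b + i"] bi b ij by (cases "i = 0") auto
      then show "?r ! i \<noteq> (y # rest) ! j \<and> E (?r ! i) ((y # rest) ! j) = (i = 0 \<and> j = 0)"
        unfolding rn[OF ij] using QM[of "b + i" j] b ij ij0 by auto
    qed
    then show ?thesis using sl unfolding tripod_def by blast
  next
    case 3
    have "ipath (y # ?l)"
    proof (rule ipath_Cons[OF il])
      show "y \<notin> set ?l" using yQ sl by blast
      fix i assume "i < length ?l"
      then have ij: "i < Suc a" using lenl by auto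
      show "E y (?l ! i) \<longleftrightarrow> i = 0" unfolding ln[OF ij] using bd[of "a - i"] less_imp_diff_less[OF a(1), of i] a ij by (cases "i = 0") auto
    qed
    moreover have "ipath (y # ?r)"
    proof (rule ipath_Cons[OF ir])
      show "y \<notin> set ?r" using yQ sl by blast
      fix i assume "i < length ?r"
      then have ij: "i < ?n - b" by auto
      have bi: "b + i < ?n" using ij by simp
      show "E y (?r ! i) \<longleftrightarrow> i = 0" unfolding rn[OF ij] using bd[of "b + i"] bi b ij by (cases "i = 0") auto
    qed
    moreover have "apart (set ?l) (set ?r)"
      unfolding apart_def
    proof (intro ballI)
      fix u v assume "u \<in> set ?l" "v \<in> set ?r"
      then obtain i j where ij0: "u = ?l ! i" "v = ?r ! j" "i < length ?l" "j < length ?r" by (metis in_set_conv_nth)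
      then have ij: "i < Suc a" "j < ?n - b" using lenl by auto
      show "u \<noteq> v \<and> \<not> E u v" unfolding ij0 ln[OF ij(1)] rn[OF ij(2)]
        using ij Qne[of "a - i" "b + j"] ipath_nthE[OF Q, of "a - i" "b + j"] a b 3 by auto
    qed
    moreover have "apart (set ?l) (set rest)" "apart (set ?r) (set rest)"
    proof -
      have "apart (set Q) (set rest)" unfolding apart_def
      proof (intro ballI)
        fix u v assume "u \<in> set Q" "v \<in> set rest"
        then show "u \<noteq> v \<and> \<not> E u v" using disj rest[of v u] sym[of u v] by auto
      qed
      then show "apart (set ?l) (set rest)" "apart (set ?r) (set rest)"
        using apart_mono[OF _ sl(1) order_refl] apart_mono[OF _ sl(2) order_refl] by blast+
    qed
    ultimately have "\<exists>A. claw p A \<and> A \<subseteq> insert y (set ?l \<union> set ?r \<union> set rest)"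
      using M pa pb lenl lenr len by (intro clawI) auto
    moreover have "insert y (set ?l \<union> set ?r \<union> set rest) \<subseteq> set Q \<union> set (y # rest)" using sl by auto
    ultimately show ?thesis unfolding tripod_def by blast
  qed
qed

text \<open>
  Three far apart legs that are attached by their first vertices to a connected set \<open>S\<close> give a tripod or its line graph.
  Two legs are joined by a shortest path through \<open>S\<close> to an induced path, and the third leg is extended through \<open>S\<close> until it first
  sees that path. It cannot see the outer parts of the first two legs, since only their first vertices
  have neighbours in \<open>S\<close>, so that \<open>spider\<close> applies.
\<close>
lemma three_legs:
  assumes S: "conn S"
    and ip: "\<And>i. i < 3 \<Longrightarrow> ipath (L i) \<and> p < length (L i) \<and> set (L i) \<inter> S = {}"
    and far: "\<And>i j. i < 3 \<Longrightarrow> j < 3 \<Longrightarrow> i \<noteq> j \<Longrightarrow> apart (set (L i)) (set (L j))"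
    and att: "\<And>i. i < (3::nat) \<Longrightarrow> \<exists>s\<in>S. E (hd (L i)) s"
    and only: "\<And>i x s. i < 3 \<Longrightarrow> x \<in> set (L i) \<Longrightarrow> s \<in> S \<Longrightarrow> E x s \<Longrightarrow> x = hd (L i)"
  shows "\<exists>A. tripod p A \<and> A \<subseteq> S \<union> (\<Union>i<3. set (L i))"
proof -
  define L1 L2 L3 where "L1 = L 0" and "L2 = L 1" and "L3 = L 2"
  note Ldefs = L1_def L2_def L3_def
  have ip1: "ipath L1" "p < length L1" "set L1 \<inter> S = {}" "L1 \<noteq> []"
    and ip2: "ipath L2" "p < length L2" "set L2 \<inter> S = {}" "L2 \<noteq> []"
    and ip3: "ipath L3" "p < length L3" "set L3 \<inter> S = {}" "L3 \<noteq> []"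
    using ip[of 0] ip[of 1] ip[of 2] by (auto simp: Ldefs)
  have far12: "apart (set L1) (set L2)" and far13: "apart (set L3) (set L1)" and far23: "apart (set L3) (set L2)"
    using far by (auto simp: Ldefs)
  have o1: "\<And>x s. x \<in> set L1 \<Longrightarrow> s \<in> S \<Longrightarrow> E x s \<Longrightarrow> x = hd L1"
    and o2: "\<And>x s. x \<in> set L2 \<Longrightarrow> s \<in> S \<Longrightarrow> E x s \<Longrightarrow> x = hd L2"
    and o3: "\<And>x s. x \<in> set L3 \<Longrightarrow> s \<in> S \<Longrightarrow> E x s \<Longrightarrow> x = hd L3"
    using only by (auto simp: Ldefs)
  obtain s1 s2 s3 where s: "s1 \<in> S" "E (hd L1) s1" "s2 \<in> S" "E (hd L2) s2" "s3 \<in> S" "E (hd L3) s3"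
    using att[of 0] att[of 1] att[of 2] by (auto simp: Ldefs)
  obtain P where P: "P \<noteq> []" "ipath P" "set P \<subseteq> S" "hd P \<in> {s\<in>S. E (hd L1) s}" "last P \<in> {s\<in>S. E (hd L2) s}"
    "\<And>z. z \<in> set P \<Longrightarrow> z \<in> {s\<in>S. E (hd L1) s} \<Longrightarrow> z = hd P"
    "\<And>z. z \<in> set P \<Longrightarrow> z \<in> {s\<in>S. E (hd L2) s} \<Longrightarrow> z = last P"
    using conn_geodesic[OF S s(1) _ s(3), of "{s\<in>S. E (hd L1) s}" "{s\<in>S. E (hd L2) s}"] s by auto
  have PL2: "ipath (P @ L2)"
  proof (rule ipath_append_set[OF P(2) ip2(1) P(1) ip2(4)])
    show "set P \<inter> set L2 = {}" using P(3) ip2 by blast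
    show "E (last P) (hd L2)" using P(5) sym by blast
    fix x y assume "x \<in> set P" "y \<in> set L2" "E x y"
    then show "x = last P \<and> y = hd L2" using o2[of y x] P(3) P(7)[of x] sym by blast
  qed
  \<comment> \<open>The vertices of \<open>P\<close> lie in \<open>S\<close> and only its ends are adjacent to the first vertices of the two legs.\<close>
  define Q where "Q = rev L1 @ P @ L2"
  have Q: "ipath Q" unfolding Q_def
  proof (rule ipath_append_set[OF ipath_rev[OF ip1(1)] PL2])
    show "set (rev L1) \<inter> set (P @ L2) = {}" using P(3) ip1 far12 by (auto simp: apart_def)
    show "E (last (rev L1)) (hd (P @ L2))" using P(1,4) by (simp add: last_rev)
    fix x y assume xy: "x \<in> set (rev L1)" "y \<in> set (P @ L2)" "E x y"
    then have "y \<in> set P" using far12 by (auto simp: apart_def)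
    then show "x = last (rev L1) \<and> y = hd (P @ L2)"
      using o1[of x y] P(1,3) P(6)[of y] xy by (auto simp: last_rev)
  qed (use ip1 P in auto)
  have setQ: "set Q = set L1 \<union> set P \<union> set L2" by (auto simp: Q_def)
  have rng: "p \<le> k \<and> k + p < length Q" if k: "k < length Q"
    "Q ! k \<in> set L1 \<longrightarrow> Q ! k = hd L1" "Q ! k \<in> set L2 \<longrightarrow> Q ! k = hd L2" for k
  proof -
    have dQ: "distinct Q" using Q by (simp add: ipath_def)
    have *: "length L1 - 1 \<le> k"
    proof (rule ccontr)
      assume "\<not> ?thesis"
      have lt: "length L1 - 1 < length Q" unfolding Q_def using ip1(4) by (cases L1) auto
      from \<open>\<not> length L1 - 1 \<le> k\<close> have "k < length L1 - 1" by simp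
      then have "Q ! k \<in> set L1" by (auto simp: Q_def nth_append rev_nth)
      then have "Q ! k = hd L1" using k by blast
      also have "\<dots> = Q ! (length L1 - 1)" using ip1(4) by (auto simp: Q_def nth_append rev_nth hd_conv_nth)
      finally have "k = length L1 - 1"
        using nth_eq_iff_index_eq[OF dQ k(1) lt] by blast
      then show False using \<open>k < length L1 - 1\<close> by simp
    qed
    moreover have "k \<le> length L1 + length P"
    proof (rule ccontr)
      let ?m = "length L1 + length P"
      assume "\<not> ?thesis"
      then have m: "?m < k" by simp
      then have "Q ! k = L2 ! (k - ?m)" by (auto simp: Q_def nth_append)
      moreover have "k - ?m < length L2" using m k(1) by (auto simp: Q_def)
      ultimately have "Q ! k = hd L2" using k by auto
      also have "\<dots> = Q ! ?m" using ip2(4) by (auto simp: Q_def nth_append hd_conv_nth)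
      finally have "k = ?m" using nth_eq_iff_index_eq[OF dQ k(1), of ?m] m k(1) by simp
      then show False using m by simp
    qed
    ultimately show ?thesis using ip1(2) ip2(2) by (auto simp: Q_def)
  qed
  have res: "\<exists>A. tripod p A \<and> A \<subseteq> set Q \<union> set M"
    if M: "ipath M" "M \<noteq> []" "set M \<inter> set Q = {}" "\<And>x q. x \<in> set (tl M) \<Longrightarrow> q \<in> set Q \<Longrightarrow> \<not> E x q"
      "q0 \<in> set Q" "E (hd M) q0" "p < length M" "hd M \<in> S \<or> hd M = hd L3" for M q0
  proof -
    obtain y rest where yr: "M = y # rest" using M(2) by (cases M) auto
    obtain k0 where k0: "k0 < length Q" "q0 = Q ! k0" using M(5) by (metis in_set_conv_nth)
    have "p \<le> k \<and> k + p < length Q" if "k < length Q" "E y (Q ! k)" for k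
    proof (rule rng[OF that(1)])
      have y: "y \<in> S \<or> y \<in> set L3" using M(8) yr ip3(4) by auto
      show "Q ! k \<in> set L1 \<longrightarrow> Q ! k = hd L1" using o1[of "Q!k" y] far13 y that(2) sym by (auto simp: apart_def)
      show "Q ! k \<in> set L2 \<longrightarrow> Q ! k = hd L2" using o2[of "Q!k" y] far23 y that(2) sym by (auto simp: apart_def)
    qed
    then show ?thesis using spider[OF Q, of y rest k0 p] M k0 yr by auto
  qed
  have L3Q: "set L3 \<inter> set Q = {}" using ip3 P(3) far13 far23 setQ by (auto simp: apart_def)
  have sub: "set Q \<subseteq> S \<union> (\<Union>i<3. set (L i))" "set L3 \<subseteq> S \<union> (\<Union>i<3. set (L i))"
    using P(3) setQ by (auto simp: UN_less_3 Ldefs)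
  show ?thesis
  proof (cases "\<exists>q\<in>set Q. E (hd L3) q")
    case True
    then obtain q0 where q0: "q0 \<in> set Q" "E (hd L3) q0" by blast
    have "\<not> E x q" if x: "x \<in> set (tl L3)" "q \<in> set Q" for x q
    proof
      assume e: "E x q"
      have xL: "x \<in> set L3" using x(1) by (cases L3) auto
      then have "q \<in> S" using x(2) e far13 far23 P(3) setQ by (auto simp: apart_def)
      then have "x = hd L3" using o3[OF xL _ e] by simp
      then show False using x(1) ip3(1,4) by (cases L3) (auto simp: ipath_def)
    qed
    then have "\<exists>A. tripod p A \<and> A \<subseteq> set Q \<union> set L3" using res[OF ip3(1,4) L3Q _ q0 ip3(2)] by simp
    then show ?thesis using sub by blast
  next
    case False
    let ?X = "{s\<in>S. E (hd L3) s}" and ?T = "{s\<in>S. s \<in> set Q \<or> (\<exists>q\<in>set Q. E s q)}"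
    have "hd P \<in> ?T" using P(1,4) setQ by auto
    then obtain R where R: "R \<noteq> []" "ipath R" "set R \<subseteq> S" "hd R \<in> ?X" "last R \<in> ?T"
      "\<And>z. z \<in> set R \<Longrightarrow> z \<in> ?X \<Longrightarrow> z = hd R" "\<And>z. z \<in> set R \<Longrightarrow> z \<in> ?T \<Longrightarrow> z = last R"
      using conn_geodesic[OF S s(5), of ?X "hd P" ?T] s P(4) by auto
    \<comment> \<open>If the extension of the third leg ended on \<open>Q\<close>, then the vertex before would already be adjacent to \<open>Q\<close>.\<close>
    have lastQ: "last R \<notin> set Q"
    proof
      assume l: "last R \<in> set Q"
      show False
      proof (cases "length R = 1")
        case True
        then have "hd R = last R" by (cases R) auto
        then show False using False R(4) l by auto
      next
        case f: False
        then have lr: "length R \<ge> 2" using R(1) by (cases R) (auto simp: Suc_le_eq)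
        let ?z = "R ! (length R - 2)"
        have z: "?z \<in> set R" using lr by simp
        have "E ?z (last R)" using ipath_nthE[OF R(2), of "length R - 2" "length R - 1"] lr R(1)
          by (auto simp: last_conv_nth)
        then have "?z \<in> ?T" using l z R(3) by blast
        then have "?z = last R" using R(7) z by blast
        then show False using \<open>E ?z (last R)\<close> irrefl by simp
      qed
    qed
    let ?M = "rev R @ L3"
    have M: "ipath ?M"
    proof (rule ipath_append_set[OF ipath_rev[OF R(2)] ip3(1)])
      show "set (rev R) \<inter> set L3 = {}" using R(3) ip3 by auto
      show "E (last (rev R)) (hd L3)" using R(1,4) sym by (simp add: last_rev)
      fix x y assume xy: "x \<in> set (rev R)" "y \<in> set L3" "E x y"
      then have "y = hd L3" using o3[of y x] R(3) sym by auto
      then show "x = last (rev R) \<and> y = hd L3" using R(6)[of x] xy R(1,3) sym by (auto simp: last_rev)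
    qed (use R ip3 in auto)
    have hdM: "hd ?M = last R" using R(1) by (simp add: hd_append hd_rev)
    have dR: "distinct ?M" using M by (simp add: ipath_def)
    obtain q0 where q0: "q0 \<in> set Q" "E (hd ?M) q0" using R(5) lastQ hdM by auto
    have noT: "z \<notin> ?T" if "z \<in> set (tl ?M)" "z \<in> set R" for z
    proof
      assume "z \<in> ?T"
      then have "z = hd ?M" using R(7) that hdM by auto
      then show False using that hd_notin_set_tl[OF dR] R(1) by simp
    qed
    have L3n: "\<not> E x q" if "x \<in> set L3" "q \<in> set Q" for x q
    proof
      assume e: "E x q"
      then have "q \<in> S" using that far13 far23 P(3) setQ by (auto simp: apart_def)
      then have "x = hd L3" using o3[OF that(1) _ e] by simp
      then show False using False e that by blast
    qed
    have tlM: "set (tl ?M) \<subseteq> set R \<union> set L3" using set_tl_subset[of ?M] by simp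
    have "\<not> E x q" if x: "x \<in> set (tl ?M)" "q \<in> set Q" for x q
      using noT[of x] L3n[of x q] tlM x R(3) by blast
    moreover have "set ?M \<inter> set Q = {}"
    proof -
      have "z \<notin> set Q" if "z \<in> set R" for z
      proof
        assume "z \<in> set Q"
        then have "z = last R" using R(3,7) that by blast
        then show False using lastQ \<open>z \<in> set Q\<close> by simp
      qed
      then show ?thesis using L3Q by auto
    qed
    moreover have "hd ?M \<in> S" using hdM R(5) by auto
    ultimately have "\<exists>A. tripod p A \<and> A \<subseteq> set Q \<union> set ?M"
      using res[OF M _ _ _ q0] R(1) ip3(2) by auto
    moreover have "set ?M \<subseteq> S \<union> (\<Union>i<3. set (L i))" using R(3) sub(2) by auto
    ultimately show ?thesis using sub(1) by blast
  qed
qed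

section \<open>Neighbourhoods and balls\<close>

definition nbhd :: "'a set \<Rightarrow> 'a set \<Rightarrow> 'a set" where
  "nbhd V D = {y \<in> V - D. \<exists>x\<in>D. E x y}"

lemma nbhd_sub: "nbhd V D \<subseteq> V - D" by (auto simp: nbhd_def)

primrec ball :: "'a set \<Rightarrow> 'a set \<Rightarrow> nat \<Rightarrow> 'a set" where
  "ball V A 0 = A"
| "ball V A (Suc n) = ball V A n \<union> nbhd V (ball V A n)"

lemma ball_sub: "A \<subseteq> V \<Longrightarrow> ball V A n \<subseteq> V"
  by (induction n) (auto simp: nbhd_def)

lemma ball_mono_n: "m \<le> n \<Longrightarrow> ball V A m \<subseteq> ball V A n"
  by (rule lift_Suc_mono_le[of "ball V A"]) auto

lemma ball_step: "x \<in> ball V A n \<Longrightarrow> y \<in> V \<Longrightarrow> E x y \<Longrightarrow> y \<in> ball V A (Suc n)"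
  by (auto simp: nbhd_def)

lemma ball_mono: "A \<subseteq> B \<Longrightarrow> ball V A n \<subseteq> ball V B n"
  by (induction n) (auto simp: nbhd_def)

lemma walk_snoc: "walk xs \<Longrightarrow> E (last xs) y \<Longrightarrow> walk (xs @ [y])"
  by (auto simp: walk_def successively_append_iff)

lemma ball_walk:
  assumes "A \<subseteq> V" "y \<in> ball V A n"
  shows "\<exists>xs. walk xs \<and> hd xs \<in> A \<and> last xs = y \<and> set xs \<subseteq> ball V A n \<and> length xs \<le> Suc n"
  using assms(2)
proof (induction n arbitrary: y)
  case 0
  then show ?case by (intro exI[of _ "[y]"]) (auto simp: walk_def)
next
  case (Suc n)
  show ?case
  proof (cases "y \<in> ball V A n")
    case True
    then obtain xs where "walk xs \<and> hd xs \<in> A \<and> last xs = y \<and> set xs \<subseteq> ball V A n \<and> length xs \<le> Suc n"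
      using Suc.IH by blast
    then show ?thesis by (intro exI[of _ xs]) auto
  next
    case False
    then obtain x where x: "x \<in> ball V A n" "E x y" using Suc.prems by (auto simp: nbhd_def)
    obtain xs where xs: "walk xs" "hd xs \<in> A" "last xs = x" "set xs \<subseteq> ball V A n" "length xs \<le> Suc n"
      using Suc.IH[OF x(1)] by blast
    have "walk (xs @ [y])" using walk_snoc xs x by auto
    moreover have "hd (xs @ [y]) = hd xs" using xs(1) by (auto simp: walk_def)
    ultimately show ?thesis using xs Suc.prems by (intro exI[of _ "xs @ [y]"]) auto
  qed
qed

lemma walk_ball:
  "walk xs \<Longrightarrow> set xs \<subseteq> V \<Longrightarrow> hd xs \<in> ball V A n \<Longrightarrow> last xs \<in> ball V A (n + length xs - 1)"
proof (induction xs arbitrary: n)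
  case (Cons x xs)
  show ?case
  proof (cases xs)
    case Nil then show ?thesis using Cons.prems by auto
  next
    case (Cons y ys)
    have "y \<in> ball V A (Suc n)" using Cons.prems Cons by (intro ball_step[of x]) (auto simp: walk_def)
    then have "last xs \<in> ball V A (Suc n + length xs - 1)"
      using Cons.IH[of "Suc n"] Cons.prems Cons by (auto simp: walk_def)
    then show ?thesis using Cons by auto
  qed
qed (simp add: walk_def)

lemma ball_conn: "x \<in> V \<Longrightarrow> conn (ball V {x} n)"
proof (rule connI_center[of _ x])
  fix y assume "x \<in> V" "y \<in> ball V {x} n"
  then show "\<exists>xs. walk xs \<and> hd xs = x \<and> last xs = y \<and> set xs \<subseteq> ball V {x} n"
    using ball_walk[of "{x}" V y n] by auto
qed

text \<open>
  Two adjacent or equal points of the balls would give a walk of length at most \<open>2 * p + 1\<close> between the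
  centres.
\<close>
lemma ball_apart:
  assumes "x \<in> V" "y \<in> V" "x \<notin> ball V {y} (2 * p + 1)"
  shows "apart (ball V {x} p) (ball V {y} p)"
  unfolding apart_def
proof (intro ballI)
  fix a b assume a: "a \<in> ball V {x} p" and b: "b \<in> ball V {y} p"
  obtain xs where xs: "walk xs" "hd xs = x" "last xs = a" "set xs \<subseteq> ball V {x} p" "length xs \<le> Suc p"
    using ball_walk[of "{x}" V a p] assms a by auto
  have w: "walk (rev xs)" "hd (rev xs) = a" "last (rev xs) = x"
    using xs walk_rev by (auto simp: hd_rev last_rev walk_def)
  have sub: "set (rev xs) \<subseteq> V" using xs(4) ball_sub[of "{x}" V p] assms by auto
  have "a \<notin> ball V {y} (Suc p)"
  proof
    assume "a \<in> ball V {y} (Suc p)"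
    then have "x \<in> ball V {y} (Suc p + length xs - 1)"
      using walk_ball[OF w(1) sub, of "{y}" "Suc p"] w by auto
    moreover have "Suc p + length xs - 1 \<le> 2 * p + 1" using xs(5) by simp
    ultimately show False using assms(3) ball_mono_n by blast
  qed
  moreover have "a \<in> V" using a ball_sub[of "{x}" V p] assms by auto
  moreover have "b \<in> ball V {y} (Suc p)" using b by simp
  ultimately show "a \<noteq> b \<and> \<not> E a b"
    using ball_step[OF b, of a] sym[of a b] by blast
qed

lemma tripod_card:
  assumes "tripod p A" shows "finite A" "card A \<le> 3 * p + 1"
proof -
  have 1: "card (set xs \<union> set ys \<union> set zs) \<le> 3 * p" if "length xs = p" "length ys = p" "length zs = p"
    for xs ys zs :: "'a list"
    using card_Un_le[of "set xs \<union> set ys" "set zs"] card_Un_le[of "set xs" "set ys"]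
      card_length[of xs] card_length[of ys] card_length[of zs] that by linarith
  have "finite A \<and> card A \<le> 3 * p + 1"
  proof (cases "claw p A")
    case True
    then obtain c L where L: "\<forall>i<3. length (L i) = p" "A = insert c (\<Union>i<3::nat. set (L i))"
      unfolding claw_def by blast
    then show ?thesis using 1[of "L 0" "L 1" "L 2"] card_insert_le_m1
      by (auto simp: UN_less_3 card_insert_if)
  next
    case False
    then obtain L where L: "\<forall>i<3. length (L i) = p" "A = (\<Union>i<3::nat. set (L i))"
      using assms unfolding tripod_def line_claw_def by blast
    then show ?thesis using 1[of "L 0" "L 1" "L 2"] by (auto simp: UN_less_3)
  qed
  then show "finite A" "card A \<le> 3 * p + 1" by auto
qed

end

section \<open>Tangles\<close>

text \<open>
  \<open>W\<close> is a set that no set of at most \<open>\<kappa>\<close> vertices can split: after the removal of such a set, one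
  component still contains all but \<open>c\<close> vertices of \<open>W\<close>. The assumption \<open>3 * c < card W\<close> makes any two
  such components intersect. This is the form in which large tree-width is used.
\<close>
locale tangled = sgraph +
  fixes V W :: "'a set" and \<kappa> c :: nat
  assumes fin: "finite V" and WV: "W \<subseteq> V" and Wbig: "3 * c < card W"
    and comp: "\<And>Y. Y \<subseteq> V \<Longrightarrow> card Y \<le> \<kappa> \<Longrightarrow>
      \<exists>C. C \<subseteq> V - Y \<and> conn C \<and> (\<forall>x\<in>C. \<forall>y\<in>V - Y. E x y \<longrightarrow> y \<in> C) \<and> card (W - C) \<le> c"
begin

definition \<beta> :: "'a set \<Rightarrow> 'a set" where
  "\<beta> Y = (SOME C. C \<subseteq> V - Y \<and> conn C \<and> (\<forall>x\<in>C. \<forall>y\<in>V - Y. E x y \<longrightarrow> y \<in> C) \<and> card (W - C) \<le> c)"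

lemma \<beta>:
  assumes "Y \<subseteq> V" "card Y \<le> \<kappa>"
  shows "\<beta> Y \<subseteq> V - Y" "conn (\<beta> Y)" "\<And>x y. x \<in> \<beta> Y \<Longrightarrow> y \<in> V - Y \<Longrightarrow> E x y \<Longrightarrow> y \<in> \<beta> Y" "card (W - \<beta> Y) \<le> c"
  using someI_ex[OF comp[OF assms]] unfolding \<beta>_def[symmetric] by blast+

lemma finW: "finite W" using WV fin finite_subset by blast

lemma meet: 
  assumes "card (W - A) \<le> c" "card (W - B) \<le> c"
  obtains w where "w \<in> W" "w \<in> A" "w \<in> B"
proof -
  have "W \<inter> A \<inter> B \<noteq> {}"
  proof
    assume "W \<inter> A \<inter> B = {}"
    then have "W \<subseteq> (W - A) \<union> (W - B)" by blast
    then have "card W \<le> card ((W - A) \<union> (W - B))" using finW by (intro card_mono) auto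
    also have "\<dots> \<le> c + c" using card_Un_le[of "W - A" "W - B"] assms by linarith
    finally show False using Wbig by simp
  qed
  then show thesis using that by blast
qed

lemma absorb:
  assumes "Y \<subseteq> V" "card Y \<le> \<kappa>" "conn S" "S \<subseteq> V - Y" "x \<in> S" "x \<in> \<beta> Y"
  shows "S \<subseteq> \<beta> Y"
  by (rule conn_closed[OF assms(3,5,6)]) (use assms \<beta>(3)[OF assms(1,2)] in blast)

lemma \<beta>_mono:
  assumes "Y \<subseteq> Y'" "Y' \<subseteq> V" "card Y' \<le> \<kappa>"
  shows "\<beta> Y' \<subseteq> \<beta> Y"
proof -
  have Y: "Y \<subseteq> V" "card Y \<le> \<kappa>"
    using assms card_mono[of Y' Y] finite_subset[OF assms(2) fin] by auto
  obtain w where "w \<in> \<beta> Y" "w \<in> \<beta> Y'" using meet[OF \<beta>(4)[OF Y] \<beta>(4)[OF assms(2,3)]] by blast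
  then show ?thesis using absorb[OF Y \<beta>(2)[OF assms(2,3)], of w] \<beta>(1)[OF assms(2,3)] assms(1) by blast
qed

text \<open>
  A set that is separated from the main component by some small set is also separated from it by its
  own neighbourhood, provided that the neighbourhood is small.
\<close>
lemma sep_nbhd:
  assumes "D \<subseteq> V" "Y \<subseteq> V" "card Y \<le> \<kappa>" "D \<inter> \<beta> Y = {}" "card (nbhd V D) \<le> \<kappa>"
  shows "D \<inter> \<beta> (nbhd V D) = {}"
proof -
  have N: "nbhd V D \<subseteq> V" using nbhd_sub by blast
  obtain z where z: "z \<in> \<beta> Y" "z \<in> \<beta> (nbhd V D)"
    using meet[OF \<beta>(4)[OF assms(2,3)] \<beta>(4)[OF N assms(5)]] by blast
  have "\<beta> (nbhd V D) \<subseteq> V - D - nbhd V D"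
  proof (rule conn_closed[OF \<beta>(2)[OF N assms(5)] z(2)])
    show "z \<in> V - D - nbhd V D" using z \<beta>(1)[OF N assms(5)] assms(4) by blast
    fix u v assume "u \<in> V - D - nbhd V D" "v \<in> \<beta> (nbhd V D)" "E u v"
    then show "v \<in> V - D - nbhd V D" using \<beta>(1)[OF N assms(5)] sym[of u v] by (auto simp: nbhd_def)
  qed
  then show ?thesis by blast
qed

end

section \<open>Tangles in which every vertex can be cut off\<close>

text \<open>
  The case without highly connected vertices: every single vertex can be cut off from the main component
  by at most \<open>k\<close> other vertices.
\<close>
locale thin = tangled +
  fixes k :: nat
  assumes k_pos: "1 \<le> k"
    and sep: "\<And>v. v \<in> V \<Longrightarrow> \<exists>Y\<subseteq>V. card Y \<le> k \<and> v \<notin> Y \<and> v \<notin> \<beta> Y"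
begin

text \<open>
  Bounded sets can be cut off without touching them. The separators of the single vertices of \<open>A\<close> may
  contain other vertices of \<open>A\<close>, but the union \<open>D\<close> of the regions that they cut off contains \<open>A\<close>, and its
  neighbourhood is contained in the union of the separators.
\<close>
lemma region0:
  assumes "A \<subseteq> V" "card A * k \<le> \<kappa>"
  shows "\<exists>D. A \<subseteq> D \<and> D \<subseteq> V \<and> card (nbhd V D) \<le> card A * k \<and> D \<inter> \<beta> (nbhd V D) = {}"
proof (cases "A = {}")
  case True
  then show ?thesis by (intro exI[of _ "{}"]) (auto simp: nbhd_def)
next
  case False
  have finA: "finite A" using assms(1) fin finite_subset by blast
  have kk: "k \<le> \<kappa>" using assms(2) False finA k_pos
    by (metis card_gt_0_iff le_trans mult_le_mono1 nat_mult_1 Suc_leI One_nat_def)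
  obtain F where F: "\<And>v. v \<in> A \<Longrightarrow> F v \<subseteq> V \<and> card (F v) \<le> k \<and> v \<notin> F v \<and> v \<notin> \<beta> (F v)"
    using sep assms(1) by (metis subsetD)
  let ?Y = "\<Union>v\<in>A. F v"
  define D where "D = (\<Union>v\<in>A. V - (F v \<union> \<beta> (F v)))"
  have YV: "?Y \<subseteq> V" using F by blast
  have cY: "card ?Y \<le> card A * k"
    using card_UN_le[OF finA, of F] sum_bounded_above[of A "\<lambda>v. card (F v)" k] F by (simp add: le_trans)
  have AD: "A \<subseteq> D" "D \<subseteq> V" using F assms(1) by (auto simp: D_def)
  have NY: "nbhd V D \<subseteq> ?Y"
  proof
    fix y assume y: "y \<in> nbhd V D"
    then obtain x v where x: "v \<in> A" "x \<in> V - (F v \<union> \<beta> (F v))" "E x y" "y \<in> V" "y \<notin> D"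
      by (auto simp: nbhd_def D_def)
    then have "y \<in> F v \<union> \<beta> (F v)" by (auto simp: D_def)
    moreover have "y \<notin> \<beta> (F v)"
      using \<beta>(3)[of "F v" y x] F[OF x(1)] kk x sym by auto
    ultimately show "y \<in> ?Y" using x by blast
  qed
  have cN: "card (nbhd V D) \<le> card A * k"
    using card_mono[OF finite_subset[OF YV fin] NY] cY by simp
  have "D \<inter> \<beta> ?Y = {}"
  proof -
    have "\<beta> ?Y \<subseteq> \<beta> (F v)" if "v \<in> A" for v
      by (rule \<beta>_mono) (use that YV cY assms(2) in auto)
    then show ?thesis by (auto simp: D_def)
  qed
  then have "D \<inter> \<beta> (nbhd V D) = {}"
    using sep_nbhd[of D ?Y] AD YV cY cN assms(2) by auto
  then show ?thesis using AD cN by blast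
qed

text \<open>
  Cutting off the neighbourhood of the region again and again puts a whole ball around \<open>A\<close> into the region, at the cost
  of a bounded factor in each round.
\<close>
lemma region:
  assumes "A \<subseteq> V" "2 * card A * k ^ Suc R \<le> \<kappa>"
  shows "\<exists>D. ball V A R \<subseteq> D \<and> D \<subseteq> V \<and> card (nbhd V D) \<le> card A * k ^ Suc R \<and> D \<inter> \<beta> (nbhd V D) = {}"
  using assms(2)
proof (induction R)
  case 0
  then show ?case using region0[OF assms(1)] by simp
next
  case (Suc R)
  have pw: "card A * k ^ Suc R \<le> card A * k ^ Suc (Suc R)" using k_pos by simp
  have pr: "2 * (card A * k ^ Suc (Suc R)) \<le> \<kappa>" using Suc.prems by (simp only: mult.assoc)
  have "2 * card A * k ^ Suc R \<le> \<kappa>" unfolding mult.assoc using pw pr by linarith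
  then obtain D where D: "ball V A R \<subseteq> D" "D \<subseteq> V" "card (nbhd V D) \<le> card A * k ^ Suc R" "D \<inter> \<beta> (nbhd V D) = {}"
    using Suc.IH by blast
  have le: "card (nbhd V D) * k \<le> card A * k ^ Suc (Suc R)"
    using mult_le_mono1[OF D(3), of k] by (simp add: ac_simps)
  have NV: "nbhd V D \<subseteq> V" using nbhd_sub by blast
  obtain D2 where D2: "nbhd V D \<subseteq> D2" "D2 \<subseteq> V" "card (nbhd V D2) \<le> card (nbhd V D) * k" "D2 \<inter> \<beta> (nbhd V D2) = {}"
  proof -
    have "card (nbhd V D) * k \<le> \<kappa>" using le pr by linarith
    then show thesis using region0[OF NV] that by blast
  qed
  have N2V: "nbhd V D2 \<subseteq> V" using nbhd_sub by blast
  let ?D = "D \<union> D2" and ?Y = "nbhd V D \<union> nbhd V D2"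
  have cY: "card ?Y \<le> \<kappa>"
    using card_Un_le[of "nbhd V D" "nbhd V D2"] D(3) D2(3) le pw pr by linarith
  have NN: "nbhd V ?D \<subseteq> nbhd V D2" using D2(1) by (auto simp: nbhd_def)
  have c: "card (nbhd V ?D) \<le> card A * k ^ Suc (Suc R)"
    using card_mono[OF finite_subset[OF N2V fin] NN] D2(3) le by linarith
  have "\<beta> ?Y \<subseteq> \<beta> (nbhd V D)" "\<beta> ?Y \<subseteq> \<beta> (nbhd V D2)"
    using \<beta>_mono[of "nbhd V D" ?Y] \<beta>_mono[of "nbhd V D2" ?Y] NV N2V cY by auto
  then have "?D \<inter> \<beta> ?Y = {}" using D D2 by blast
  then have "?D \<inter> \<beta> (nbhd V ?D) = {}"
    using sep_nbhd[of ?D ?Y] D D2 NV N2V cY c pr by auto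
  moreover have "ball V A (Suc R) \<subseteq> ?D"
    using D(1) D2(1) by (auto simp: nbhd_def)
  ultimately show ?case using D(2) D2(2) c by (intro exI[of _ ?D]) auto
qed

text \<open>
  Choose three vertices of \<open>W\<close> such that none of them is cut off from the main component together with
  a ball around the other two; \<open>free_set\<close> provides them, because the region around a pair contains few vertices of
  \<open>W\<close>. Each of the three can then be joined to the common main component \<open>C\<close> without
  entering the balls around the other two. What lies outside the three balls on these connections forms, together
  with \<open>C\<close>, the connected set to which \<open>three_legs\<close> is applied; the legs are shortest paths inside the balls.
\<close>
lemma thin_tripod:
  assumes \<kappa>: "12 * k ^ (2 * p + 2) \<le> \<kappa>"
    and free: "\<And>f. (\<forall>P. finite (f P) \<and> card (f P) \<le> c) \<Longrightarrow> (\<exists>X\<subseteq>W. finite X \<and> card X = 3 \<and>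
      (\<forall>u\<in>X. \<forall>v\<in>X. \<forall>w\<in>X. u \<noteq> v \<and> w \<noteq> u \<and> w \<noteq> v \<longrightarrow> w \<notin> f {u, v}))"
  shows "\<exists>A. tripod p A \<and> A \<subseteq> V"
proof -
  \<comment> \<open>Vertices at distance more than \<open>2 * p + 1\<close> have balls of radius \<open>p\<close> that are apart.\<close>
  define R where "R = 2 * p + 1"
  define K where "K = 2 * k ^ Suc R"
  have \<kappa>K: "6 * K \<le> \<kappa>" using \<kappa> by (simp add: K_def R_def)
  have reg: "\<exists>D. P \<subseteq> V \<and> card P = 2 \<longrightarrow> ball V P R \<subseteq> D \<and> D \<subseteq> V \<and> card (nbhd V D) \<le> K \<and> D \<inter> \<beta> (nbhd V D) = {}" for P
  proof (cases "P \<subseteq> V \<and> card P = 2")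
    case True
    then have "2 * card P * k ^ Suc R \<le> \<kappa>" "card P * k ^ Suc R = K" using \<kappa>K by (simp_all add: K_def)
    from region[OF _ this(1)] this(2) True show ?thesis by auto
  qed blast
  obtain Df where Df: "\<And>P. P \<subseteq> V \<Longrightarrow> card P = 2 \<Longrightarrow> ball V P R \<subseteq> Df P \<and> Df P \<subseteq> V \<and> card (nbhd V (Df P)) \<le> K \<and> Df P \<inter> \<beta> (nbhd V (Df P)) = {}"
    using reg by metis
  define f where "f P = (if P \<subseteq> V \<and> card P = 2 then W - \<beta> (nbhd V (Df P)) else {})" for P
  have nbV: "nbhd V D \<subseteq> V" for D using nbhd_sub by blast
  have "\<forall>P. finite (f P) \<and> card (f P) \<le> c"
  proof
    fix P show "finite (f P) \<and> card (f P) \<le> c"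
      using finW \<beta>(4)[OF nbV, of "Df P"] Df[of P] \<kappa>K by (auto simp: f_def)
  qed
  from free[OF this] obtain X where X: "X \<subseteq> W" "card X = 3"
    "\<And>u v w. u\<in>X \<Longrightarrow> v\<in>X \<Longrightarrow> w\<in>X \<Longrightarrow> u \<noteq> v \<Longrightarrow> w \<noteq> u \<Longrightarrow> w \<noteq> v \<Longrightarrow> w \<notin> f {u, v}"
    by blast
  obtain x0 x1 x2 where x012: "X = {x0, x1, x2}" "x0 \<noteq> x1" "x1 \<noteq> x2" "x0 \<noteq> x2"
    using X(2) by (auto simp: card_3_iff)
  define x where "x = (\<lambda>i::nat. [x0,x1,x2] ! i)"
  define D where "D = (\<lambda>i::nat. Df ([{x1,x2},{x0,x2},{x0,x1}] ! i))"
  define Y where "Y i = nbhd V (D i)" for i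
  have xX: "x i \<in> X" if "i < 3" for i using that x012 by (auto simp: x_def less_Suc_eq numeral_3_eq_3)
  have xV: "x i \<in> V" if "i < 3" for i using xX[OF that] X(1) WV by blast
  have VX: "X \<subseteq> V" using X(1) WV by blast
  have DD: "D i \<subseteq> V \<and> card (Y i) \<le> K \<and> D i \<inter> \<beta> (Y i) = {} \<and> x i \<in> \<beta> (Y i)" if "i < 3" for i
  proof -
    have "i = 0 \<or> i = 1 \<or> i = 2" using that by auto
    then show ?thesis
      using Df[of "{x1,x2}"] Df[of "{x0,x2}"] Df[of "{x0,x1}"] X(3)[of x1 x2 x0] X(3)[of x0 x2 x1] X(3)[of x0 x1 x2]
        x012 VX X(1)
      by (elim disjE) (simp_all add: D_def Y_def x_def f_def)
  qed
  have YV: "Y i \<subseteq> V" for i using nbV by (simp add: Y_def)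
  have cY: "card (Y i) \<le> \<kappa>" if "i < 3" for i using DD[OF that] \<kappa>K by auto
  have bD: "ball V {x j} R \<subseteq> D i" if "i < 3" "j < 3" "i \<noteq> j" for i j
  proof -
    have *: "ball V {a} R \<subseteq> Df {a, b}" "ball V {b} R \<subseteq> Df {a, b}" if "a \<in> X" "b \<in> X" "a \<noteq> b" for a b
    proof -
      have "ball V {a, b} R \<subseteq> Df {a, b}" using Df[of "{a,b}"] that VX by auto
      then show "ball V {a} R \<subseteq> Df {a, b}" "ball V {b} R \<subseteq> Df {a, b}"
        using ball_mono[of "{a}" "{a,b}" V R] ball_mono[of "{b}" "{a,b}" V R] by blast+
    qed
    have "i = 0 \<or> i = 1 \<or> i = 2" "j = 0 \<or> j = 1 \<or> j = 2" using that by auto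
    then show ?thesis using *[of x0 x1] *[of x0 x2] *[of x1 x2] x012 that(3)
      by (elim disjE) (simp_all add: D_def x_def)
  qed
  let ?Z = "Y 0 \<union> Y 1 \<union> Y 2"
  \<comment> \<open>Outside all three separators, \<open>C\<close> is disjoint from the regions and thus from the balls.\<close>
  define C where "C = \<beta> ?Z"
  have cZ: "card ?Z \<le> \<kappa>"
    using card_Un_le[of "Y 0 \<union> Y 1" "Y 2"] card_Un_le[of "Y 0" "Y 1"] DD[of 0] DD[of 1] DD[of 2] \<kappa>K by simp
  have ZV: "?Z \<subseteq> V" using YV by blast
  have CY: "C \<subseteq> \<beta> (Y i)" if "i < 3" for i
  proof -
    have "i = 0 \<or> i = 1 \<or> i = 2" using that by auto
    then have "Y i \<subseteq> ?Z" by auto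
    then show ?thesis unfolding C_def by (rule \<beta>_mono[OF _ ZV cZ])
  qed
  have Cne: "C \<noteq> {}" using meet[OF \<beta>(4)[OF ZV cZ] \<beta>(4)[OF ZV cZ]] unfolding C_def by blast
  have Cconn: "conn C" unfolding C_def by (rule \<beta>(2)[OF ZV cZ])
  have CV: "C \<subseteq> V" unfolding C_def using \<beta>(1)[OF ZV cZ] by blast
  define U where "U i = ball V {x i} p" for i
  have UV: "U i \<subseteq> V" if "i < 3" for i unfolding U_def using ball_sub xV[OF that] by auto
  have UD: "U j \<subseteq> D i" if "i < 3" "j < 3" "i \<noteq> j" for i j
    unfolding U_def using bD[OF that] ball_mono_n[of p R V "{x j}"] by (auto simp: R_def)
  have Ub: "U j \<inter> \<beta> (Y i) = {}" if "i < 3" "j < 3" "i \<noteq> j" for i j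
    using UD[OF that] DD[OF that(1)] by blast
  have ex_other: "\<exists>j<3. j \<noteq> i" for i :: nat
    by (rule exI[of _ "if i = 0 then 1 else 0"]) auto
  have UC: "U i \<inter> C = {}" if "i < 3" for i
    using ex_other[of i] Ub[of _ i] CY that by blast
  have path: "\<exists>ys. ys \<noteq> [] \<and> tl ys \<noteq> [] \<and> walk (tl ys) \<and> set ys \<subseteq> \<beta> (Y i) \<and> hd ys \<in> U i \<and> last (tl ys) \<in> C \<and>
      set (tl ys) \<inter> U i = {} \<and> E (hd ys) (hd (tl ys))" if i: "i < 3" for i
  proof -
    obtain t where t: "t \<in> C" using Cne by blast
    have xU: "x i \<in> U i" unfolding U_def using ball_mono_n[of 0 p V "{x i}"] by auto
    have xb: "x i \<in> \<beta> (Y i)" and tb: "t \<in> \<beta> (Y i)" using DD[OF i] CY[OF i] t by auto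
    obtain ys where ys: "ys \<noteq> []" "ipath ys" "set ys \<subseteq> \<beta> (Y i)" "hd ys \<in> U i" "last ys \<in> C"
      "\<And>z. z \<in> set ys \<Longrightarrow> z \<in> U i \<Longrightarrow> z = hd ys"
      using conn_geodesic[OF \<beta>(2)[OF YV cY[OF i]] xb xU tb t] by metis
    have "last ys \<noteq> hd ys" using ys(4,5) UC[OF i] by auto
    then obtain h h2 tls where hs: "ys = h # h2 # tls" using ys(1) by (cases ys; cases "tl ys") auto
    have "walk ys" using ipath_walk ys by blast
    then have "walk (tl ys)" "E h h2" unfolding hs by (auto simp: walk_def)
    moreover have "set (tl ys) \<inter> U i = {}" using ys(6) hd_notin_set_tl[of ys] ys(1,2) set_tl_subset[of ys] by (auto simp: ipath_def)
    ultimately show ?thesis using ys hs by (intro exI[of _ ys]) auto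
  qed
  obtain P where P: "\<And>i. i < 3 \<Longrightarrow> P i \<noteq> [] \<and> tl (P i) \<noteq> [] \<and> walk (tl (P i)) \<and> set (P i) \<subseteq> \<beta> (Y i) \<and> hd (P i) \<in> U i \<and> last (tl (P i)) \<in> C \<and>
      set (tl (P i)) \<inter> U i = {} \<and> E (hd (P i)) (hd (tl (P i)))"
    using path by metis
  define S where "S = C \<union> set (tl (P 0)) \<union> set (tl (P 1)) \<union> set (tl (P 2))"
  have PS: "set (tl (P i)) \<subseteq> S" if "i < 3" for i
  proof -
    have "i = 0 \<or> i = 1 \<or> i = 2" using that by auto
    then show ?thesis by (auto simp: S_def)
  qed
  have add: "conn (T \<union> set (tl (P i)))" if "conn T" "C \<subseteq> T" "i < 3" for T i
  proof (rule conn_Un[OF that(1) conn_set_walk])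
    show "walk (tl (P i))" using P that by blast
    show "last (tl (P i)) \<in> T" "last (tl (P i)) \<in> set (tl (P i))" using P that by auto
  qed blast
  have Sconn: "conn S" unfolding S_def by (intro add) (use Cconn in auto)
  have tlb: "set (tl (P i)) \<subseteq> \<beta> (Y i)" if "i < 3" for i using P[OF that] set_tl_subset[of "P i"] by blast
  have tlV: "set (tl (P i)) \<subseteq> V" if "i < 3" for i using tlb[OF that] \<beta>(1)[OF YV cY[OF that]] by blast
  have SV: "S \<subseteq> V" using CV tlV[of 0] tlV[of 1] tlV[of 2] unfolding S_def by simp
  have SU: "S \<inter> U i = {}" if i: "i < 3" for i
  proof -
    have Pj: "set (tl (P j)) \<inter> U i = {}" if j: "j < 3" for j
      using P[OF i] tlb[OF j] Ub[OF j i] by (cases "i = j") auto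
    show ?thesis using UC[OF i] Pj[of 0] Pj[of 1] Pj[of 2] unfolding S_def by auto
  qed
  have apart: "apart (U i) (U j)" if "i < 3" "j < 3" "i \<noteq> j" for i j
    unfolding U_def
  proof (rule ball_apart[OF xV xV])
    have "x i \<notin> D i" using DD[OF that(1)] by auto
    then show "x i \<notin> ball V {x j} (2 * p + 1)" using bD[OF that] unfolding R_def by blast
  qed (use that in auto)
  have leg: "\<exists>ys. ipath ys \<and> p < length ys \<and> set ys \<subseteq> U i \<and> (\<exists>s\<in>S. E (hd ys) s) \<and>
     (\<forall>z\<in>set ys. \<forall>s\<in>S. E z s \<longrightarrow> z = hd ys)" if i: "i < 3" for i
  proof -
    let ?X = "{u. \<exists>s\<in>S. E u s}"
    have "hd (tl (P i)) \<in> S" using subsetD[OF PS[OF i] hd_in_set] P[OF i] by blast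
    then have h: "hd (P i) \<in> U i" "hd (P i) \<in> ?X" using P[OF i] by blast+
    have xU: "x i \<in> U i" unfolding U_def using ball_mono_n[of 0 p V "{x i}"] by auto
    obtain ys where ys: "ys \<noteq> []" "ipath ys" "set ys \<subseteq> U i" "hd ys \<in> ?X" "last ys \<in> {x i}"
      "\<And>z. z \<in> set ys \<Longrightarrow> z \<in> ?X \<Longrightarrow> z = hd ys"
      by (rule conn_geodesic[OF ball_conn[OF xV[OF i], of p, folded U_def] h xU singletonI]) (rule that)
    \<comment> \<open>The first vertex of the leg has a neighbour outside the ball of radius \<open>p\<close>, hence is at distance at least \<open>p\<close>.\<close>
    have "p < length ys"
    proof (rule ccontr)
      assume "\<not> ?thesis"
      then have lp: "length ys \<le> p" by simp
      have w: "walk (rev ys)" using walk_rev ipath_walk ys by blast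
      have "last (rev ys) \<in> ball V {x i} (0 + length (rev ys) - 1)"
        by (rule walk_ball[OF w]) (use ys UV[OF i] in \<open>auto simp: hd_rev\<close>)
      then have hb: "hd ys \<in> ball V {x i} (length ys - 1)" using ys(1) by (simp add: last_rev)
      obtain s where s: "s \<in> S" "E (hd ys) s" using ys(4) by blast
      then have "s \<in> ball V {x i} (Suc (length ys - 1))" using ball_step[OF hb] SV by blast
      then have "s \<in> U i" unfolding U_def
        using ball_mono_n[of "Suc (length ys - 1)" p V "{x i}"] lp ys(1) by (auto simp: Suc_le_eq)
      then show False using SU[OF i] s by blast
    qed
    then show ?thesis using ys by (intro exI[of _ ys]) auto
  qed
  obtain L where L: "\<And>i. i < 3 \<Longrightarrow> ipath (L i) \<and> p < length (L i) \<and> set (L i) \<subseteq> U i \<and> (\<exists>s\<in>S. E (hd (L i)) s) \<and>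
     (\<forall>z\<in>set (L i). \<forall>s\<in>S. E z s \<longrightarrow> z = hd (L i))"
    using leg by metis
  have "\<exists>A. tripod p A \<and> A \<subseteq> S \<union> (\<Union>i<3. set (L i))"
  proof (rule three_legs[OF Sconn])
    fix i :: nat assume i: "i < 3"
    show "ipath (L i) \<and> p < length (L i) \<and> set (L i) \<inter> S = {}" using L[OF i] SU[OF i] by blast
    show "\<exists>s\<in>S. E (hd (L i)) s" using L[OF i] by blast
  next
    fix i j :: nat assume "i < 3" "j < 3" "i \<noteq> j"
    then show "apart (set (L i)) (set (L j))" using apart_mono[OF apart] L by blast
  qed (use L in blast)
  moreover have "set (L i) \<subseteq> V" if "i < 3" for i using L[OF that] UV[OF that] by blast
  then have "S \<union> (\<Union>i<3. set (L i)) \<subseteq> V" using SV by (simp add: UN_less_3)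
  ultimately show ?thesis by blast
qed

end

section \<open>Graphs without large bicliques\<close>

context sgraph begin

text \<open>
  No complete bipartite subgraph, induced or not, with \<open>s\<close> vertices on each side.
\<close>
definition nobiclique :: "nat \<Rightarrow> 'a set \<Rightarrow> bool" where
  "nobiclique s V \<longleftrightarrow> \<not> (\<exists>X Y. X \<subseteq> V \<and> Y \<subseteq> V \<and> card X = s \<and> card Y = s \<and> (\<forall>x\<in>X. \<forall>y\<in>Y. E x y))"

lemma nobiclique_mono:
  assumes "nobiclique s V" "V' \<subseteq> V"
  shows "nobiclique s V'"
  unfolding nobiclique_def
proof
  assume "\<exists>X Y. X \<subseteq> V' \<and> Y \<subseteq> V' \<and> card X = s \<and> card Y = s \<and> (\<forall>x\<in>X. \<forall>y\<in>Y. E x y)"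
  then obtain X Y where XY: "X \<subseteq> V'" "Y \<subseteq> V'" "card X = s" "card Y = s" "\<forall>x\<in>X. \<forall>y\<in>Y. E x y" by blast
  have "X \<subseteq> V" "Y \<subseteq> V" using XY(1,2) assms(2) by auto
  then show False using XY(3-5) assms(1) unfolding nobiclique_def by blast
qed

lemma nobicliqueD:
  "nobiclique s V \<Longrightarrow> inj_on f {..<s} \<Longrightarrow> inj_on g {..<s} \<Longrightarrow> f ` {..<s} \<subseteq> V \<Longrightarrow> g ` {..<s} \<subseteq> V \<Longrightarrow>
   (\<And>i j. i < s \<Longrightarrow> j < s \<Longrightarrow> E (f i) (g j)) \<Longrightarrow> False"
  unfolding nobiclique_def
proof (erule notE)
  assume a: "inj_on f {..<s}" "inj_on g {..<s}" "f ` {..<s} \<subseteq> V" "g ` {..<s} \<subseteq> V"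
    "\<And>i j. i < s \<Longrightarrow> j < s \<Longrightarrow> E (f i) (g j)"
  show "\<exists>X Y. X \<subseteq> V \<and> Y \<subseteq> V \<and> card X = s \<and> card Y = s \<and> (\<forall>x\<in>X. \<forall>y\<in>Y. E x y)"
    using a by (intro exI[of _ "f ` {..<s}"] exI[of _ "g ` {..<s}"]) (auto simp: card_image)
qed

lemma has_tripods_Suc:
  assumes "tripod p A" "A \<subseteq> V" "has_tripods p m V'" "V' \<subseteq> V" "apart A V'"
  shows "has_tripods p (Suc m) V"
proof -
  obtain F where F: "\<And>i. i < m \<Longrightarrow> F i \<subseteq> V' \<and> tripod p (F i)"
    "\<And>i j. i < m \<Longrightarrow> j < m \<Longrightarrow> i \<noteq> j \<Longrightarrow> apart (F i) (F j)"
    using assms(3) unfolding has_tripods_def by blast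
  have AF: "apart A (F i)" if "i < m" for i using apart_mono[OF assms(5)] F(1)[OF that] by blast
  show ?thesis
    unfolding has_tripods_def
  proof (intro exI[of _ "\<lambda>i. case i of 0 \<Rightarrow> A | Suc i \<Rightarrow> F i"] conjI allI impI)
    fix i assume "i < Suc m"
    then show "(case i of 0 \<Rightarrow> A | Suc i \<Rightarrow> F i) \<subseteq> V" "tripod p (case i of 0 \<Rightarrow> A | Suc i \<Rightarrow> F i)"
      using F(1) assms by (cases i; force)+
  next
    fix i j assume "i < Suc m" "j < Suc m" "i \<noteq> j"
    then show "apart (case i of 0 \<Rightarrow> A | Suc i \<Rightarrow> F i) (case j of 0 \<Rightarrow> A | Suc i \<Rightarrow> F i)"
      using F(2) AF apart_sym[OF AF] by (cases i; cases j) auto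
  qed
qed

lemma has_tripods_mono: "has_tripods p m V \<Longrightarrow> m' \<le> m \<Longrightarrow> has_tripods p m' V"
  unfolding has_tripods_def by (meson order_less_le_trans)

definition shortwalk :: "nat \<Rightarrow> 'a set \<Rightarrow> 'a \<Rightarrow> 'a \<Rightarrow> bool" where
  "shortwalk q U u v \<longleftrightarrow> (\<exists>xs. walk xs \<and> hd xs = u \<and> last xs = v \<and> set xs \<subseteq> U \<and> length xs \<le> Suc q)"

lemma shortwalk_sym: "shortwalk q U u v \<Longrightarrow> shortwalk q U v u"
  unfolding shortwalk_def
proof (elim exE conjE)
  fix xs assume "walk xs" "hd xs = u" "last xs = v" "set xs \<subseteq> U" "length xs \<le> Suc q"
  then show "\<exists>xs. walk xs \<and> hd xs = v \<and> last xs = u \<and> set xs \<subseteq> U \<and> length xs \<le> Suc q"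
    using walk_rev[of xs] by (intro exI[of _ "rev xs"]) (auto simp: hd_rev last_rev)
qed

end

text \<open>
  Many disjoint lists of bounded length contain several that are pairwise apart. Otherwise Ramsey's theorem
  yields positions \<open>a\<close> and \<open>b\<close> such that the \<open>a\<close>-th vertex of every list is adjacent to the \<open>b\<close>-th vertex of every later
  list, which is a biclique.
\<close>
lemma apart_tuples:
  "\<exists>N. \<forall>E (V :: 'a set) L. sgraph E \<longrightarrow> sgraph.nobiclique E s V \<longrightarrow>
     (\<forall>i<N. length (L i) = q \<and> set (L i) \<subseteq> V) \<longrightarrow>
     (\<forall>i<N. \<forall>j<N. i \<noteq> j \<longrightarrow> set (L i) \<inter> set (L j) = {}) \<longrightarrow>
     (\<exists>e::nat \<Rightarrow> nat. e ` {..<M::nat} \<subseteq> {..<N::nat} \<and>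
        (\<forall>i<M. \<forall>j<M. i \<noteq> j \<longrightarrow> sgraph.apart E (set (L (e i))) (set (L (e j)))))"
proof -
  \<comment> \<open>The additional indices leave room for the two sides of a biclique.\<close>
  let ?M = "M + 2 * s"
  obtain N where N: "\<And>F :: nat list \<Rightarrow> (nat \<times> nat) set. (\<forall>xs. F xs \<in> Pow ({..<q} \<times> {..<q})) \<Longrightarrow>
    (\<exists>(e :: nat \<Rightarrow> nat) c. strict_mono_on {..<?M} e \<and> e ` {..<?M} \<subseteq> {..<N} \<and>
      (\<forall>ps. sorted_wrt (<) ps \<and> length ps = 2 \<and> set ps \<subseteq> {..<?M} \<longrightarrow> F (map e ps) = c))"
    using ramsey_tuples[of "Pow ({..<q} \<times> {..<q}) :: (nat \<times> nat) set set" ?M 2] by auto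
  show ?thesis
  proof (intro exI[of _ N] allI impI)
    fix E and V :: "'a set" and L :: "nat \<Rightarrow> 'a list"
    assume "sgraph E" and nb: "sgraph.nobiclique E s V"
      and L: "\<forall>i<N. length (L i) = q \<and> set (L i) \<subseteq> V"
      and disj: "\<forall>i<N. \<forall>j<N. i \<noteq> j \<longrightarrow> set (L i) \<inter> set (L j) = {}"
    interpret sgraph E by fact
    define F where "F = (\<lambda>xs. {(a,b). a < q \<and> b < q \<and> E (L (xs ! 0) ! a) (L (xs ! 1) ! b)})"
    have "\<forall>xs. F xs \<in> Pow ({..<q} \<times> {..<q})" by (auto simp: F_def)
    from N[OF this] obtain e c where e: "strict_mono_on {..<?M} e" "e ` {..<?M} \<subseteq> {..<N}"
      and c: "\<forall>ps. sorted_wrt (<) ps \<and> length ps = 2 \<and> set ps \<subseteq> {..<?M} \<longrightarrow> F (map e ps) = c" by blast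
    have c2: "F [e i, e j] = c" if "i < j" "j < ?M" for i j
      using c[rule_format, of "[i,j]"] that by simp
    have eN: "e i < N" if "i < ?M" for i using e(2) that by blast
    have einj: "e i \<noteq> e j" if "i < ?M" "j < ?M" "i \<noteq> j" for i j
      using strict_mono_on_imp_inj_on[OF e(1)] that by (auto simp: inj_on_def)
    have inj: "inj_on (\<lambda>i. L (e (i + k)) ! a) {..<s}" if a: "a < q" and k: "k \<le> s" for a k
    proof (rule inj_onI, rule ccontr)
      fix i j assume ij: "i \<in> {..<s}" "j \<in> {..<s}" "L (e (i + k)) ! a = L (e (j + k)) ! a" "i \<noteq> j"
      have lt: "e (i + k) < N" "e (j + k) < N" using ij k by (auto intro!: eN)
      have "e (i + k) \<noteq> e (j + k)" using ij k by (intro einj) auto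
      then have "set (L (e (i + k))) \<inter> set (L (e (j + k))) = {}" using disj lt by blast
      moreover have "L (e (i + k)) ! a \<in> set (L (e (i + k)))" "L (e (j + k)) ! a \<in> set (L (e (j + k)))"
        using L lt a by auto
      ultimately show False using ij(3) by (metis disjoint_iff)
    qed
    have img: "(\<lambda>i. L (e (i + k)) ! a) ` {..<s} \<subseteq> V" if a: "a < q" and k: "k \<le> s" for a k
    proof
      fix y assume "y \<in> (\<lambda>i. L (e (i + k)) ! a) ` {..<s}"
      then obtain i where i: "i < s" "y = L (e (i + k)) ! a" by auto
      have "e (i + k) < N" using i k by (intro eN) auto
      then have "length (L (e (i + k))) = q" "set (L (e (i + k))) \<subseteq> V" using L by blast+
      then show "y \<in> V" using i a by (metis nth_mem subsetD)
    qed
    have "c = {}"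
    proof (rule ccontr)
      assume "c \<noteq> {}"
      then obtain a b where ab: "(a, b) \<in> c" by auto
      show False
      proof (cases "s = 0")
        case True
        show ?thesis by (rule nobicliqueD[OF nb, of undefined undefined]) (simp_all add: True)
      next
        case False
        then have abq: "a < q" "b < q" using ab c2[of 0 1] by (auto simp: F_def)
        show ?thesis
        proof (rule nobicliqueD[OF nb inj[OF abq(1), of 0] inj[OF abq(2), of s] img[OF abq(1), of 0] img[OF abq(2), of s]])
          fix i j assume "i < s" "j < s"
          then have "(a, b) \<in> F [e (i + 0), e (j + s)]" using ab c2[of i "j + s"] by simp
          then show "E (L (e (i + 0)) ! a) (L (e (j + s)) ! b)" by (simp add: F_def)
        qed auto
      qed
    qed
    have nadj: "apart (set (L (e i))) (set (L (e j)))" if ij: "i < j" "j < M" for i j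
      unfolding apart_def
    proof (intro ballI)
      fix x y assume x: "x \<in> set (L (e i))" and y: "y \<in> set (L (e j))"
      have lt: "e i < N" "e j < N" "e i \<noteq> e j" using ij einj[of i j] eN by auto
      obtain a b where "a < length (L (e i))" "x = L (e i) ! a" "b < length (L (e j))" "y = L (e j) ! b"
        using x y unfolding in_set_conv_nth by blast
      moreover have "length (L (e i)) = q" "length (L (e j)) = q" using L lt by blast+
      ultimately have ab: "a < q" "x = L (e i) ! a" "b < q" "y = L (e j) ! b" by simp_all
      have "(a, b) \<notin> F [e i, e j]" using c2[of i j] ij \<open>c = {}\<close> by auto
      then have "\<not> E x y" using ab by (auto simp: F_def)
      moreover have "x \<noteq> y" using disj lt x y by blast
      ultimately show "x \<noteq> y \<and> \<not> E x y" by simp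
    qed
    have "apart (set (L (e i))) (set (L (e j)))" if ij: "i < M" "j < M" "i \<noteq> j" for i j
    proof (cases "i < j")
      case True
      then show ?thesis using nadj ij by simp
    next
      case False
      then have "j < i" using ij by simp
      then show ?thesis using nadj[of j i, THEN apart_sym] ij by simp
    qed
    moreover have "e ` {..<M} \<subseteq> {..<N}" using e(2) by (auto simp: image_subset_iff)
    ultimately show "\<exists>e. e ` {..<M} \<subseteq> {..<N} \<and>
        (\<forall>i<M. \<forall>j<M. i \<noteq> j \<longrightarrow> apart (set (L (e i))) (set (L (e j))))" by blast
  qed
qed

text \<open>
  Highly connected vertices that are pairwise far from each other outside a bounded set \<open>Z\<close> are centres of
  disjoint claws. Around each of them one finds arbitrarily many disjoint
  induced paths of length \<open>p\<close> greedily: after the removal of \<open>Z\<close> and of the paths found so far, the vertex is still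
  connected to another vertex of \<open>B\<close>, which is far away.
\<close>
lemma (in tangled) far_many:
  assumes star: "\<And>L. (\<forall>i<Ns. length (L i) = p \<and> set (L i) \<subseteq> V) \<Longrightarrow>
      (\<forall>i<Ns. \<forall>j<Ns. i \<noteq> j \<longrightarrow> set (L i) \<inter> set (L j) = {}) \<Longrightarrow>
      \<exists>e. e ` {..<3} \<subseteq> {..<Ns::nat} \<and> (\<forall>i<3::nat. \<forall>j<3. i \<noteq> j \<longrightarrow> apart (set (L (e i))) (set (L (e j))))"
    and B: "B \<subseteq> V" "card B = m" "2 \<le> m" and Z: "Z \<subseteq> V" "Z \<inter> B = {}"
    and far: "\<And>u v. u \<in> B \<Longrightarrow> v \<in> B \<Longrightarrow> u \<noteq> v \<Longrightarrow> \<not> shortwalk (2 * p + 1) (V - Z) u v"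
    and core: "\<And>v Y. v \<in> B \<Longrightarrow> Y \<subseteq> V \<Longrightarrow> card Y \<le> k \<Longrightarrow> v \<notin> Y \<Longrightarrow> v \<in> \<beta> Y"
    and k: "card Z + Ns * p \<le> k" "k \<le> \<kappa>"
  shows "has_tripods p m V"
proof -
  let ?V = "V - Z"
  have BV: "u \<in> ?V" if "u \<in> B" for u using B Z that by blast
  have notball: "u \<notin> ball ?V {v} n" if uv: "u \<in> B" "v \<in> B" "u \<noteq> v" and n: "n \<le> 2 * p + 1" for u v n
  proof
    assume "u \<in> ball ?V {v} n"
    then obtain xs where "walk xs" "hd xs \<in> {v}" "last xs = u" "set xs \<subseteq> ball ?V {v} n" "length xs \<le> Suc n"
      using ball_walk[of "{v}" ?V u n] BV uv by auto
    moreover have "ball ?V {v} n \<subseteq> ?V" using ball_sub[of "{v}" ?V n] BV uv by auto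
    ultimately have "shortwalk (2 * p + 1) ?V v u" unfolding shortwalk_def using n by (intro exI[of _ xs]) auto
    then show False using far[of v u] uv by auto
  qed
  have star_at: "\<exists>A. claw p A \<and> A \<subseteq> ball ?V {u} p" if u: "u \<in> B" for u
  proof -
    have "\<exists>u'. u' \<in> B \<and> u' \<noteq> u"
    proof (rule ccontr)
      assume "\<not> ?thesis"
      then have "B \<subseteq> {u}" by blast
      then have "card B \<le> 1" using card_mono[of "{u}" B] by auto
      then show False using B by simp
    qed
    then obtain u' where u': "u' \<in> B" "u' \<noteq> u" by blast
    have ballV: "ball ?V {u} p \<subseteq> ?V" using ball_sub[of "{u}" ?V p] BV u by auto
    have "\<exists>L. (\<forall>i<t. length (L i) = p \<and> ipath (u # L i) \<and> set (L i) \<subseteq> ball ?V {u} p) \<and>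
        (\<forall>i<t. \<forall>j<t. i \<noteq> j \<longrightarrow> set (L i) \<inter> set (L j) = {})" if "t \<le> Ns" for t
      using that
    proof (induction t)
      case (Suc t)
      obtain L where L: "\<And>i. i < t \<Longrightarrow> length (L i) = p \<and> ipath (u # L i) \<and> set (L i) \<subseteq> ball ?V {u} p"
        "\<And>i j. i < t \<Longrightarrow> j < t \<Longrightarrow> i \<noteq> j \<Longrightarrow> set (L i) \<inter> set (L j) = {}"
        using Suc.IH[OF Suc_leD[OF Suc.prems]] by blast
      let ?Y = "Z \<union> (\<Union>i<t. set (L i))"
      have YV: "?Y \<subseteq> V" using Z L(1) ballV by blast
      have "card (\<Union>i<t. set (L i)) \<le> (\<Sum>i<t. card (set (L i)))" by (rule card_UN_le) simp
      also have "\<dots> \<le> (\<Sum>i<t. p)"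
      proof (rule sum_mono)
        fix i assume "i \<in> {..<t}"
        then show "card (set (L i)) \<le> p" using card_length[of "L i"] L(1)[of i] by simp
      qed
      also have "\<dots> \<le> Ns * p" using Suc.prems by simp
      finally have cY: "card ?Y \<le> k" using card_Un_le[of Z "\<Union>i<t. set (L i)"] k by linarith
      have uY: "u \<notin> ?Y" using L(1) BV[OF u] by (auto simp: ipath_def)
      have u'Y: "u' \<notin> ?Y" using L(1) BV[OF u'(1)] notball[OF u'(1) u u'(2), of p] by auto
      have ub: "u \<in> \<beta> ?Y" "u' \<in> \<beta> ?Y" using core[OF _ YV cY] u u' uY u'Y by auto
      have Yk: "card ?Y \<le> \<kappa>" using cY k by simp
      obtain ys where ys: "ys \<noteq> []" "ipath ys" "set ys \<subseteq> \<beta> ?Y" "hd ys \<in> {u}" "last ys \<in> {u'}"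
        by (rule conn_geodesic[OF \<beta>(2)[OF YV Yk] ub(1) singletonI ub(2) singletonI]) (rule that)
      have ysV: "set ys \<subseteq> V - ?Y" using ys(3) \<beta>(1)[OF YV Yk] by blast
      have w: "walk ys" using ipath_walk ys by blast
      have long: "2 * p + 2 < length ys"
      proof (rule ccontr)
        assume "\<not> ?thesis"
        then have "shortwalk (2 * p + 1) ?V u u'"
          unfolding shortwalk_def using w ys ysV by (intro exI[of _ ys]) auto
        then show False using far[OF u u'(1)] u' by auto
      qed
      define l where "l = take p (tl ys)"
      have ul: "u # l = take (Suc p) ys" using ys(1,4) by (cases ys) (auto simp: l_def)
      have ll: "length l = p" using long by (simp add: l_def)
      have il: "ipath (u # l)" unfolding ul by (rule ipath_take[OF ys(2)])
      have sl: "set l \<subseteq> set ys" using ul set_take_subset[of "Suc p" ys] by (metis set_subset_Cons order_trans)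
      have lb: "set l \<subseteq> ball ?V {u} p"
      proof
        fix y assume "y \<in> set l"
        then obtain i where i: "i < Suc p" "y = take (Suc p) ys ! i" unfolding ul[symmetric]
          using ll by (metis in_set_conv_nth length_Cons list.set_intros(2))
        then have y: "y = ys ! i" "i < length ys" using long by auto
        have "last (take (Suc i) ys) \<in> ball ?V {u} (0 + length (take (Suc i) ys) - 1)"
        proof (rule walk_ball)
          show "walk (take (Suc i) ys)" using walk_take_conn[OF w y(2)] by blast
          show "set (take (Suc i) ys) \<subseteq> ?V" using ysV set_take_subset[of "Suc i" ys] by blast
          show "hd (take (Suc i) ys) \<in> ball ?V {u} 0" using walk_take_conn[OF w y(2)] ys(4) by simp
        qed
        then have "y \<in> ball ?V {u} i" using walk_take_conn[OF w y(2)] y by simp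
        then show "y \<in> ball ?V {u} p" using ball_mono_n[of i p ?V "{u}"] i by auto
      qed
      have ld: "set l \<inter> set (L i) = {}" if "i < t" for i using sl ysV that by blast
      show ?case
      proof (intro exI[of _ "L(t := l)"] conjI allI impI)
        fix i assume "i < Suc t"
        then show "length ((L(t := l)) i) = p" "ipath (u # (L(t := l)) i)" "set ((L(t := l)) i) \<subseteq> ball ?V {u} p"
          using L(1)[of i] ll il lb by (cases "i = t"; simp)+
      next
        fix i j assume "i < Suc t" "j < Suc t" "i \<noteq> j"
        then show "set ((L(t := l)) i) \<inter> set ((L(t := l)) j) = {}"
          using L(2)[of i j] ld[of i] ld[of j] by (cases "i = t"; cases "j = t") auto
      qed
    qed simp
    then obtain L where L: "\<And>i. i < Ns \<Longrightarrow> length (L i) = p \<and> ipath (u # L i) \<and> set (L i) \<subseteq> ball ?V {u} p"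
      "\<forall>i<Ns. \<forall>j<Ns. i \<noteq> j \<longrightarrow> set (L i) \<inter> set (L j) = {}" by blast
    have "\<forall>i<Ns. length (L i) = p \<and> set (L i) \<subseteq> V" using L(1) ballV by blast
    from star[OF this L(2)] obtain e where e: "e ` {..<3} \<subseteq> {..<Ns}"
      "\<forall>i<3::nat. \<forall>j<3. i \<noteq> j \<longrightarrow> apart (set (L (e i))) (set (L (e j)))" by blast
    have eN: "e i < Ns" if "i < 3" for i using e(1) that by auto
    let ?A = "insert u (\<Union>i<3. set (L (e i)))"
    have "claw p ?A" unfolding claw_def
      by (rule exI[of _ u], rule exI[of _ "\<lambda>i. L (e i)"]) (use L(1)[OF eN] e(2) in blast)
    moreover have "u \<in> ball ?V {u} p" using ball_mono_n[of 0 p ?V "{u}"] by auto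
    then have "?A \<subseteq> ball ?V {u} p" using L(1)[OF eN] by auto
    ultimately show ?thesis by blast
  qed
  then obtain A where A: "\<And>u. u \<in> B \<Longrightarrow> claw p (A u) \<and> A u \<subseteq> ball ?V {u} p" by metis
  have "finite B" using B fin finite_subset by blast
  then obtain h where h: "bij_betw h {..<m} B"
    using ex_bij_betw_nat_finite[of B] B(2) unfolding lessThan_atLeast0 by blast
  show ?thesis unfolding has_tripods_def
  proof (intro exI[of _ "\<lambda>i. A (h i)"] conjI allI impI)
    fix i assume "i < m"
    then have hi: "h i \<in> B" using h by (auto simp: bij_betw_def)
    have "ball ?V {h i} p \<subseteq> ?V" using ball_sub[of "{h i}" ?V p] BV[OF hi] by auto
    then show "A (h i) \<subseteq> V" using A[OF hi] by blast
    show "tripod p (A (h i))" using A[OF hi] by (simp add: tripod_def)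
  next
    fix i j assume ij: "i < m" "j < m" "i \<noteq> j"
    then have hij: "h i \<in> B" "h j \<in> B" "h i \<noteq> h j" using h by (auto simp: bij_betw_def inj_on_def)
    have "apart (ball ?V {h i} p) (ball ?V {h j} p)"
      by (rule ball_apart[OF BV[OF hij(1)] BV[OF hij(2)] notball[OF hij]]) simp
    then show "apart (A (h i)) (A (h j))" using A hij apart_mono by blast
  qed
qed

section \<open>Claws in subdivided complete graphs\<close>

text \<open>
  The indices of the branch vertices that serve the \<open>c\<close>-th claw: \<open>k = 0\<close> is its centre, shared by the
  three legs, and \<open>k\<close> counts the branch vertices passed on leg \<open>l\<close>.
\<close>
definition claw_pos :: "nat \<Rightarrow> nat \<Rightarrow> nat \<Rightarrow> nat \<Rightarrow> nat" where
  "claw_pos p c l k = c * (3 * p + 1) + (if k = 0 then 0 else l * p + k)"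

lemma claw_pos_less: "c < m \<Longrightarrow> l < 3 \<Longrightarrow> k \<le> p \<Longrightarrow> claw_pos p c l k < m * (3 * p + 1)"
proof -
  assume "c < m" "l < 3" "k \<le> p"
  then have "Suc c * (3 * p + 1) \<le> m * (3 * p + 1)" by (intro mult_le_mono1) simp
  moreover have "l * p \<le> 2 * p" using \<open>l < 3\<close> by (intro mult_le_mono1) simp
  then have "l * p + k < 3 * p + 1" using \<open>k \<le> p\<close> by linarith
  ultimately show ?thesis by (simp add: claw_pos_def)
qed

lemma claw_pos_mono: "k < k' \<Longrightarrow> claw_pos p c l k < claw_pos p c l k'"
  by (simp add: claw_pos_def)

lemma claw_pos_c:
  assumes "claw_pos p c l k = claw_pos p c' l' k'" "l < 3" "l' < 3" "k \<le> p" "k' \<le> p"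
  shows "c = c'"
proof -
  have r: "(if k = 0 then 0 else l * p + k) < 3 * p + 1" if "l < 3" "k \<le> p" for l k :: nat
  proof -
    have "l * p \<le> 2 * p" using \<open>l < 3\<close> by (intro mult_le_mono1) simp
    then have "l * p + k < 3 * p + 1" using that by linarith
    then show ?thesis by simp
  qed
  have "claw_pos p c l k div (3 * p + 1) = c" if "l < 3" "k \<le> p" for c l k
  proof -
    have "claw_pos p c l k div (3 * p + 1) = c + (if k = 0 then 0 else l * p + k) div (3 * p + 1)"
      unfolding claw_pos_def by (subst add.commute, rule div_mult_self1) simp
    then show ?thesis using div_less[OF r[OF that]] by simp
  qed
  then show ?thesis using assms by metis
qed

lemma claw_pos_l:
  assumes "claw_pos p c l k = claw_pos p c l' k'" "k \<le> p" "k' \<le> p" "1 \<le> k"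
  shows "l = l' \<and> k = k'"
proof -
  have e: "l * p + k = (if k' = 0 then 0 else l' * p + k')" using assms by (simp add: claw_pos_def)
  then have k': "1 \<le> k'" using assms(4) by (auto split: if_splits)
  have e: "l * p + k = l' * p + k'" using e k' by simp
  have lt: False if "l * p + k = l' * p + k'" "l < l'" "k \<le> p" "1 \<le> k'" for l l' k k' :: nat
  proof -
    have "Suc l * p \<le> l' * p" using that by (intro mult_le_mono1) simp
    then show False using that by simp
  qed
  have "l = l'" using lt[OF e] lt[OF e[symmetric]] assms k' by (metis linorder_neqE_nat)
  then show ?thesis using e by simp
qed

context sgraph begin

text \<open>
  An induced subdivision of a large complete graph contains many disjoint claws. The set
  \<open>part i i\<close> is the \<open>i\<close>-th branch vertex and \<open>part i j\<close> is the interior of the connection of two branch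
  vertices; connections need to be connected sets only. A leg is a shortest path through \<open>p\<close> consecutive connections, and it has
  length at least \<open>p\<close> because one edge never skips a branch vertex.
\<close>
lemma subdivided_clique_many:
  assumes disj: "\<And>i j k l. i \<le> j \<Longrightarrow> j < M \<Longrightarrow> k \<le> l \<Longrightarrow> l < M \<Longrightarrow> (i, j) \<noteq> (k, l) \<Longrightarrow> part i j \<inter> part k l = {}"
    and nadj: "\<And>i j k l x y. i \<le> j \<Longrightarrow> j < M \<Longrightarrow> k \<le> l \<Longrightarrow> l < M \<Longrightarrow> \<not> {i, j} \<subseteq> {k, l} \<Longrightarrow> \<not> {k, l} \<subseteq> {i, j} \<Longrightarrow>
      x \<in> part i j \<Longrightarrow> y \<in> part k l \<Longrightarrow> \<not> E x y"
    and con: "\<And>i j. i < j \<Longrightarrow> j < M \<Longrightarrow> conn (part i i \<union> part i j \<union> part j j)"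
    and sing: "\<And>i. i < M \<Longrightarrow> part i i = {v i}"
    and sub: "\<And>i j. i \<le> j \<Longrightarrow> j < M \<Longrightarrow> part i j \<subseteq> V"
    and M: "m * (3 * p + 1) \<le> M"
  shows "has_tripods p m V"
proof -
  let ?q = "claw_pos p"
  have posM: "?q c l k < M" if "c < m" "l < 3" "k \<le> p" for c l k using claw_pos_less[OF that] M by simp
  define I where "I c l n = {(?q c l k, ?q c l k) | k. k \<le> n} \<union> {(?q c l k, ?q c l (Suc k)) | k. k < n}" for c l n
  define S where "S c l n = (\<Union>(i, j)\<in>I c l n. part i j)" for c l n
  have Ient: "(\<exists>k\<le>n. i = ?q c l k) \<and> (\<exists>k\<le>n. j = ?q c l k)" if I: "(i, j) \<in> I c l n" for i j c l n
  proof -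
    consider k where "k \<le> n" "i = ?q c l k" "j = ?q c l k" | k where "k < n" "i = ?q c l k" "j = ?q c l (Suc k)"
      using I unfolding I_def by blast
    then show ?thesis
    proof cases
      case 1 then show ?thesis by blast
    next
      case 2 then show ?thesis using less_imp_le[of k n] Suc_leI[of k n] by blast
    qed
  qed
  have I0: "I c l 0 = {(?q c l 0, ?q c l 0)}" for c l by (auto simp: I_def)
  have ISuc: "I c l (Suc n) = I c l n \<union> {(?q c l (Suc n), ?q c l (Suc n)), (?q c l n, ?q c l (Suc n))}" for c l n
    unfolding I_def using le_Suc_eq less_Suc_eq by auto
  have S0: "S c l 0 = part (?q c l 0) (?q c l 0)" for c l by (simp add: S_def I0)
  have SSuc: "S c l (Suc n) = S c l n \<union> (part (?q c l n) (?q c l (Suc n)) \<union> part (?q c l (Suc n)) (?q c l (Suc n)))" for c l n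
    by (auto simp: S_def ISuc)
  have Imono: "I c l n \<subseteq> I c l n'" if "n \<le> n'" for c l n n' using that by (auto simp: I_def)
  have IM: "i \<le> j \<and> j < M" if "(i, j) \<in> I c l p" "c < m" "l < 3" for i j c l
    using that posM[OF that(2,3)] claw_pos_mono[of _ _ p c l] by (auto simp: I_def less_imp_le)
  have ctr: "?q c l 0 = ?q c 0 0" for c l by (simp add: claw_pos_def)
  define x where "x c = v (?q c 0 0)" for c
  have xS: "S c l 0 = {x c}" if "c < m" for c l
    using S0[of c l] sing[OF posM[OF that, of 0 0]] ctr[of c l] by (simp add: x_def)
  have Smono: "S c l n \<subseteq> S c l n'" if "n \<le> n'" for c l n n' using Imono[OF that] by (auto simp: S_def)
  have SV: "S c l p \<subseteq> V" if "c < m" "l < 3" for c l using IM[OF _ that] sub by (fastforce simp: S_def)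
  have Sconn: "conn (S c l n)" if "c < m" "l < 3" "n \<le> p" for c l n
    using that(3)
  proof (induction n)
    case 0 then show ?case using xS[OF that(1)] conn_sing by simp
  next
    case (Suc n)
    let ?a = "?q c l n" and ?b = "?q c l (Suc n)"
    have c1: "conn (part ?a ?a \<union> part ?a ?b \<union> part ?b ?b)"
      by (rule con) (use posM[OF that(1,2) Suc.prems] claw_pos_mono in auto)
    have an: "?a < M" using posM[OF that(1,2)] Suc.prems by simp
    have va: "v ?a \<in> S c l n" "v ?a \<in> part ?a ?a" using sing[OF an] by (auto simp: S_def I_def)
    have "conn (S c l n \<union> (part ?a ?a \<union> part ?a ?b \<union> part ?b ?b))"
      using conn_Un[OF Suc.IH c1 va(1), of "v ?a"] va Suc.prems by simp
    moreover have "S c l n \<union> (part ?a ?a \<union> part ?a ?b \<union> part ?b ?b) = S c l (Suc n)"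
      using va(1) sing[OF an] by (auto simp: SSuc)
    ultimately show ?case by simp
  qed
  \<comment> \<open>One step along an edge advances by at most one branch vertex, since connections whose index sets are not nested are not adjacent.\<close>
  have grow: "z \<in> S c l (Suc n)" if cl: "c < m" "l < 3" and y: "y \<in> S c l n" and z: "z \<in> S c l p" and e: "E y z" and n: "Suc n \<le> p"
    for c l n y z
  proof -
    obtain i j where ij: "(i, j) \<in> I c l n" "y \<in> part i j" using y by (auto simp: S_def)
    obtain i' j' where ij': "(i', j') \<in> I c l p" "z \<in> part i' j'" using z by (auto simp: S_def)
    have "(i, j) \<in> I c l p" using Imono[of n p c l] ij(1) n by auto
    then have b: "i \<le> j" "j < M" "i' \<le> j'" "j' < M" using IM[OF _ cl] ij'(1) by blast+
    have "{i, j} \<subseteq> {i', j'} \<or> {i', j'} \<subseteq> {i, j}" using nadj[OF b _ _ ij(2) ij'(2)] e by blast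
    moreover have inj: "k = k'" if "?q c l k = ?q c l k'" for k k'
      using that claw_pos_mono[of k k' p c l] claw_pos_mono[of k' k p c l] by (metis less_irrefl linorder_neqE_nat)
    have "(i', j') \<in> I c l (Suc n)" 
    proof -
      obtain k where k: "(i = ?q c l k \<and> j = ?q c l k \<and> k \<le> n) \<or> (i = ?q c l k \<and> j = ?q c l (Suc k) \<and> k < n)"
        using ij(1) by (auto simp: I_def)
      obtain k' where k': "(i' = ?q c l k' \<and> j' = ?q c l k') \<or> (i' = ?q c l k' \<and> j' = ?q c l (Suc k'))"
        using ij'(1) by (auto simp: I_def)
      from calculation k k' have "(i' = ?q c l k' \<and> j' = ?q c l k' \<and> k' \<le> n) \<or> (i' = ?q c l k' \<and> j' = ?q c l (Suc k') \<and> k' \<le> n)"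
        by (auto dest!: inj)
      then show ?thesis by (auto simp: I_def)
    qed
    then show ?thesis using ij'(2) by (auto simp: S_def)
  qed
  have leg: "\<exists>L. length L = p \<and> ipath (x c # L) \<and> set L \<subseteq> S c l p - {x c}" if cl: "c < m" "l < 3" for c l
  proof -
    let ?t = "v (?q c l p)"
    have tM: "?q c l p < M" using posM[OF cl] by simp
    have xin: "x c \<in> S c l p" using Smono[of 0 p c l] xS[OF cl(1)] by auto
    have tin: "?t \<in> S c l p" using sing[OF tM] by (auto simp: S_def I_def)
    obtain ys where ys: "ys \<noteq> []" "ipath ys" "set ys \<subseteq> S c l p" "hd ys \<in> {x c}" "last ys \<in> {?t}"
      by (rule conn_geodesic[OF Sconn[OF cl order_refl] xin singletonI tin singletonI]) (rule that)
    have lev: "ys ! i \<in> S c l i" if "i < length ys" "i \<le> p" for i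
      using that
    proof (induction i)
      case 0 then show ?case using ys(1,4) xS[OF cl(1)] by (simp add: hd_conv_nth)
    next
      case (Suc i)
      have "E (ys ! i) (ys ! Suc i)" using ipath_nthE[OF ys(2), of i "Suc i"] Suc.prems by simp
      moreover have "ys ! i \<in> S c l i" using Suc by simp
      moreover have "ys ! Suc i \<in> S c l p" using ys(3) nth_mem[OF Suc.prems(1)] by blast
      ultimately show ?case using grow[OF cl] Suc.prems(2) by blast
    qed
    have "p < length ys"
    proof (rule ccontr)
      assume "\<not> ?thesis"
      then have n: "length ys - 1 < p" "length ys - 1 < length ys" using ys(1) by (cases ys; simp)+
      have "?t \<in> S c l (length ys - 1)" using lev[OF n(2)] n ys(1,5) by (simp add: last_conv_nth)
      then obtain i j where ij: "(i, j) \<in> I c l (length ys - 1)" "?t \<in> part i j" by (auto simp: S_def)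
      have "(i, j) \<in> I c l p" using Imono[of "length ys - 1" p c l] ij(1) n by auto
      then have "i \<le> j" "j < M" using IM[OF _ cl] by blast+
      then have "(i, j) = (?q c l p, ?q c l p)" using disj[of i j "?q c l p" "?q c l p"] ij(2) sing[OF tM] tM by auto
      moreover obtain k where "k \<le> length ys - 1" "i = ?q c l k"
        using ij(1) less_imp_le unfolding I_def by blast
      ultimately have "k < p" "?q c l k = ?q c l p" using n by auto
      then show False using claw_pos_mono[of k p p c l] by simp
    qed
    then have l1: "length (take p (tl ys)) = p" by simp
    have ul: "x c # take p (tl ys) = take (Suc p) ys" using ys(1,4) by (cases ys) auto
    have ip: "ipath (x c # take p (tl ys))" unfolding ul by (rule ipath_take[OF ys(2)])
    moreover have "set (take p (tl ys)) \<subseteq> S c l p"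
      using ys(3) set_take_subset[of p "tl ys"] set_tl_subset[of ys] by blast
    ultimately show ?thesis using l1 by (intro exI[of _ "take p (tl ys)"]) (auto simp: ipath_def)
  qed
  obtain L where L: "\<And>c l. c < m \<Longrightarrow> l < 3 \<Longrightarrow> length (L c l) = p \<and> ipath (x c # L c l) \<and> set (L c l) \<subseteq> S c l p - {x c}"
    using leg by metis
  have sepI: "apart (part i j) (part k l)" if "i \<le> j" "j < M" "k \<le> l" "l < M" "\<not> {i, j} \<subseteq> {k, l}" "\<not> {k, l} \<subseteq> {i, j}" for i j k l
    unfolding apart_def
  proof (intro ballI conjI)
    fix a b assume "a \<in> part i j" "b \<in> part k l"
    moreover have "(i, j) \<noteq> (k, l)" using that by auto
    ultimately show "a \<noteq> b" "\<not> E a b" using disj[OF that(1-4)] nadj[OF that] by auto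
  qed
  have legs: "apart (S c l p - {x c}) (S c l' p - {x c})" if cl: "c < m" "l < 3" "l' < 3" "l \<noteq> l'" for c l l'
  proof -
    have *: "\<exists>i j. a \<in> part i j \<and> (i, j) \<in> I c l p \<and> (\<exists>k. 1 \<le> k \<and> k \<le> p \<and> j = ?q c l k)" if a: "a \<in> S c l p - {x c}" and "l < 3" for a l
    proof -
      obtain i j where ij: "a \<in> part i j" "(i, j) \<in> I c l p" using a by (auto simp: S_def)
      have n0: "(i, j) \<noteq> (?q c l 0, ?q c l 0)" using ij a S0[of c l] xS[OF cl(1), of l] by auto
      have "(\<exists>k\<le>p. i = ?q c l k \<and> j = ?q c l k) \<or> (\<exists>k<p. i = ?q c l k \<and> j = ?q c l (Suc k))"
        using ij(2) unfolding I_def by blast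
      then have "\<exists>k. 1 \<le> k \<and> k \<le> p \<and> j = ?q c l k"
      proof
        assume "\<exists>k\<le>p. i = ?q c l k \<and> j = ?q c l k"
        then obtain k where k: "k \<le> p" "i = ?q c l k" "j = ?q c l k" by blast
        have "k \<noteq> 0" using k n0 by metis
        then show ?thesis using k by (intro exI[of _ k]) simp
      next
        assume "\<exists>k<p. i = ?q c l k \<and> j = ?q c l (Suc k)"
        then obtain k where "k < p" "j = ?q c l (Suc k)" by blast
        then show ?thesis by (intro exI[of _ "Suc k"]) simp
      qed
      then show ?thesis using ij by blast
    qed
    have nin: "?q c l k \<notin> {i, j}" if k: "1 \<le> k" "k \<le> p" and ij: "(i, j) \<in> I c l' p" and "l \<noteq> l'" for l l' k i j
    proof
      assume "?q c l k \<in> {i, j}"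
      then obtain k' where "k' \<le> p" "?q c l k = ?q c l' k'" using Ient[OF ij] by blast
      then show False using claw_pos_l[of p c l k l' k'] k \<open>l \<noteq> l'\<close> by blast
    qed
    show ?thesis unfolding apart_def
    proof (intro ballI)
      fix a b assume "a \<in> S c l p - {x c}" "b \<in> S c l' p - {x c}"
      then obtain i j k i' j' k' where
        a: "a \<in> part i j" "(i, j) \<in> I c l p" "1 \<le> k" "k \<le> p" "j = ?q c l k" and
        b: "b \<in> part i' j'" "(i', j') \<in> I c l' p" "1 \<le> k'" "k' \<le> p" "j' = ?q c l' k'"
        using * cl by meson
      have "j \<notin> {i', j'}" "j' \<notin> {i, j}" using nin[OF a(3,4) b(2) cl(4)] nin[OF b(3,4) a(2)] cl(4) a(5) b(5) by auto
      then have "apart (part i j) (part i' j')"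
        by (intro sepI) (use IM[OF a(2) cl(1,2)] IM[OF b(2) cl(1,3)] in auto)
      then show "a \<noteq> b \<and> \<not> E a b" using a(1) b(1) by (auto simp: apart_def)
    qed
  qed
  have claws: "apart (S c l p) (S c' l' p)" if cl: "c < m" "l < 3" "c' < m" "l' < 3" "c \<noteq> c'" for c l c' l'
    unfolding apart_def
  proof (intro ballI)
    fix a b assume "a \<in> S c l p" "b \<in> S c' l' p"
    then obtain i j i' j' where a: "a \<in> part i j" "(i, j) \<in> I c l p" and b: "b \<in> part i' j'" "(i', j') \<in> I c' l' p"
      by (auto simp: S_def)
    obtain k1 k2 where k: "k1 \<le> p" "i = ?q c l k1" "k2 \<le> p" "j = ?q c l k2" using Ient[OF a(2)] by blast
    obtain k1' k2' where k': "k1' \<le> p" "i' = ?q c' l' k1'" "k2' \<le> p" "j' = ?q c' l' k2'" using Ient[OF b(2)] by blast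
    have ne: "?q c l h \<noteq> ?q c' l' h'" if "h \<le> p" "h' \<le> p" for h h'
      using claw_pos_c[OF _ cl(2,4) that, of c c'] cl(5) by blast
    have "{i, j} \<inter> {i', j'} = {}"
      using ne[OF k(1) k'(1)] ne[OF k(1) k'(3)] ne[OF k(3) k'(1)] ne[OF k(3) k'(3)] k k' by simp
    then have "apart (part i j) (part i' j')"
      by (intro sepI) (use IM[OF a(2) cl(1,2)] IM[OF b(2) cl(3,4)] in auto)
    then show "a \<noteq> b \<and> \<not> E a b" using a(1) b(1) by (auto simp: apart_def)
  qed
  let ?A = "\<lambda>c. insert (x c) (\<Union>l<3. set (L c l))"
  have AS: "?A c \<subseteq> (\<Union>l<3. S c l p)" if "c < m" for c
    using L[OF that] Smono[of 0 p c 0] xS[OF that, of 0] by auto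
  show ?thesis unfolding has_tripods_def
  proof (intro exI[of _ ?A] conjI allI impI)
    fix c assume c: "c < m"
    have "(\<Union>l<3. S c l p) \<subseteq> V" using SV[OF c] by auto
    then show "?A c \<subseteq> V" using AS[OF c] by (rule order_trans[rotated])
    have "claw p (?A c)" unfolding claw_def
    proof (intro exI[of _ "x c"] exI[of _ "L c"] conjI allI impI)
      fix l :: nat assume l: "l < 3"
      show "length (L c l) = p" "ipath (x c # L c l)" using L[OF c l] by blast+
    next
      fix l l' :: nat assume l: "l < 3" "l' < 3" "l \<noteq> l'"
      show "apart (set (L c l)) (set (L c l'))"
        by (rule apart_mono[OF legs[OF c l]]) (use L[OF c l(1)] L[OF c l(2)] in blast)+
    qed (rule refl)
    then show "tripod p (?A c)" by (simp add: tripod_def)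
  next
    fix c c' assume c: "c < m" "c' < m" "c \<noteq> c'"
    have "apart (\<Union>l<3. S c l p) (\<Union>l<3. S c' l p)"
      using claws[OF c(1) _ c(2) _ c(3)] by (auto simp: apart_def)
    then show "apart (?A c) (?A c')" by (rule apart_mono[OF _ AS[OF c(1)] AS[OF c(2)]])
  qed
qed

text \<open>
  The connections are chosen one pair at a time: all earlier ones, together with the other branch
  vertices, form a bounded set that the next short walk can avoid.
\<close>
lemma connectors:
  assumes v: "inj_on v {..<n}" "v ` {..<n} \<subseteq> V" and finV: "finite V"
    and close: "\<And>u w Z. u \<in> v ` {..<n} \<Longrightarrow> w \<in> v ` {..<n} \<Longrightarrow> u \<noteq> w \<Longrightarrow> Z \<subseteq> V - {u, w} \<Longrightarrow> card Z \<le> n + n * n * Suc q \<Longrightarrow>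
       shortwalk q (V - Z) u w"
  shows "\<exists>I. \<forall>i j. i < j \<and> j < n \<longrightarrow> I (i, j) \<subseteq> V - v ` {..<n} \<and> card (I (i, j)) \<le> Suc q \<and>
     conn ({v i, v j} \<union> I (i, j)) \<and> (\<forall>k l. k < l \<and> l < n \<and> (k, l) \<noteq> (i, j) \<longrightarrow> I (i, j) \<inter> I (k, l) = {})"
proof -
  let ?B = "v ` {..<n}"
  let ?ok = "\<lambda>I P. (\<forall>(i, j)\<in>P. I (i, j) \<subseteq> V - ?B \<and> card (I (i, j)) \<le> Suc q \<and> conn ({v i, v j} \<union> I (i, j))) \<and>
      (\<forall>e\<in>P. \<forall>f\<in>P. e \<noteq> f \<longrightarrow> I e \<inter> I f = {})"
  let ?All = "{(i, j). i < j \<and> j < n}"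
  have sub: "?All \<subseteq> {..<n} \<times> {..<n}" by auto
  then have finAll: "finite ?All" using finite_subset by blast
  have cAll: "card ?All \<le> n * n" using card_mono[OF _ sub] by (simp add: card_cartesian_product)
  have ex: "\<exists>I. ?ok I P" if "P \<subseteq> ?All" for P
    using finite_subset[OF that finAll] that
  proof (induction P rule: finite_induct)
    case (insert e P)
    then obtain I where I: "?ok I P" by auto
    obtain i j where ij: "e = (i, j)" "i < j" "j < n" using insert.prems by auto
    have uw: "v i \<in> ?B" "v j \<in> ?B" "v i \<noteq> v j" using ij v(1) by (auto simp: inj_on_def)
    let ?Z = "(?B - {v i, v j}) \<union> (\<Union>e\<in>P. I e)"
    have "card (\<Union>e\<in>P. I e) \<le> (\<Sum>e\<in>P. card (I e))" by (rule card_UN_le[OF insert.hyps(1)])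
    also have "\<dots> \<le> card P * Suc q" using sum_bounded_above[of P "\<lambda>e. card (I e)" "Suc q"] I by fastforce
    also have "\<dots> \<le> n * n * Suc q"
      using card_mono[OF finAll, of P] insert.prems cAll by (intro mult_le_mono1) auto
    finally have "card (\<Union>e\<in>P. I e) \<le> n * n * Suc q" .
    moreover have "card (?B - {v i, v j}) \<le> n"
      using card_mono[of ?B "?B - {v i, v j}"] card_image_le[of "{..<n}" v] by simp
    ultimately have cZ: "card ?Z \<le> n + n * n * Suc q"
      using card_Un_le[of "?B - {v i, v j}" "\<Union>e\<in>P. I e"] by linarith
    have IVB: "I f \<subseteq> V - ?B" if "f \<in> P" for f using I that by (cases f) blast
    have ZV: "?Z \<subseteq> V - {v i, v j}"
    proof
      fix z assume "z \<in> ?Z"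
      then show "z \<in> V - {v i, v j}" using IVB v(2) uw by blast
    qed
    obtain xs where xs: "walk xs" "hd xs = v i" "last xs = v j" "set xs \<subseteq> V - ?Z" "length xs \<le> Suc q"
      using close[OF uw ZV cZ] unfolding shortwalk_def by blast
    have ne: "xs \<noteq> []" using xs(1) by (simp add: walk_def)
    have "{v i, v j} \<subseteq> set xs" using hd_in_set[OF ne] last_in_set[OF ne] xs by auto
    then have eq: "{v i, v j} \<union> (set xs - {v i, v j}) = set xs" by blast
    let ?I = "I(e := set xs - {v i, v j})"
    have 1: "set xs - {v i, v j} \<subseteq> V - ?B" using xs(4) by blast
    have 2: "card (set xs - {v i, v j}) \<le> Suc q"
      using card_mono[of "set xs" "set xs - {v i, v j}"] card_length[of xs] xs(5) by simp
    have 3: "conn ({v i, v j} \<union> (set xs - {v i, v j}))" unfolding eq by (rule conn_set_walk[OF xs(1)])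
    have 4: "(set xs - {v i, v j}) \<inter> I f = {}" if "f \<in> P" for f using xs(4) that by blast
    have "?ok ?I (insert e P)"
    proof (intro conjI ballI impI)
      fix f assume f: "f \<in> insert e P"
      show "case f of (i, j) \<Rightarrow> ?I (i, j) \<subseteq> V - ?B \<and> card (?I (i, j)) \<le> Suc q \<and> conn ({v i, v j} \<union> ?I (i, j))"
      proof (cases "f = e")
        case True
        show ?thesis unfolding True ij(1) prod.case fun_upd_same using 1 2 3 by blast
      next
        case False
        then have "f \<in> P" using f by simp
        then have "case f of (i, j) \<Rightarrow> I (i, j) \<subseteq> V - ?B \<and> card (I (i, j)) \<le> Suc q \<and> conn ({v i, v j} \<union> I (i, j))"
          using I by blast
        then show ?thesis using False by (cases f) auto
      qed
    next
      fix f g assume fg: "f \<in> insert e P" "g \<in> insert e P" "f \<noteq> g"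
      show "?I f \<inter> ?I g = {}"
      proof (cases "f = e")
        case True
        then have "g \<in> P" "g \<noteq> e" using fg by auto
        then show ?thesis using True 4[of g] by simp
      next
        case f: False
        then have fP: "f \<in> P" using fg by simp
        show ?thesis
        proof (cases "g = e")
          case True
          then show ?thesis using f 4[OF fP] by (simp add: Int_commute)
        next
          case False
          then have "I f \<inter> I g = {}" using fP fg I by blast
          then show ?thesis using f False by simp
        qed
      qed
    qed
    then show ?case by blast
  qed simp
  have "\<exists>I. ?ok I ?All" by (rule ex[OF order_refl])
  then obtain I where I: "?ok I ?All" ..
  show ?thesis
  proof (intro exI[of _ I] allI impI)
    fix i j assume ij: "i < j \<and> j < n"
    then have e: "(i, j) \<in> ?All" by simp
    have a: "I (i, j) \<subseteq> V - ?B" "card (I (i, j)) \<le> Suc q" "conn ({v i, v j} \<union> I (i, j))"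
      using bspec[OF I[THEN conjunct1] e] by simp_all
    have b: "\<forall>k l. k < l \<and> l < n \<and> (k, l) \<noteq> (i, j) \<longrightarrow> I (i, j) \<inter> I (k, l) = {}"
    proof (intro allI impI)
      fix k l assume "k < l \<and> l < n \<and> (k, l) \<noteq> (i, j)"
      then have "(k, l) \<in> ?All" "(i, j) \<noteq> (k, l)" by auto
      then show "I (i, j) \<inter> I (k, l) = {}" by (rule I[THEN conjunct2, rule_format, OF e])
    qed
    show "I (i, j) \<subseteq> V - ?B \<and> card (I (i, j)) \<le> Suc q \<and>
     conn ({v i, v j} \<union> I (i, j)) \<and> (\<forall>k l. k < l \<and> l < n \<and> (k, l) \<noteq> (i, j) \<longrightarrow> I (i, j) \<inter> I (k, l) = {})" by (intro conjI a b)
  qed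
qed

end

lemma finite_color_space: "finite (Pow ({..<4::nat} \<times> {..<4::nat} \<times> {..<4::nat} \<times> {..<4::nat} \<times> {..<w::nat} \<times> {..<w}))"
  by simp

lemma sorted_embedding:
  assumes A: "A \<subseteq> {..<M}" "card A \<le> 4" "4 \<le> (M::nat)"
  obtains ps where "sorted_wrt (<) ps" "length ps = 4" "set ps \<subseteq> {..<M}" "A \<subseteq> set ps"
proof -
  have finA: "finite A" using A(1) finite_subset by blast
  obtain T where T: "A \<subseteq> T" "T \<subseteq> {..<M}" "card T = 4"
    using exists_subset_between[of A 4 "{..<M}"] A finA by auto
  then have finT: "finite T" using finite_subset by blast
  show thesis
    by (rule that[of "sorted_list_of_set T"]) (use T finT in \<open>auto simp: strict_sorted_list_of_set\<close>)
qed

text \<open>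
  Vertices that are pairwise joined by short walks avoiding any bounded set span a subdivided complete graph,
  which becomes induced after an application of Ramsey's theorem to \<open>4\<close>-tuples of branch vertices. The colour of a tuple
  records all adjacencies between the connections inside it. An adjacency between
  two connections neither of whose index sets contains the other would, by homogeneity, be repeated over many disjoint choices of the
  indices, and produce a biclique.
\<close>
lemma close_many:
  "\<exists>n z. \<forall>E (V::'a set) B. sgraph E \<longrightarrow> finite V \<longrightarrow> sgraph.nobiclique E s V \<longrightarrow> B \<subseteq> V \<longrightarrow> card B = n \<longrightarrow>
     (\<forall>u\<in>B. \<forall>w\<in>B. \<forall>Z. u \<noteq> w \<longrightarrow> Z \<subseteq> V - {u, w} \<longrightarrow> card Z \<le> z \<longrightarrow> sgraph.shortwalk E q (V - Z) u w) \<longrightarrow>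
     sgraph.has_tripods E p m V"
proof -
  \<comment> \<open>Four blocks of \<open>s\<close> indices for bicliques, and the branch vertices of all claws; a connection has at most \<open>q + 1\<close> inner vertices.\<close>
  let ?M = "4 * s + m * (3 * p + 1) + 4" and ?w = "q + 2"
  let ?Col = "Pow ({..<4::nat} \<times> {..<4::nat} \<times> {..<4::nat} \<times> {..<4::nat} \<times> {..<?w} \<times> {..<?w})"
  obtain N where N: "\<And>F :: nat list \<Rightarrow> (nat \<times> nat \<times> nat \<times> nat \<times> nat \<times> nat) set. (\<forall>xs. F xs \<in> ?Col) \<Longrightarrow>
    (\<exists>(e :: nat \<Rightarrow> nat) c. strict_mono_on {..<?M} e \<and> e ` {..<?M} \<subseteq> {..<N} \<and>
      (\<forall>ps. sorted_wrt (<) ps \<and> length ps = 4 \<and> set ps \<subseteq> {..<?M} \<longrightarrow> F (map e ps) = c))"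
    using ramsey_tuples[OF finite_color_space[of ?w], of ?M 4] by blast
  show ?thesis
  proof (rule exI[of _ N], rule exI[of _ "N + N * N * Suc q"], intro allI impI)
    fix E and V B :: "'a set"
    assume "sgraph E" and finV: "finite V" and nb: "sgraph.nobiclique E s V" and B: "B \<subseteq> V" "card B = N"
      and close: "\<forall>u\<in>B. \<forall>w\<in>B. \<forall>Z. u \<noteq> w \<longrightarrow> Z \<subseteq> V - {u, w} \<longrightarrow> card Z \<le> N + N * N * Suc q \<longrightarrow>
        sgraph.shortwalk E q (V - Z) u w"
    interpret sgraph E by fact
    have "finite B" using B finV finite_subset by blast
    then obtain v where v: "bij_betw v {..<N} B"
      using ex_bij_betw_nat_finite[of B] B(2) unfolding lessThan_atLeast0 by blast
    then have vinj: "inj_on v {..<N}" and vB: "v ` {..<N} = B" by (auto simp: bij_betw_def)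
    have "\<exists>I. \<forall>i j. i < j \<and> j < N \<longrightarrow> I (i, j) \<subseteq> V - v ` {..<N} \<and> card (I (i, j)) \<le> Suc q \<and>
     conn ({v i, v j} \<union> I (i, j)) \<and> (\<forall>k l. k < l \<and> l < N \<and> (k, l) \<noteq> (i, j) \<longrightarrow> I (i, j) \<inter> I (k, l) = {})"
    proof (rule connectors[OF vinj _ finV])
      show "v ` {..<N} \<subseteq> V" using vB B by simp
      fix u w Z assume "u \<in> v ` {..<N}" "w \<in> v ` {..<N}" "u \<noteq> w" "Z \<subseteq> V - {u, w}" "card Z \<le> N + N * N * Suc q"
      then show "shortwalk q (V - Z) u w" using close unfolding vB by blast
    qed
    then obtain I where I0: "\<forall>i j. i < j \<and> j < N \<longrightarrow> I (i, j) \<subseteq> V - v ` {..<N} \<and> card (I (i, j)) \<le> Suc q \<and>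
     conn ({v i, v j} \<union> I (i, j)) \<and> (\<forall>k l. k < l \<and> l < N \<and> (k, l) \<noteq> (i, j) \<longrightarrow> I (i, j) \<inter> I (k, l) = {})" ..
    have I: "I (i, j) \<subseteq> V - B \<and> card (I (i, j)) \<le> Suc q \<and> conn ({v i, v j} \<union> I (i, j))" if "i < j" "j < N" for i j
      using I0[rule_format, of i j] that unfolding vB by simp
    have Id: "I (i, j) \<inter> I (k, l) = {}" if "i < j" "j < N" "k < l" "l < N" "(k, l) \<noteq> (i, j)" for i j k l
      using I0[rule_format, of i j, THEN conjunct2, THEN conjunct2, THEN conjunct2, rule_format, of k l] that by simp
    define part where "part i j = (if i = j then {v i} else I (i, j))" for i j
    have vN: "v i \<in> B" if "i < N" for i using vB that by blast
    have partV: "part i j \<subseteq> V" if "i \<le> j" "j < N" for i j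
      using that I[of i j] vN[of i] B(1) by (auto simp: part_def)
    have pfin: "finite (part i j) \<and> card (part i j) \<le> ?w" if "i \<le> j" "j < N" for i j
      using that I[of i j] finite_subset[OF partV[OF that] finV] by (auto simp: part_def)
    have pdisj: "part i j \<inter> part k l = {}" if "i \<le> j" "j < N" "k \<le> l" "l < N" "(i, j) \<noteq> (k, l)" for i j k l
    proof (cases "i = j"; cases "k = l")
      assume "i = j" "k = l"
      then show ?thesis using that inj_onD[OF vinj, of i k] by (auto simp: part_def)
    next
      assume "i = j" "k \<noteq> l"
      then show ?thesis using that I[of k l] vN[of i] by (auto simp: part_def)
    next
      assume "i \<noteq> j" "k = l"
      then show ?thesis using that I[of i j] vN[of k] by (auto simp: part_def)
    next
      assume "i \<noteq> j" "k \<noteq> l"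
      then show ?thesis using that Id[of i j k l] by (auto simp: part_def)
    qed
    define ls where "ls i j = (SOME xs. set xs = part i j \<and> distinct xs)" for i j
    have ls: "set (ls i j) = part i j \<and> length (ls i j) \<le> ?w" if "i \<le> j" "j < N" for i j
    proof -
      have "\<exists>xs. set xs = part i j \<and> distinct xs" using finite_distinct_list pfin[OF that] by blast
      then have "set (ls i j) = part i j \<and> distinct (ls i j)" unfolding ls_def by (rule someI_ex)
      then show ?thesis using distinct_card[of "ls i j"] pfin[OF that] by simp
    qed
    define F where "F = (\<lambda>xs. {(\<alpha>,\<alpha>',\<gamma>,\<gamma>',a,b). \<alpha> < 4 \<and> \<alpha>' < 4 \<and> \<gamma> < 4 \<and> \<gamma>' < 4 \<and> a < ?w \<and> b < ?w \<and>
      a < length (ls (xs!\<alpha>) (xs!\<alpha>')) \<and> b < length (ls (xs!\<gamma>) (xs!\<gamma>')) \<and>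
      E (ls (xs!\<alpha>) (xs!\<alpha>') ! a) (ls (xs!\<gamma>) (xs!\<gamma>') ! b)})"
    have "\<forall>xs. F xs \<in> ?Col" by (auto simp: F_def)
    from N[OF this] obtain e c where e: "strict_mono_on {..<?M} e" "e ` {..<?M} \<subseteq> {..<N}"
      and c0: "\<forall>ps. sorted_wrt (<) ps \<and> length ps = 4 \<and> set ps \<subseteq> {..<?M} \<longrightarrow> F (map e ps) = c"
      by (elim exE conjE) (rule that)
    have c: "F (map e ps) = c" if "sorted_wrt (<) ps" "length ps = 4" "set ps \<subseteq> {..<?M}" for ps
      using c0 that by simp
    have eN: "e i < N" if "i < ?M" for i using e(2) that by blast
    have emono: "e i < e j" if "i < j" "j < ?M" for i j using strict_mono_onD[OF e(1), of i j] that by auto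
    have emono': "e i \<le> e j" if "i \<le> j" "j < ?M" for i j using emono[of i j] that by (cases "i = j") auto
    have einj: "i = j" if "e i = e j" "i < ?M" "j < ?M" for i j
      using emono[of i j] emono[of j i] that by (metis less_irrefl linorder_neqE_nat)
    have key: False
      if col: "(\<alpha>,\<alpha>',\<gamma>,\<gamma>',a,b) \<in> c" and o: "\<alpha> \<le> \<alpha>'" "\<gamma> \<le> \<gamma>'" "\<alpha>' < 4" "\<gamma>' < 4"
        and nest: "\<not> {\<alpha>, \<alpha>'} \<subseteq> {\<gamma>, \<gamma>'}" "\<not> {\<gamma>, \<gamma>'} \<subseteq> {\<alpha>, \<alpha>'}" for \<alpha> \<alpha>' \<gamma> \<gamma>' a b
    proof -
      have hM: "P * s + t < ?M" if "P < 4" "t < s" for P t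
      proof -
        have "Suc P * s \<le> 4 * s" using that by (intro mult_le_mono1) simp
        then have "P * s + t < 4 * s" using that unfolding mult_Suc by linarith
        then show ?thesis by simp
      qed
      have hmono: "P * s + t < P' * s + t'" if "P < P'" "t < s" for P P' t t'
      proof -
        have "Suc P * s \<le> P' * s" using that by (intro mult_le_mono1) simp
        then show ?thesis using that unfolding mult_Suc by linarith
      qed
      \<comment> \<open>The four positions of a tuple range over four consecutive blocks of \<open>s\<close> indices. The positions shared by both
        connections stay fixed, while the others vary independently on the two sides.\<close>
      define ia where "ia P t = (if P \<in> {\<gamma>, \<gamma>'} then 0 else t)" for P t :: nat
      define ib where "ib P t = (if P \<in> {\<alpha>, \<alpha>'} then 0 else t)" for P t :: nat
      let ?ga = "\<lambda>P t. e (P * s + ia P t)" and ?gb = "\<lambda>P t. e (P * s + ib P t)"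
      have adj: "a < length (ls (?ga \<alpha> t) (?ga \<alpha>' t)) \<and> b < length (ls (?gb \<gamma> t') (?gb \<gamma>' t')) \<and>
          E (ls (?ga \<alpha> t) (?ga \<alpha>' t) ! a) (ls (?gb \<gamma> t') (?gb \<gamma>' t') ! b)" if t: "t < s" "t' < s" for t t'
      proof -
        define ix where "ix P = (if P \<in> {\<alpha>, \<alpha>'} then ia P t else ib P t')" for P
        have ixs: "ix P < s" for P using t by (auto simp: ix_def ia_def ib_def)
        have ixa: "ix \<alpha> = ia \<alpha> t" "ix \<alpha>' = ia \<alpha>' t" by (auto simp: ix_def)
        have ixb: "ix \<gamma> = ib \<gamma> t'" "ix \<gamma>' = ib \<gamma>' t'" by (auto simp: ix_def ia_def ib_def)
        let ?ps = "map (\<lambda>P. P * s + ix P) [0..<4]"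
        have "sorted_wrt (<) ?ps" unfolding sorted_wrt_map
          by (rule sorted_wrt_mono_rel[OF _ sorted_wrt_upt]) (use hmono ixs in blast)
        moreover have "set ?ps \<subseteq> {..<?M}" using hM ixs by auto
        ultimately have Fc: "F (map e ?ps) = c" by (intro c) auto
        have nthps: "map e ?ps ! P = e (P * s + ix P)" if "P < 4" for P using that by (simp del: upt_Suc)
        have "\<alpha> < 4" "\<gamma> < 4" using o by auto
        then show ?thesis
          using col[folded Fc] nthps[of \<alpha>] nthps[of \<alpha>'] nthps[of \<gamma>] nthps[of \<gamma>'] o ixa ixb
          unfolding F_def by simp
      qed
      have lsel: "inj_on (\<lambda>t. ls (e (P * s + i1 t)) (e (P' * s + i2 t)) ! d) {..<s} \<and>
          (\<lambda>t. ls (e (P * s + i1 t)) (e (P' * s + i2 t)) ! d) ` {..<s} \<subseteq> V"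
        if PP: "P \<le> P'" "P' < 4" and i12: "\<And>t. t < s \<Longrightarrow> i1 t < s \<and> i2 t < s" "P = P' \<Longrightarrow> i1 = i2"
          and d: "\<And>t. t < s \<Longrightarrow> d < length (ls (e (P * s + i1 t)) (e (P' * s + i2 t)))"
          and ne: "\<And>t t'. t < s \<Longrightarrow> t' < s \<Longrightarrow> t \<noteq> t' \<Longrightarrow> i1 t \<noteq> i1 t' \<or> i2 t \<noteq> i2 t'" for P P' i1 i2 d
      proof -
        have le: "e (P * s + i1 t) \<le> e (P' * s + i2 t)" "e (P' * s + i2 t) < N" if "t < s" for t
        proof -
          have "P * s + i1 t \<le> P' * s + i2 t"
            using hmono[of P P' "i1 t" "i2 t"] i12(1)[OF that] i12(2) PP by (cases "P = P'") auto
          moreover have "P' * s + i2 t < ?M" using hM PP i12(1)[OF that] by blast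
          ultimately show "e (P * s + i1 t) \<le> e (P' * s + i2 t)" "e (P' * s + i2 t) < N"
            using emono' eN by blast+
        qed
        have mem: "ls (e (P * s + i1 t)) (e (P' * s + i2 t)) ! d \<in> part (e (P * s + i1 t)) (e (P' * s + i2 t))" if "t < s" for t
          using nth_mem[OF d[OF that]] ls[OF le[OF that]] by simp
        have "inj_on (\<lambda>t. ls (e (P * s + i1 t)) (e (P' * s + i2 t)) ! d) {..<s}"
        proof (rule inj_onI, rule ccontr)
          fix t t' assume t: "t \<in> {..<s}" "t' \<in> {..<s}" "t \<noteq> t'"
            and eq: "ls (e (P * s + i1 t)) (e (P' * s + i2 t)) ! d = ls (e (P * s + i1 t')) (e (P' * s + i2 t')) ! d"
          have t': "t < s" "t' < s" using t by auto
          have b: "P * s + i1 t < ?M" "P' * s + i2 t < ?M" "P * s + i1 t' < ?M" "P' * s + i2 t' < ?M"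
            using hM[of P] hM[of P'] i12(1)[OF t'(1)] i12(1)[OF t'(2)] PP by auto
          have "(e (P * s + i1 t), e (P' * s + i2 t)) \<noteq> (e (P * s + i1 t'), e (P' * s + i2 t'))"
            using ne[OF t' t(3)] einj[OF _ b(1,3)] einj[OF _ b(2,4)] by auto
          then have "part (e (P * s + i1 t)) (e (P' * s + i2 t)) \<inter> part (e (P * s + i1 t')) (e (P' * s + i2 t')) = {}"
            by (rule pdisj[OF le[OF t'(1)] le[OF t'(2)]])
          then show False using mem[OF t'(1)] mem[OF t'(2)] eq by auto
        qed
        moreover have "(\<lambda>t. ls (e (P * s + i1 t)) (e (P' * s + i2 t)) ! d) ` {..<s} \<subseteq> V"
          using mem partV[OF le] by blast
        ultimately show ?thesis by blast
      qed
      have s0: "0 < s" using nobicliqueD[OF nb, of undefined undefined] by (cases "s = 0") auto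
      have A: "inj_on (\<lambda>t. ls (?ga \<alpha> t) (?ga \<alpha>' t) ! a) {..<s} \<and> (\<lambda>t. ls (?ga \<alpha> t) (?ga \<alpha>' t) ! a) ` {..<s} \<subseteq> V"
      proof (rule lsel)
        fix t t' assume "t < s" "t' < s" "t \<noteq> t'"
        then show "ia \<alpha> t \<noteq> ia \<alpha> t' \<or> ia \<alpha>' t \<noteq> ia \<alpha>' t'" using nest by (auto simp: ia_def)
      next
        fix t assume "t < s"
        then show "a < length (ls (?ga \<alpha> t) (?ga \<alpha>' t))" using adj[of t t] by blast
      qed (use o s0 in \<open>auto simp: ia_def\<close>)
      have Bb: "inj_on (\<lambda>t. ls (?gb \<gamma> t) (?gb \<gamma>' t) ! b) {..<s} \<and> (\<lambda>t. ls (?gb \<gamma> t) (?gb \<gamma>' t) ! b) ` {..<s} \<subseteq> V"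
      proof (rule lsel)
        fix t t' assume "t < s" "t' < s" "t \<noteq> t'"
        then show "ib \<gamma> t \<noteq> ib \<gamma> t' \<or> ib \<gamma>' t \<noteq> ib \<gamma>' t'" using nest by (auto simp: ib_def)
      next
        fix t assume "t < s"
        then show "b < length (ls (?gb \<gamma> t) (?gb \<gamma>' t))" using adj[of t t] by blast
      qed (use o s0 in \<open>auto simp: ib_def\<close>)
      show False
        by (rule nobicliqueD[OF nb A[THEN conjunct1] Bb[THEN conjunct1] A[THEN conjunct2] Bb[THEN conjunct2]])
          (use adj in blast)
    qed
    show "has_tripods p m V"
    proof (rule subdivided_clique_many[of ?M "\<lambda>i j. part (e i) (e j)" "\<lambda>i. v (e i)"])
      fix i j k l assume ij: "i \<le> j" "j < ?M" "k \<le> l" "l < ?M" 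
      note le = emono'[OF ij(1,2)] eN[OF ij(2)] emono'[OF ij(3,4)] eN[OF ij(4)]
      { assume "(i, j) \<noteq> (k, l)"
        moreover have "i < ?M" "k < ?M" using ij by auto
        ultimately have "(e i, e j) \<noteq> (e k, e l)" using einj[of i k] einj[of j l] ij by auto
        then show "part (e i) (e j) \<inter> part (e k) (e l) = {}" by (rule pdisj[OF le]) }
      { fix x y assume nest: "\<not> {i, j} \<subseteq> {k, l}" "\<not> {k, l} \<subseteq> {i, j}"
          and x: "x \<in> part (e i) (e j)" and y: "y \<in> part (e k) (e l)"
        show "\<not> E x y"
        proof
          assume xy: "E x y"
          have "{i, j, k, l} \<subseteq> {..<?M}" using ij by auto
          moreover have "card {i, j, k, l} \<le> 4" by (simp add: card_insert_if)
          ultimately obtain ps where ps: "sorted_wrt (<) ps" "length ps = 4" "set ps \<subseteq> {..<?M}" "{i, j, k, l} \<subseteq> set ps"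
            using sorted_embedding[of "{i, j, k, l}" ?M] by auto
          have "\<exists>P<4. ps ! P = z" if "z \<in> {i, j, k, l}" for z
            using ps(2,4) that by (metis in_set_conv_nth subsetD)
          then obtain P where P: "\<And>z. z \<in> {i, j, k, l} \<Longrightarrow> P z < 4 \<and> ps ! P z = z" by metis
          have Pm: "P z \<le> P z'" if "z \<in> {i,j,k,l}" "z' \<in> {i,j,k,l}" "z \<le> z'" for z z'
          proof (rule ccontr)
            assume "\<not> P z \<le> P z'"
            then have "ps ! P z' < ps ! P z" using sorted_wrt_nth_less[OF ps(1), of "P z'" "P z"] P[OF that(1)] ps(2) by simp
            then show False using P[OF that(1)] P[OF that(2)] that(3) by simp
          qed
          have Pi: "P z = P z' \<longleftrightarrow> z = z'" if "z \<in> {i,j,k,l}" "z' \<in> {i,j,k,l}" for z z'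
          proof
            assume e: "P z = P z'"
            have "ps ! P z = z" "ps ! P z' = z'" using P[OF that(1)] P[OF that(2)] by simp_all
            then show "z = z'" unfolding e by simp
          qed simp
          obtain a where a: "a < length (ls (e i) (e j))" "x = ls (e i) (e j) ! a"
            using x ls[OF le(1,2)] by (metis in_set_conv_nth)
          obtain b where b: "b < length (ls (e k) (e l))" "y = ls (e k) (e l) ! b"
            using y ls[OF le(3,4)] by (metis in_set_conv_nth)
          have nth: "map e ps ! P z = e z" if "z \<in> {i,j,k,l}" for z using P[OF that] ps(2) by simp
          have "(P i, P j, P k, P l, a, b) \<in> F (map e ps)"
            unfolding F_def using nth[of i] nth[of j] nth[of k] nth[of l] P a b xy ls[OF le(1,2)] ls[OF le(3,4)] by auto
          then have "(P i, P j, P k, P l, a, b) \<in> c" using c[OF ps(1-3)] by simp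
          then show False
          proof (rule key)
            show "P i \<le> P j" "P k \<le> P l" using Pm ij by auto
            show "P j < 4" "P l < 4" using P by auto
            show "\<not> {P i, P j} \<subseteq> {P k, P l}" "\<not> {P k, P l} \<subseteq> {P i, P j}" using nest Pi by auto
          qed
        qed }
    next
      fix i j assume ij: "i < j" "j < ?M"
      have "e i < e j" "e j < N" using emono[OF ij] eN[OF ij(2)] by auto
      moreover have "{v (e i)} \<union> I (e i, e j) \<union> {v (e j)} = {v (e i), v (e j)} \<union> I (e i, e j)" by blast
      ultimately show "conn (part (e i) (e i) \<union> part (e i) (e j) \<union> part (e j) (e j))"
        using I[of "e i" "e j"] unfolding part_def by simp
    next
      fix i j assume "i \<le> j" "j < ?M"
      then show "part (e i) (e j) \<subseteq> V" using partV emono' eN by blast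
    qed (auto simp: part_def)
  qed
qed

section \<open>Many disjoint tripods\<close>

text \<open>
  Many vertices of high connectivity to the main component yield many claws: by Ramsey's theorem, a large subset of them is
  pairwise close, which gives an induced subdivided complete graph, or pairwise far, which gives
  claws around the single vertices.
\<close>
lemma block_many:
  "\<exists>b0 k. 1 \<le> k \<and> (\<forall>E (V :: 'a set) W \<kappa> c B. tangled E V W \<kappa> c \<longrightarrow> k \<le> \<kappa> \<longrightarrow>
     sgraph.nobiclique E s V \<longrightarrow> B \<subseteq> V \<longrightarrow> b0 \<le> card B \<longrightarrow>
     (\<forall>v\<in>B. \<forall>Y. Y \<subseteq> V \<longrightarrow> card Y \<le> k \<longrightarrow> v \<notin> Y \<longrightarrow> v \<in> tangled.\<beta> E V W c Y) \<longrightarrow> sgraph.has_tripods E p m V)"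
proof -
  \<comment> \<open>Two vertices are needed because a far vertex serves as the target of the long paths.\<close>
  let ?m = "max m 2" and ?q = "2 * p + 1"
  obtain n z where close: "\<And>E (V::'a set) B. sgraph E \<Longrightarrow> finite V \<Longrightarrow> sgraph.nobiclique E s V \<Longrightarrow> B \<subseteq> V \<Longrightarrow> card B = n \<Longrightarrow>
     (\<forall>u\<in>B. \<forall>w\<in>B. \<forall>Z. u \<noteq> w \<longrightarrow> Z \<subseteq> V - {u, w} \<longrightarrow> card Z \<le> z \<longrightarrow> sgraph.shortwalk E ?q (V - Z) u w) \<Longrightarrow>
     sgraph.has_tripods E p ?m V"
    using close_many[of s ?q p ?m, where 'a = 'a] by blast
  obtain Ns where Ns: "\<And>E (V :: 'a set) L. sgraph E \<Longrightarrow> sgraph.nobiclique E s V \<Longrightarrow>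
     (\<forall>i<Ns. length (L i) = p \<and> set (L i) \<subseteq> V) \<Longrightarrow>
     (\<forall>i<Ns. \<forall>j<Ns. i \<noteq> j \<longrightarrow> set (L i) \<inter> set (L j) = {}) \<Longrightarrow>
     (\<exists>e::nat \<Rightarrow> nat. e ` {..<3} \<subseteq> {..<Ns} \<and>
        (\<forall>i<3. \<forall>j<3. i \<noteq> j \<longrightarrow> sgraph.apart E (set (L (e i))) (set (L (e j)))))"
    using apart_tuples[of s p 3, where 'a = 'a] by blast
  obtain Nf where Nf: "\<And>(W::'a set) f. Nf \<le> card W \<Longrightarrow> (\<forall>P. finite (f P) \<and> card (f P) \<le> z) \<Longrightarrow>
     (\<exists>X\<subseteq>W. finite X \<and> card X = ?m \<and> (\<forall>u\<in>X. \<forall>v\<in>X. \<forall>w\<in>X. u \<noteq> v \<and> w \<noteq> u \<and> w \<noteq> v \<longrightarrow> w \<notin> f {u, v}))"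
    using free_set[of z ?m, where 'a = 'a] by blast
  \<comment> \<open>A homogeneous set that is large enough for both of the two cases.\<close>
  let ?M = "n + Nf"
  obtain N0 where N0: "\<And>F :: nat list \<Rightarrow> bool.
    (\<exists>(e :: nat \<Rightarrow> nat) c. strict_mono_on {..<?M} e \<and> e ` {..<?M} \<subseteq> {..<N0} \<and>
      (\<forall>ps. sorted_wrt (<) ps \<and> length ps = 2 \<and> set ps \<subseteq> {..<?M} \<longrightarrow> F (map e ps) = c))"
    using ramsey_tuples[of "UNIV :: bool set" ?M 2] by auto
  define k where "k = ?m * ?m * z + Ns * p + 1"
  show ?thesis
  proof (rule exI[of _ N0], rule exI[of _ k], intro conjI allI impI)
    show "1 \<le> k" by (simp add: k_def)
    fix E and V W B :: "'a set" and \<kappa> c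
    assume T: "tangled E V W \<kappa> c" and k\<kappa>: "k \<le> \<kappa>" and nb: "sgraph.nobiclique E s V" and B: "B \<subseteq> V" "N0 \<le> card B"
      and core: "\<forall>v\<in>B. \<forall>Y. Y \<subseteq> V \<longrightarrow> card Y \<le> k \<longrightarrow> v \<notin> Y \<longrightarrow> v \<in> tangled.\<beta> E V W c Y"
    interpret tangled E V W \<kappa> c by (rule T)
    have "finite B" using B fin finite_subset by blast
    then obtain h where h: "bij_betw h {..<card B} B"
      using ex_bij_betw_nat_finite[of B] unfolding lessThan_atLeast0 by blast
    define cl where "cl u w \<longleftrightarrow> (\<forall>Z. Z \<subseteq> V - {u, w} \<longrightarrow> card Z \<le> z \<longrightarrow> shortwalk ?q (V - Z) u w)" for u w
    have cl_sym1: "cl w u" if "cl u w" for u w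
      unfolding cl_def
    proof (intro allI impI)
      fix Z assume "Z \<subseteq> V - {w, u}" "card Z \<le> z"
      then have "shortwalk ?q (V - Z) u w" using that unfolding cl_def by (simp add: insert_commute)
      then show "shortwalk ?q (V - Z) w u" by (rule shortwalk_sym)
    qed
    have cl_sym: "cl u w \<longleftrightarrow> cl w u" for u w using cl_sym1 by blast
    obtain e col where e: "strict_mono_on {..<?M} e" "e ` {..<?M} \<subseteq> {..<N0}"
      and col0: "\<forall>ps. sorted_wrt (<) ps \<and> length ps = 2 \<and> set ps \<subseteq> {..<?M} \<longrightarrow> cl (h (map e ps ! 0)) (h (map e ps ! 1)) = col"
      using N0[of "\<lambda>xs. cl (h (xs ! 0)) (h (xs ! 1))"] by (elim exE conjE) (rule that)
    have col: "cl (h (map e ps ! 0)) (h (map e ps ! 1)) = col" if "sorted_wrt (<) ps" "length ps = 2" "set ps \<subseteq> {..<?M}" for ps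
      using col0[rule_format, OF conjI[OF that(1) conjI[OF that(2,3)]]] .
    define g where "g i = h (e i)" for i
    have eB: "e i < card B" if "i < ?M" for i
    proof -
      have "e i < N0" using e(2) that by blast
      then show ?thesis using B(2) by simp
    qed
    have gB: "g i \<in> B" if "i < ?M" for i using eB[OF that] h by (auto simp: g_def bij_betw_def)
    have ginj: "inj_on g {..<?M}"
    proof (rule inj_onI)
      fix i j assume ij: "i \<in> {..<?M}" "j \<in> {..<?M}" "g i = g j"
      then have "e i = e j" using h eB[of i] eB[of j] by (auto simp: g_def bij_betw_def inj_on_def)
      then show "i = j" using strict_mono_on_imp_inj_on[OF e(1)] ij by (auto simp: inj_on_def)
    qed
    have lt: "cl (g i) (g j) = col" if "i < j" "j < ?M" for i j
      using col[of "[i, j]"] that by (simp add: g_def)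
    have gcl: "cl (g i) (g j) = col" if "i < ?M" "j < ?M" "i \<noteq> j" for i j
      using lt[of i j] lt[of j i] cl_sym[of "g i" "g j"] that by (cases "i < j") auto
    have "has_tripods p ?m V"
    proof (cases col)
      case True
      show ?thesis
      proof (rule close[OF sgraph_axioms fin nb])
        show "g ` {..<n} \<subseteq> V" using gB B(1) by auto
        show "card (g ` {..<n}) = n" using card_image[OF inj_on_subset[OF ginj, of "{..<n}"]] by auto
        show "\<forall>u\<in>g ` {..<n}. \<forall>w\<in>g ` {..<n}. \<forall>Z. u \<noteq> w \<longrightarrow> Z \<subseteq> V - {u, w} \<longrightarrow> card Z \<le> z \<longrightarrow> shortwalk ?q (V - Z) u w"
        proof (intro ballI allI impI)
          fix u w Z assume u: "u \<in> g ` {..<n}" "w \<in> g ` {..<n}" "u \<noteq> w" and Z: "Z \<subseteq> V - {u, w}" "card Z \<le> z"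
          obtain i j where ij: "u = g i" "w = g j" "i < n" "j < n" using u by auto
          then have "cl u w" using gcl[of i j] True u(3) by auto
          then show "shortwalk ?q (V - Z) u w" using Z unfolding cl_def by blast
        qed
      qed
    next
      case False
      let ?W = "g ` {..<Nf}"
      have ncl: "\<not> cl u w" if uw: "u \<in> ?W" "w \<in> ?W" "u \<noteq> w" for u w
      proof -
        obtain i j where ij: "u = g i" "w = g j" "i < Nf" "j < Nf" using uw by auto
        then show ?thesis using gcl[of i j] False uw(3) by auto
      qed
      have "\<exists>Z. (\<exists>u w. P = {u, w} \<and> u \<in> ?W \<and> w \<in> ?W \<and> u \<noteq> w) \<longrightarrow> Z \<subseteq> V - P \<and> card Z \<le> z \<and>
          (\<forall>u w. P = {u, w} \<longrightarrow> \<not> shortwalk ?q (V - Z) u w)" for P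
      proof (cases "\<exists>u w. P = {u, w} \<and> u \<in> ?W \<and> w \<in> ?W \<and> u \<noteq> w")
        case True
        then obtain u w where uw: "P = {u, w}" "u \<in> ?W" "w \<in> ?W" "u \<noteq> w" by blast
        then obtain Z where Z: "Z \<subseteq> V - {u, w}" "card Z \<le> z" "\<not> shortwalk ?q (V - Z) u w"
          using ncl[OF uw(2-4)] unfolding cl_def by blast
        have "\<not> shortwalk ?q (V - Z) u' w'" if "P = {u', w'}" for u' w'
          using that Z(3) shortwalk_sym unfolding uw(1) by (auto simp: doubleton_eq_iff)
        then show ?thesis using Z uw by blast
      qed blast
      then obtain f0 where f0: "\<And>u w. u \<in> ?W \<Longrightarrow> w \<in> ?W \<Longrightarrow> u \<noteq> w \<Longrightarrow> f0 {u, w} \<subseteq> V - {u, w} \<and> card (f0 {u, w}) \<le> z \<and>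
          \<not> shortwalk ?q (V - f0 {u, w}) u w"
        by metis
      define f where "f P = (if finite (f0 P) \<and> card (f0 P) \<le> z then f0 P else {})" for P
      have "\<forall>P. finite (f P) \<and> card (f P) \<le> z" by (auto simp: f_def)
      moreover have "Nf \<le> card ?W" using card_image[OF inj_on_subset[OF ginj, of "{..<Nf}"]] by auto
      ultimately obtain X where X: "X \<subseteq> ?W" "finite X" "card X = ?m"
        "\<forall>u\<in>X. \<forall>v\<in>X. \<forall>w\<in>X. u \<noteq> v \<and> w \<noteq> u \<and> w \<noteq> v \<longrightarrow> w \<notin> f {u, v}"
        using Nf by metis
      have ff0: "f {u, w} = f0 {u, w}" if "u \<in> X" "w \<in> X" "u \<noteq> w" for u w
      proof -
        have "f0 {u, w} \<subseteq> V" "card (f0 {u, w}) \<le> z" using f0[of u w] that X(1) by blast+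
        then show ?thesis using finite_subset[OF _ fin] unfolding f_def by auto
      qed
      define Z where "Z = (\<Union>(u, w)\<in>{(u, w). u \<in> X \<and> w \<in> X \<and> u \<noteq> w}. f {u, w})"
      have ZV: "Z \<subseteq> V"
      proof
        fix x assume "x \<in> Z"
        then obtain u w where uw: "u \<in> X" "w \<in> X" "u \<noteq> w" "x \<in> f {u, w}" by (auto simp: Z_def)
        then show "x \<in> V" using ff0[OF uw(1-3)] f0[of u w] X(1) by blast
      qed
      have ZX: "Z \<inter> X = {}"
      proof -
        have "x \<notin> X" if xZ: "x \<in> Z" for x
        proof
          assume "x \<in> X"
          obtain u w where uw: "u \<in> X" "w \<in> X" "u \<noteq> w" "x \<in> f {u, w}" using xZ by (auto simp: Z_def)
          then have "x = u \<or> x = w" using X(4) \<open>x \<in> X\<close> by blast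
          then show False using ff0[OF uw(1-3)] f0[of u w] X(1) uw by blast
        qed
        then show ?thesis by blast
      qed
      have cZ: "card Z \<le> ?m * ?m * z"
      proof -
        let ?P = "{(u, w). u \<in> X \<and> w \<in> X \<and> u \<noteq> w}"
        have sub: "?P \<subseteq> X \<times> X" by auto
        have finP: "finite ?P" using finite_subset[OF sub] X(2) by simp
        have "card ?P \<le> ?m * ?m" using card_mono[OF _ sub] X(2,3) by (simp add: card_cartesian_product)
        have "card Z \<le> (\<Sum>(u, w)\<in>?P. card (f {u, w}))"
          unfolding Z_def using card_UN_le[OF finP, of "\<lambda>(u, w). f {u, w}"] by (simp add: case_prod_unfold)
        also have "\<dots> \<le> (\<Sum>(u, w)\<in>?P. z)" by (rule sum_mono) (auto simp: f_def)
        also have "\<dots> = card ?P * z" by simp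
        also have "\<dots> \<le> ?m * ?m * z" using \<open>card ?P \<le> ?m * ?m\<close> by (rule mult_le_mono1)
        finally show ?thesis .
      qed
      have WB: "?W \<subseteq> B" using gB by auto
      show ?thesis
      proof (rule far_many[where B = X and Z = Z and k = k and Ns = Ns])
        show "X \<subseteq> V" using X(1) WB B(1) by blast
        show "card X = ?m" "2 \<le> ?m" using X by auto
        show "card Z + Ns * p \<le> k" using cZ by (simp add: k_def)
        show "v \<in> \<beta> Y" if "v \<in> X" "Y \<subseteq> V" "card Y \<le> k" "v \<notin> Y" for v Y
          using core that X(1) WB by blast
        show "\<not> shortwalk (2 * p + 1) (V - Z) u v" if uv: "u \<in> X" "v \<in> X" "u \<noteq> v" for u v
        proof
          assume "shortwalk (2 * p + 1) (V - Z) u v"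
          moreover have "f0 {u, v} \<subseteq> Z" using ff0[OF uv] uv by (auto simp: Z_def)
          ultimately have "shortwalk ?q (V - f0 {u, v}) u v" unfolding shortwalk_def by blast
          then show False using f0[of u v] uv X(1) by blast
        qed
        show "\<exists>e. e ` {..<3} \<subseteq> {..<Ns} \<and> (\<forall>i<3::nat. \<forall>j<3. i \<noteq> j \<longrightarrow> apart (set (L (e i))) (set (L (e j))))"
          if "\<forall>i<Ns. length (L i) = p \<and> set (L i) \<subseteq> V" "\<forall>i<Ns. \<forall>j<Ns. i \<noteq> j \<longrightarrow> set (L i) \<inter> set (L j) = {}" for L
          by (rule Ns[OF sgraph_axioms nb that])
      qed (use ZV ZX k\<kappa> in auto)
    qed
    then show "has_tripods p m V" by (rule has_tripods_mono) simp
  qed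
qed

text \<open>
  Either many vertices cannot be cut off from the main component by \<open>k\<close> vertices, and \<open>block_many\<close> gives all tripods at once; or these
  few vertices are deleted, every remaining vertex can be cut off, and \<open>thin_tripod\<close> gives one tripod. This tripod
  lies in a region with a small neighbourhood, disjoint from it, so that the main component outside this
  region is apart from the tripod and still carries a tangle.
\<close>
lemma many_tripods:
  fixes p s m :: nat
  shows "\<exists>\<kappa>. \<forall>c. \<exists>N. \<forall>E (V :: 'a set) W. tangled E V W \<kappa> c \<longrightarrow> N \<le> card W \<longrightarrow>
    sgraph.nobiclique E s V \<longrightarrow> sgraph.has_tripods E p m V"
proof (induction m)
  case 0
  have "sgraph.has_tripods E p 0 V" if "tangled E V W 0 c" for E and V W :: "'a set" and c
  proof -
    interpret tangled E V W 0 c by (rule that)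
    show ?thesis by (simp add: has_tripods_def)
  qed
  then show ?case by blast
next
  case (Suc m)
  obtain \<kappa>m where IH: "\<And>c. \<exists>N. \<forall>E (V :: 'a set) W. tangled E V W \<kappa>m c \<longrightarrow> N \<le> card W \<longrightarrow>
    sgraph.nobiclique E s V \<longrightarrow> sgraph.has_tripods E p m V" using Suc by blast
  obtain b0 k where k: "1 \<le> k" and block: "\<forall>E (V :: 'a set) W \<kappa> c B. tangled E V W \<kappa> c \<longrightarrow> k \<le> \<kappa> \<longrightarrow>
     sgraph.nobiclique E s V \<longrightarrow> B \<subseteq> V \<longrightarrow> b0 \<le> card B \<longrightarrow>
     (\<forall>v\<in>B. \<forall>Y. Y \<subseteq> V \<longrightarrow> card Y \<le> k \<longrightarrow> v \<notin> Y \<longrightarrow> v \<in> tangled.\<beta> E V W c Y) \<longrightarrow> sgraph.has_tripods E p (Suc m) V"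
    using block_many[of s p "Suc m", where 'a = 'a] by blast
  \<comment> \<open>The order of the tangle pays for the deleted vertices, for the separator of one tripod, for the search for
    this tripod, and for the next tripods.\<close>
  define \<kappa> where "\<kappa> = \<kappa>m + b0 + (3 * p + 1) * k + 12 * k ^ (2 * p + 2) + k"
  show ?case
  proof (rule exI[of _ \<kappa>], rule allI)
    fix c
    obtain Nm where Nm: "\<And>E (V :: 'a set) W. tangled E V W \<kappa>m c \<Longrightarrow> Nm \<le> card W \<Longrightarrow>
        sgraph.nobiclique E s V \<Longrightarrow> sgraph.has_tripods E p m V" using IH[of c] by blast
    obtain F where F: "\<And>(W::'a set) f. F \<le> card W \<Longrightarrow> (\<forall>P. finite (f P) \<and> card (f P) \<le> c) \<Longrightarrow>
     (\<exists>X\<subseteq>W. finite X \<and> card X = 3 \<and> (\<forall>u\<in>X. \<forall>v\<in>X. \<forall>w\<in>X. u \<noteq> v \<and> w \<noteq> u \<and> w \<noteq> v \<longrightarrow> w \<notin> f {u, v}))"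
      using free_set[of c 3, where 'a = 'a] by blast
    show "\<exists>N. \<forall>E (V :: 'a set) W. tangled E V W \<kappa> c \<longrightarrow> N \<le> card W \<longrightarrow>
        sgraph.nobiclique E s V \<longrightarrow> sgraph.has_tripods E p (Suc m) V"
    proof (intro exI[of _ "Nm + b0 + F + 4 * c + 1"] allI impI)
      fix E and V W :: "'a set"
      assume T: "tangled E V W \<kappa> c" and N: "Nm + b0 + F + 4 * c + 1 \<le> card W"
        and nb: "sgraph.nobiclique E s V"
      interpret tangled E V W \<kappa> c by (rule T)
      define B where "B = {v \<in> V. \<forall>Y\<subseteq>V. card Y \<le> k \<and> v \<notin> Y \<longrightarrow> v \<in> \<beta> Y}"
      have BV: "B \<subseteq> V" by (auto simp: B_def)
      then have finB: "finite B" using fin finite_subset by blast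
      show "has_tripods p (Suc m) V"
      proof (cases "b0 \<le> card B")
        case True
        show ?thesis by (rule block[rule_format, OF T _ nb BV True]) (auto simp: \<kappa>_def B_def)
      next
        case False
        \<comment> \<open>The tangle survives the deletion of the few vertices that cannot be cut off.\<close>
        define V2 W2 \<kappa>2 where "V2 = V - B" and "W2 = W - B" and "\<kappa>2 = \<kappa> - b0"
        have cW2: "card W \<le> card W2 + b0"
          using diff_card_le_card_Diff[OF finB, of W] False unfolding W2_def by linarith
        have T2: "tangled E V2 W2 \<kappa>2 c"
        proof unfold_locales
          show "finite V2" "W2 \<subseteq> V2" using fin WV by (auto simp: V2_def W2_def)
          show "3 * c < card W2" using cW2 N by linarith
          fix Y assume Y: "Y \<subseteq> V2" "card Y \<le> \<kappa>2"
          have YB: "Y \<union> B \<subseteq> V" "card (Y \<union> B) \<le> \<kappa>"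
            using Y BV False card_Un_le[of Y B] by (auto simp: V2_def \<kappa>2_def \<kappa>_def)
          have "card (W2 - \<beta> (Y \<union> B)) \<le> card (W - \<beta> (Y \<union> B))"
            by (rule card_mono) (auto simp: W2_def finW)
          then show "\<exists>C\<subseteq>V2 - Y. conn C \<and> (\<forall>x\<in>C. \<forall>y\<in>V2 - Y. E x y \<longrightarrow> y \<in> C) \<and> card (W2 - C) \<le> c"
            using \<beta>(1,2,4)[OF YB] \<beta>(3)[OF YB]
            by (intro exI[of _ "\<beta> (Y \<union> B)"]) (auto simp: V2_def)
        qed
        interpret T2: tangled E V2 W2 \<kappa>2 c by (rule T2)
        have V2V: "V2 \<subseteq> V" by (auto simp: V2_def)
        interpret T2: thin E V2 W2 \<kappa>2 c k
        proof unfold_locales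
          show "1 \<le> k" by (rule k)
          fix v assume v: "v \<in> V2"
          then obtain Y where Y: "Y \<subseteq> V" "card Y \<le> k" "v \<notin> Y" "v \<notin> \<beta> Y" by (auto simp: V2_def B_def)
          have finY: "finite Y" using Y fin finite_subset by blast
          let ?Y = "Y - B"
          have Y': "?Y \<subseteq> V2" "card ?Y \<le> k" using Y card_mono[OF finY, of ?Y] by (auto simp: V2_def)
          then have Y2: "card ?Y \<le> \<kappa>2" by (simp add: \<kappa>2_def \<kappa>_def)
          have Yk: "card Y \<le> \<kappa>" using Y by (simp add: \<kappa>_def)
          have "card (W2 - \<beta> Y) \<le> card (W - \<beta> Y)" by (rule card_mono) (auto simp: W2_def finW)
          then have "card (W2 - \<beta> Y) \<le> c" using \<beta>(4)[OF Y(1) Yk] by linarith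
          then obtain w where "w \<in> T2.\<beta> ?Y" "w \<in> \<beta> Y"
            using T2.meet[OF T2.\<beta>(4)[OF Y'(1) Y2]] by blast
          then have "T2.\<beta> ?Y \<subseteq> \<beta> Y"
            using absorb[OF Y(1) Yk T2.\<beta>(2)[OF Y'(1) Y2], of w] T2.\<beta>(1)[OF Y'(1) Y2] by (auto simp: V2_def)
          then show "\<exists>Y\<subseteq>V2. card Y \<le> k \<and> v \<notin> Y \<and> v \<notin> T2.\<beta> Y" using Y Y' by (intro exI[of _ ?Y]) auto
        qed
        have "F \<le> card W2" using cW2 N by linarith
        then have "\<exists>A. tripod p A \<and> A \<subseteq> V2"
          by (intro T2.thin_tripod F) (auto simp: \<kappa>2_def \<kappa>_def)
        then obtain A where A: "tripod p A" "A \<subseteq> V2" by blast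
        have cA: "card A * k \<le> (3 * p + 1) * k" using tripod_card(2)[OF A(1)] by (rule mult_le_mono1)
        have le2: "(3 * p + 1) * k + \<kappa>m \<le> \<kappa>2" by (simp add: \<kappa>2_def \<kappa>_def)
        obtain D where D: "A \<subseteq> D" "D \<subseteq> V2" "card (nbhd V2 D) \<le> card A * k" "D \<inter> T2.\<beta> (nbhd V2 D) = {}"
          using T2.region0[OF A(2)] cA le2 by (meson add_leD1 order_trans)
        let ?n = "nbhd V2 D"
        have n: "?n \<subseteq> V2" "card ?n \<le> (3 * p + 1) * k" "card ?n \<le> \<kappa>2"
          using nbhd_sub D(3) cA le2 by (blast, linarith+)
        \<comment> \<open>The main component outside the region around the tripod.\<close>
        define V3 W3 where "V3 = T2.\<beta> ?n" and "W3 = W2 \<inter> V3"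
        have V3: "V3 \<subseteq> V2 - ?n" unfolding V3_def by (rule T2.\<beta>(1)[OF n(1,3)])
        have cW3: "card W2 \<le> card W3 + c"
        proof -
          have "W2 = W3 \<union> (W2 - V3)" by (auto simp: W3_def)
          then have "card W2 \<le> card W3 + card (W2 - V3)" by (metis card_Un_le)
          then show ?thesis using T2.\<beta>(4)[OF n(1,3)] unfolding V3_def by linarith
        qed
        have "tangled E V3 W3 \<kappa>m c"
        proof unfold_locales
          show "finite V3" using V3 T2.fin finite_subset by blast
          show "W3 \<subseteq> V3" by (simp add: W3_def)
          show "3 * c < card W3" using cW2 cW3 N by linarith
          fix Y assume Y: "Y \<subseteq> V3" "card Y \<le> \<kappa>m"
          let ?Y = "Y \<union> ?n"
          have Y': "?Y \<subseteq> V2" "card ?Y \<le> \<kappa>2" using Y V3 n card_Un_le[of Y ?n] le2 by (blast, linarith)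
          have sub: "T2.\<beta> ?Y \<subseteq> V3" unfolding V3_def by (rule T2.\<beta>_mono[OF _ Y']) blast
          have "card (W3 - T2.\<beta> ?Y) \<le> card (W2 - T2.\<beta> ?Y)"
            by (rule card_mono) (auto simp: W3_def T2.finW)
          then show "\<exists>C\<subseteq>V3 - Y. conn C \<and> (\<forall>x\<in>C. \<forall>y\<in>V3 - Y. E x y \<longrightarrow> y \<in> C) \<and> card (W3 - C) \<le> c"
            using T2.\<beta>(1,2,4)[OF Y'] T2.\<beta>(3)[OF Y'] V3 sub
            by (intro exI[of _ "T2.\<beta> ?Y"]) auto
        qed
        then have m3: "has_tripods p m V3"
        proof (rule Nm)
          show "Nm \<le> card W3" using cW2 cW3 N by linarith
          show "nobiclique s V3" by (rule nobiclique_mono[OF nb]) (use V3 V2V in blast)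
        qed
        have a3: "apart A V3"
          unfolding apart_def
        proof (intro ballI)
          fix a v assume "a \<in> A" "v \<in> V3"
          then have "a \<in> D" "v \<in> V2" "v \<notin> D" "v \<notin> nbhd V2 D"
            using D(1,4) V3 unfolding V3_def[symmetric] by blast+
          then show "a \<noteq> v \<and> \<not> E a v" unfolding nbhd_def by blast
        qed
        show ?thesis by (rule has_tripods_Suc[OF A(1) _ m3 _ a3]) (use A V2V V3 in blast)+
      qed
    qed
  qed
qed

section \<open>Tree-decompositions\<close>

context sgraph begin

text \<open>
  A tree-decomposition of the graph induced on \<open>V\<close> with bags of size at most \<open>k\<close>, whose tree is rooted: the nodes
  are lists of booleans, the root is the empty list, and the parent is the tail. The bags that contain a vertex
  form a subtree if and only if one of them is the topmost one, from which all others can be reached downwards.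
\<close>
definition rooted_dec :: "nat \<Rightarrow> 'a set \<Rightarrow> 'a set \<Rightarrow> bool list set \<Rightarrow> (bool list \<Rightarrow> 'a set) \<Rightarrow> bool" where
  "rooted_dec k V W Pos bag \<longleftrightarrow> finite Pos \<and> [] \<in> Pos \<and> (\<forall>p\<in>Pos. tl p \<in> Pos) \<and>
     (\<forall>p\<in>Pos. bag p \<subseteq> V \<and> card (bag p) \<le> k) \<and> W \<subseteq> bag [] \<and>
     (\<forall>x\<in>V. \<forall>y\<in>V. E x y \<longrightarrow> (\<exists>p\<in>Pos. x \<in> bag p \<and> y \<in> bag p)) \<and>
     (\<forall>v\<in>V. \<exists>t\<in>Pos. v \<in> bag t \<and> (\<forall>p\<in>Pos. v \<in> bag p \<and> p \<noteq> t \<longrightarrow> p \<noteq> [] \<and> v \<in> bag (tl p)))"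

definition decomposable :: "nat \<Rightarrow> 'a set \<Rightarrow> 'a set \<Rightarrow> bool" where
  "decomposable k V W \<longleftrightarrow> (\<exists>Pos bag. rooted_dec k V W Pos bag)"

lemma decomposable_leaf: "card V \<le> k \<Longrightarrow> W \<subseteq> V \<Longrightarrow> decomposable k V W"
  unfolding decomposable_def rooted_dec_def by (rule exI[of _ "{[]}"], rule exI[of _ "\<lambda>_. V"]) auto

lemma decomposable_weaken: "decomposable k V W \<Longrightarrow> W' \<subseteq> W \<Longrightarrow> decomposable k V W'"
  unfolding decomposable_def rooted_dec_def by (elim exE, intro exI conjI) (elim conjE, assumption | blast)+

text \<open>
  Two decompositions of the sides of a separation become the subtrees of a new root. The new bit is
  appended at the end of a node, so that the tail remains the parent.
\<close>
lemma decomposable_join: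
  assumes A: "decomposable k A WA" and B: "decomposable k B WB" and V: "V = A \<union> B"
    and WA: "A \<inter> B \<subseteq> WA" "W \<inter> A \<subseteq> WA" and WB: "A \<inter> B \<subseteq> WB" "W \<inter> B \<subseteq> WB"
    and W: "W \<subseteq> V" and c: "card (W \<union> (A \<inter> B)) \<le> k"
    and no: "\<And>a b. a \<in> A - B \<Longrightarrow> b \<in> B - A \<Longrightarrow> \<not> E a b"
  shows "decomposable k V W"
proof -
  obtain PA bA where A0: "rooted_dec k A WA PA bA" using A unfolding decomposable_def by blast
  have PA: "finite PA" "[] \<in> PA" "\<And>p. p \<in> PA \<Longrightarrow> tl p \<in> PA"
     "\<And>p. p \<in> PA \<Longrightarrow> bA p \<subseteq> A \<and> card (bA p) \<le> k" "WA \<subseteq> bA []"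
     and eA: "\<And>x y. x \<in> A \<Longrightarrow> y \<in> A \<Longrightarrow> E x y \<Longrightarrow> \<exists>p\<in>PA. x \<in> bA p \<and> y \<in> bA p"
     and tA: "\<And>v. v \<in> A \<Longrightarrow> \<exists>t\<in>PA. v \<in> bA t \<and> (\<forall>p\<in>PA. v \<in> bA p \<and> p \<noteq> t \<longrightarrow> p \<noteq> [] \<and> v \<in> bA (tl p))"
    using A0 unfolding rooted_dec_def by simp_all
  obtain PB bB where B0: "rooted_dec k B WB PB bB" using B unfolding decomposable_def by blast
  have PB: "finite PB" "[] \<in> PB" "\<And>p. p \<in> PB \<Longrightarrow> tl p \<in> PB"
     "\<And>p. p \<in> PB \<Longrightarrow> bB p \<subseteq> B \<and> card (bB p) \<le> k" "WB \<subseteq> bB []"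
     and eB: "\<And>x y. x \<in> B \<Longrightarrow> y \<in> B \<Longrightarrow> E x y \<Longrightarrow> \<exists>p\<in>PB. x \<in> bB p \<and> y \<in> bB p"
     and tB: "\<And>v. v \<in> B \<Longrightarrow> \<exists>t\<in>PB. v \<in> bB t \<and> (\<forall>p\<in>PB. v \<in> bB p \<and> p \<noteq> t \<longrightarrow> p \<noteq> [] \<and> v \<in> bB (tl p))"
    using B0 unfolding rooted_dec_def by simp_all
  define Pos where "Pos = insert [] ((\<lambda>p. p @ [True]) ` PA \<union> (\<lambda>p. p @ [False]) ` PB)"
  define bag where "bag q = (if q = [] then W \<union> (A \<inter> B) else if last q then bA (butlast q) else bB (butlast q))" for q
  have bag0: "bag [] = W \<union> (A \<inter> B)" and bagA: "bag (p @ [True]) = bA p" and bagB: "bag (p @ [False]) = bB p" for p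
    by (auto simp: bag_def)
  have PosE: "q = [] \<or> (\<exists>p\<in>PA. q = p @ [True]) \<or> (\<exists>p\<in>PB. q = p @ [False])" if "q \<in> Pos" for q
    using that by (auto simp: Pos_def)
  have AP: "p @ [True] \<in> Pos" if "p \<in> PA" for p using that by (auto simp: Pos_def)
  have BP: "p @ [False] \<in> Pos" if "p \<in> PB" for p using that by (auto simp: Pos_def)
  have finP: "finite Pos" "[] \<in> Pos" using PA PB by (auto simp: Pos_def)
  have tlP: "tl q \<in> Pos" if "q \<in> Pos" for q
  proof -
    have "tl (p @ [b]) = (if p = [] then [] else tl p @ [b])" for p and b :: bool by (cases p) auto
    then show ?thesis using PosE[OF that] AP[OF PA(3)] BP[OF PB(3)] finP by auto
  qed
  have bagV: "bag q \<subseteq> V \<and> card (bag q) \<le> k" if "q \<in> Pos" for q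
    using PosE[OF that]
  proof (elim disjE bexE)
    assume "q = []" then show ?thesis using W V c by (auto simp: bag0)
  next
    fix p assume "p \<in> PA" "q = p @ [True]" then show ?thesis using PA(4)[of p] V by (auto simp: bagA)
  next
    fix p assume "p \<in> PB" "q = p @ [False]" then show ?thesis using PB(4)[of p] V by (auto simp: bagB)
  qed
  have edge: "\<exists>q\<in>Pos. x \<in> bag q \<and> y \<in> bag q" if xy: "x \<in> V" "y \<in> V" "E x y" for x y
  proof -
    have "(x \<in> A \<and> y \<in> A) \<or> (x \<in> B \<and> y \<in> B)" using xy V no sym by blast
    then show ?thesis
    proof (elim disjE conjE)
      assume "x \<in> A" "y \<in> A"
      then obtain p where "p \<in> PA" "x \<in> bA p" "y \<in> bA p" using eA xy(3) by blast
      then show ?thesis using AP bagA by (intro bexI[of _ "p @ [True]"]) auto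
    next
      assume "x \<in> B" "y \<in> B"
      then obtain p where "p \<in> PB" "x \<in> bB p" "y \<in> bB p" using eB xy(3) by blast
      then show ?thesis using BP bagB by (intro bexI[of _ "p @ [False]"]) auto
    qed
  qed
  have top: "\<exists>t\<in>Pos. v \<in> bag t \<and> (\<forall>q\<in>Pos. v \<in> bag q \<and> q \<noteq> t \<longrightarrow> q \<noteq> [] \<and> v \<in> bag (tl q))" if v: "v \<in> V" for v
  proof (cases "v \<in> W \<union> (A \<inter> B)")
    case True
    have "q \<noteq> [] \<and> v \<in> bag (tl q)" if q: "q \<in> Pos" "v \<in> bag q" "q \<noteq> []" for q
    proof -
      from PosE[OF q(1)] q(3) consider p where "p \<in> PA" "q = p @ [True]" | p where "p \<in> PB" "q = p @ [False]" by blast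
      then show ?thesis
      proof cases
        case 1
        have vp: "v \<in> bA p" using q(2) 1 bagA by simp
        then have vA: "v \<in> A" using PA(4)[OF 1(1)] by blast
        then have v0: "v \<in> bA []" using True WA PA(5) by blast
        obtain t where t: "\<forall>p\<in>PA. v \<in> bA p \<and> p \<noteq> t \<longrightarrow> p \<noteq> [] \<and> v \<in> bA (tl p)" using tA[OF vA] by blast
        have "t = []" using t PA(2) v0 by blast
        then have "p \<noteq> [] \<Longrightarrow> v \<in> bA (tl p)" using t 1(1) vp by blast
        then show ?thesis using 1(2) True bagA bag0 by (cases p) auto
      next
        case 2
        have vp: "v \<in> bB p" using q(2) 2 bagB by simp
        then have vA: "v \<in> B" using PB(4)[OF 2(1)] by blast
        then have v0: "v \<in> bB []" using True WB PB(5) by blast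
        obtain t where t: "\<forall>p\<in>PB. v \<in> bB p \<and> p \<noteq> t \<longrightarrow> p \<noteq> [] \<and> v \<in> bB (tl p)" using tB[OF vA] by blast
        have "t = []" using t PB(2) v0 by blast
        then have "p \<noteq> [] \<Longrightarrow> v \<in> bB (tl p)" using t 2(1) vp by blast
        then show ?thesis using 2(2) True bagB bag0 by (cases p) auto
      qed
    qed
    then show ?thesis using True finP bag0 by (intro bexI[of _ "[]"]) auto
  next
    case False
    then consider "v \<in> A" "v \<notin> B" | "v \<in> B" "v \<notin> A" using v V by blast
    then show ?thesis
    proof cases
      case 1
      obtain t where t: "t \<in> PA" "v \<in> bA t" "\<forall>p\<in>PA. v \<in> bA p \<and> p \<noteq> t \<longrightarrow> p \<noteq> [] \<and> v \<in> bA (tl p)" using tA[OF 1(1)] by blast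
      have "q \<noteq> [] \<and> v \<in> bag (tl q)" if q: "q \<in> Pos" "v \<in> bag q" "q \<noteq> t @ [True]" for q
      proof -
        have "q \<noteq> []" using q False bag0 by auto
        moreover have "\<not> (\<exists>p\<in>PB. q = p @ [False])" using PB(4) 1 q bagB by auto
        ultimately obtain p where p: "p \<in> PA" "q = p @ [True]" using PosE[OF q(1)] by blast
        then have "p \<noteq> [] \<and> v \<in> bA (tl p)" using t(3) q bagA by auto
        then show ?thesis using p bagA by (cases p) auto
      qed
      then show ?thesis using t AP bagA by (intro bexI[of _ "t @ [True]"]) auto
    next
      case 2
      obtain t where t: "t \<in> PB" "v \<in> bB t" "\<forall>p\<in>PB. v \<in> bB p \<and> p \<noteq> t \<longrightarrow> p \<noteq> [] \<and> v \<in> bB (tl p)" using tB[OF 2(1)] by blast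
      have "q \<noteq> [] \<and> v \<in> bag (tl q)" if q: "q \<in> Pos" "v \<in> bag q" "q \<noteq> t @ [False]" for q
      proof -
        have "q \<noteq> []" using q False bag0 by auto
        moreover have "\<not> (\<exists>p\<in>PA. q = p @ [True])" using PA(4) 2 q bagA by auto
        ultimately obtain p where p: "p \<in> PB" "q = p @ [False]" using PosE[OF q(1)] by blast
        then have "p \<noteq> [] \<and> v \<in> bB (tl p)" using t(3) q bagB by auto
        then show ?thesis using p bagB by (cases p) auto
      qed
      then show ?thesis using t BP bagB by (intro bexI[of _ "t @ [False]"]) auto
    qed
  qed
  have WW: "W \<subseteq> bag []" by (simp add: bag0)
  have "rooted_dec k V W Pos bag" unfolding rooted_dec_def
    using finP tlP bagV WW edge top by (intro conjI ballI impI) simp_all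
  then show ?thesis unfolding decomposable_def by blast
qed

definition linked :: "nat \<Rightarrow> 'a set \<Rightarrow> 'a set \<Rightarrow> bool" where
  "linked K V W \<longleftrightarrow> (\<forall>A B. A \<union> B = V \<longrightarrow> (\<forall>a\<in>A - B. \<forall>b\<in>B - A. \<not> E a b) \<longrightarrow> card (A \<inter> B) \<le> K \<longrightarrow>
     card (W \<inter> (A - B)) < K \<or> card (W \<inter> (B - A)) < K)"

text \<open>
  The standard recursion that proves bounded tree-width: the set \<open>W\<close> to be contained in the root bag is enlarged to
  exactly \<open>n\<close> vertices and split by a separation. On each side at least \<open>K\<close> vertices of \<open>W\<close> are exchanged for at
  most \<open>K\<close> vertices of the separator, so that the recursion goes on with sets of size at most \<open>n\<close>.
\<close>
lemma linked_or_decomposable: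
  assumes "finite V" "1 \<le> K" "K \<le> n"
    and "\<And>V' W. V' \<subseteq> V \<Longrightarrow> W \<subseteq> V' \<Longrightarrow> card W = n \<Longrightarrow> \<not> linked K V' W"
    and "W \<subseteq> V" "card W \<le> n"
  shows "decomposable (n + K) V W"
  using assms(1,4-6)
proof (induction V arbitrary: W rule: finite_psubset_induct)
  case (psubset V)
  show ?case
  proof (cases "card V \<le> n")
    case True
    then show ?thesis using decomposable_leaf psubset.prems by simp
  next
    case False
    obtain W' where W': "W \<subseteq> W'" "W' \<subseteq> V" "card W' = n"
      using exists_subset_between[of W n V] psubset.prems psubset.hyps False by auto
    then obtain A B where AB: "A \<union> B = V" "\<forall>a\<in>A - B. \<forall>b\<in>B - A. \<not> E a b" "card (A \<inter> B) \<le> K"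
      "K \<le> card (W' \<inter> (A - B))" "K \<le> card (W' \<inter> (B - A))"
      using psubset.prems(1)[of V W'] unfolding linked_def by (auto simp: not_less)
    have finW': "finite W'" using W' psubset.hyps finite_subset by blast
    have half: "decomposable (n + K) X ((W' \<inter> X) \<union> (A \<inter> B))"
      if X: "X \<subset> V" "A \<inter> B \<subseteq> X" "W' \<inter> X \<subseteq> W' - D" "D \<subseteq> W'" "K \<le> card D" for X D
    proof (rule psubset.IH[OF X(1)])
      show "\<not> linked K V' W" if "V' \<subseteq> X" "W \<subseteq> V'" "card W = n" for V' W
        using psubset.prems(1)[of V' W] that X(1) by blast
      show "W' \<inter> X \<union> A \<inter> B \<subseteq> X" using X(2) by blast
      have "card (W' \<inter> X) \<le> card (W' - D)" by (rule card_mono) (use finW' X in auto)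
      also have "\<dots> = n - card D" using card_Diff_subset[OF _ X(4)] finite_subset[OF X(4) finW'] W'(3) by simp
      finally have "card (W' \<inter> X) \<le> n - K" using X(5) by linarith
      then show "card (W' \<inter> X \<union> A \<inter> B) \<le> n"
        using card_Un_le[of "W' \<inter> X" "A \<inter> B"] AB(3) assms(3) by linarith
    qed
    have ne: "W' \<inter> (A - B) \<noteq> {}" "W' \<inter> (B - A) \<noteq> {}"
      using AB(4,5) assms(2) by auto
    have hA: "decomposable (n + K) A ((W' \<inter> A) \<union> (A \<inter> B))"
      by (rule half[of A "W' \<inter> (B - A)"]) (use AB ne in auto)
    have hB: "decomposable (n + K) B ((W' \<inter> B) \<union> (A \<inter> B))"
      by (rule half[of B "W' \<inter> (A - B)"]) (use AB ne in auto)
    have "card (W' \<union> (A \<inter> B)) \<le> n + K" using card_Un_le[of W' "A \<inter> B"] AB(3) W'(3) by linarith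
    then have "decomposable (n + K) V W'"
      using AB W' by (intro decomposable_join[OF hA hB]) auto
    then show ?thesis using W'(1) decomposable_weaken by blast
  qed
qed

text \<open>
  A minimal union of components of \<open>V - Y\<close> with at least \<open>K\<close> vertices of \<open>W\<close> is connected: two
  smaller closed parts would have fewer than \<open>K\<close> vertices of \<open>W\<close> each, and fewer than \<open>K\<close> lie outside.
\<close>
lemma linked_tangled:
  assumes fin: "finite V" and WV: "W \<subseteq> V" and K: "1 \<le> K" "6 * K < card W" and L: "linked K V W"
  shows "tangled E V W K (2 * K)"
proof unfold_locales
  show "finite V" "W \<subseteq> V" "3 * (2 * K) < card W" using assms by auto
  have finW: "finite W" using fin WV finite_subset by blast
  fix Y assume Y: "Y \<subseteq> V" "card Y \<le> K"
  have finY: "finite Y" using fin Y finite_subset by blast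
  let ?cl = "\<lambda>U. U \<subseteq> V - Y \<and> (\<forall>x\<in>U. \<forall>y\<in>V - Y. E x y \<longrightarrow> y \<in> U)"
  have small: "card (W \<inter> U) < K \<or> card (W - Y - U) < K" if U: "?cl U" for U
  proof -
    have 1: "(U \<union> Y) \<union> (V - U) = V" using U Y by blast
    have 2: "(U \<union> Y) \<inter> (V - U) = Y" using U Y by blast
    have 3: "(U \<union> Y) - (V - U) = U" "(V - U) - (U \<union> Y) = V - Y - U" using U Y by auto
    have "card (W \<inter> ((U \<union> Y) - (V - U))) < K \<or> card (W \<inter> ((V - U) - (U \<union> Y))) < K"
      using L[unfolded linked_def, rule_format, OF 1] U Y unfolding 2 3 by blast
    moreover have "W \<inter> (V - Y - U) = W - Y - U" using WV by blast
    ultimately show ?thesis unfolding 3 by simp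
  qed
  have cWY: "card W \<le> card (W - Y) + K" using diff_card_le_card_Diff[OF finY, of W] Y(2) by linarith
  have big: "card (W - Y) \<le> card (W \<inter> U) + card (W - Y - U)" for U
  proof -
    have "card (W - Y) \<le> card ((W \<inter> U) \<union> (W - Y - U))" by (rule card_mono) (use finW in auto)
    then show ?thesis using card_Un_le[of "W \<inter> U" "W - Y - U"] by linarith
  qed
  have "?cl (V - Y) \<and> K \<le> card (W \<inter> (V - Y))"
  proof -
    have "W \<inter> (V - Y) = W - Y" using WV by blast
    then show ?thesis using cWY K by auto
  qed
  then obtain U where U0: "?cl U \<and> K \<le> card (W \<inter> U)"
    and min0: "\<forall>U'. ?cl U' \<and> K \<le> card (W \<inter> U') \<longrightarrow> card U \<le> card U'"
    by (rule exE[OF ex_has_least_nat[of "\<lambda>U. ?cl U \<and> K \<le> card (W \<inter> U)" "V - Y" card]], elim conjE) (rule that, simp_all)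
  have U: "?cl U" "K \<le> card (W \<inter> U)" using U0 by simp_all
  have min: "card U \<le> card U'" if "?cl U'" "K \<le> card (W \<inter> U')" for U' using min0 that by simp
  have finU: "finite U" using U fin finite_subset by blast
  have rest: "card (W - Y - U) < K" using small[OF U(1)] U(2) by linarith
  have "conn U"
  proof (cases "U = {}")
    case True then show ?thesis by (simp add: conn_def)
  next
    case False
    show ?thesis unfolding conn_def
    proof (intro ballI)
      fix x y assume xy: "x \<in> U" "y \<in> U"
      define R where "R = {y. \<exists>xs. walk xs \<and> hd xs = x \<and> last xs = y \<and> set xs \<subseteq> U}"
      have xR: "x \<in> R" unfolding R_def using xy by (auto intro!: exI[of _ "[x]"] simp: walk_def)
      have RU: "R \<subseteq> U" unfolding R_def walk_def by auto
      have step: "z' \<in> R" if z: "z \<in> R" "z' \<in> U" "E z z'" for z z'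
      proof -
        obtain xs where xs: "walk xs" "hd xs = x" "last xs = z" "set xs \<subseteq> U" using z(1) unfolding R_def by blast
        have "walk (xs @ [z'])" using walk_snoc xs z by simp
        moreover have "hd (xs @ [z']) = x" using xs by (auto simp: walk_def)
        ultimately show ?thesis unfolding R_def using xs z by (intro CollectI exI[of _ "xs @ [z']"]) auto
      qed
      have clR: "?cl R" using U(1) RU step by blast
      have clS: "?cl (U - R)" using U(1) RU step sym by blast
      have "U - R = {}"
      proof (rule ccontr)
        assume ne: "U - R \<noteq> {}"
        have 1: "card R < card U" "card (U - R) < card U"
          using ne xR RU finU xy by (auto intro!: psubset_card_mono)
        then have "card (W \<inter> R) < K" "card (W \<inter> (U - R)) < K"
          using min[OF clR] min[OF clS] by linarith+
        moreover have "W \<inter> U = (W \<inter> R) \<union> (W \<inter> (U - R))" using RU by blast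
        ultimately have "card (W \<inter> U) < 2 * K" using card_Un_le[of "W \<inter> R" "W \<inter> (U - R)"] by simp
        then show False using big[of U] rest cWY K by linarith
      qed
      then have "y \<in> R" using xy by blast
      then show "\<exists>xs. walk xs \<and> hd xs = x \<and> last xs = y \<and> set xs \<subseteq> U" unfolding R_def by blast
    qed
  qed
  moreover have "card (W - U) \<le> 2 * K"
  proof -
    have "card (W - U) \<le> card ((W - Y - U) \<union> Y)" by (rule card_mono) (use finW finY in auto)
    then show ?thesis using card_Un_le[of "W - Y - U" Y] rest Y(2) by linarith
  qed
  ultimately show "\<exists>C\<subseteq>V - Y. conn C \<and> (\<forall>x\<in>C. \<forall>y\<in>V - Y. E x y \<longrightarrow> y \<in> C) \<and> card (W - C) \<le> 2 * K"
    using U(1) by blast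
qed

end

section \<open>Trees of bit lists\<close>

definition path_tree :: "bool list set \<Rightarrow> nat pair_pre_digraph" where
  "path_tree Pos = \<lparr> pverts = to_nat ` Pos,
     parcs = {(to_nat p, to_nat (tl p)) | p. p \<in> Pos \<and> p \<noteq> []} \<union> {(to_nat (tl p), to_nat p) | p. p \<in> Pos \<and> p \<noteq> []} \<rparr>"

lemma pcas_chain:
  "pcas u p v \<Longrightarrow> p \<noteq> [] \<Longrightarrow> fst (hd p) = u \<and> snd (last p) = v \<and> (\<forall>i. Suc i < length p \<longrightarrow> fst (p ! Suc i) = snd (p ! i))"
proof (induction p arbitrary: u)
  case (Cons e es)
  show ?case
  proof (cases es)
    case Nil then show ?thesis using Cons.prems by auto
  next
    case (Cons e' es')
    then have *: "fst e' = snd e" "snd (last es) = v" "\<forall>i. Suc i < length es \<longrightarrow> fst (es ! Suc i) = snd (es ! i)"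
      using Cons.IH[of "snd e"] Cons.prems by auto
    have "fst ((e # es) ! Suc i) = snd ((e # es) ! i)" if "Suc i < length (e # es)" for i
      using that * Cons by (cases i) auto
    then show ?thesis using * Cons Cons.prems by auto
  qed
qed simp

lemma pawalk_verts_pcas: "pcas u p v \<Longrightarrow> pawalk_verts u p = u # map snd p"
  by (induction p arbitrary: u) auto

lemma path_tree_connected:
  assumes S: "S \<subseteq> Pos" "t \<in> S" and top: "\<And>p. p \<in> S \<Longrightarrow> p \<noteq> t \<Longrightarrow> p \<noteq> [] \<and> tl p \<in> S"
  shows "connected (with_proj (path_tree Pos) \<restriction> (to_nat ` S))"
proof -
  let ?G = "with_proj (path_tree Pos) \<restriction> (to_nat ` S)"
  let ?r = "parcs (mk_symmetric ?G)"
  have step: "(to_nat p, to_nat (tl p)) \<in> ?r" if "p \<in> S" "p \<noteq> t" for p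
    using that top[OF that] S(1) unfolding mk_symmetric_def path_tree_def by force
  have "sym ?r" by (auto simp: mk_symmetric_def sym_def)
  then have sy: "sym (rtrancl_on (to_nat ` S) ?r)" by (rule rtrancl_on_sym)
  have reach: "(to_nat p, to_nat t) \<in> rtrancl_on (to_nat ` S) ?r" if "p \<in> S" for p
    using that
  proof (induction "length p" arbitrary: p rule: less_induct)
    case less
    show ?case
    proof (cases "p = t")
      case True then show ?thesis using less.prems by simp
    next
      case False
      then have tp: "tl p \<in> S" "p \<noteq> []" using top less.prems by auto
      have "(to_nat (tl p), to_nat t) \<in> rtrancl_on (to_nat ` S) ?r" using less.hyps[of "tl p"] tp by simp
      then show ?thesis using converse_rtrancl_on_into_rtrancl_on[OF step[OF less.prems False]] less.prems by blast
    qed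
  qed
  show ?thesis unfolding connected_def
  proof (rule strongly_connectedI)
    have vs: "verts (with_proj (mk_symmetric ?G)) = to_nat ` S" by (simp add: mk_symmetric_def)
    show "verts (with_proj (mk_symmetric ?G)) \<noteq> {}" unfolding vs using S(2) by blast
    fix u v assume "u \<in> verts (with_proj (mk_symmetric ?G))" "v \<in> verts (with_proj (mk_symmetric ?G))"
    then obtain p q where pq: "u = to_nat p" "p \<in> S" "v = to_nat q" "q \<in> S" unfolding vs by blast
    have "(to_nat t, to_nat q) \<in> rtrancl_on (to_nat ` S) ?r" using reach[OF pq(4)] sy by (simp add: sym_def)
    then have "(u, v) \<in> rtrancl_on (to_nat ` S) ?r" using rtrancl_on_trans[OF reach[OF pq(2)]] pq by simp
    then show "u \<rightarrow>\<^sup>*\<^bsub>with_proj (mk_symmetric ?G)\<^esub> v" unfolding reachable_def vs by simp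
  qed
qed

text \<open>
  In a cycle of length at least three, a vertex of maximal depth has two different neighbours, and both
  would have to be its parent.
\<close>
lemma undirected_tree_path_tree:
  assumes fin: "finite Pos" and root: "[] \<in> Pos" and tlP: "\<And>p. p \<in> Pos \<Longrightarrow> tl p \<in> Pos"
  shows "undirected_tree (path_tree Pos)"
  unfolding undirected_tree_def
proof (intro conjI)
  let ?T = "path_tree Pos"
  have tlne: "tl p \<noteq> p" if "p \<noteq> []" for p :: "bool list" using that by (cases p) auto
  have sub: "parcs ?T \<subseteq> pverts ?T \<times> pverts ?T" using tlP by (auto simp: path_tree_def)
  have finv: "finite (pverts ?T)" using fin by (simp add: path_tree_def)
  show pg: "pair_graph ?T"
  proof unfold_locales
    show "finite (pverts ?T)" "finite (parcs ?T)" using finv finite_subset[OF sub] by auto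
    show "symmetric (with_proj ?T)" unfolding symmetric_def by (auto simp: path_tree_def sym_def)
    fix e assume "e \<in> parcs ?T"
    then show "fst e \<in> pverts ?T" "snd e \<in> pverts ?T" using sub by auto
    from \<open>e \<in> parcs ?T\<close> show "fst e \<noteq> snd e" using tlne by (auto simp: path_tree_def) metis+
  qed
  have eq: "with_proj ?T \<restriction> (to_nat ` Pos) = with_proj ?T"
    using sub by (auto simp: induce_subgraph_def with_proj_def path_tree_def)
  have "connected (with_proj ?T \<restriction> (to_nat ` Pos))"
    by (rule path_tree_connected[of Pos Pos "[]"]) (use root tlP in auto)
  then show "connected (with_proj ?T)" unfolding eq .
  show "\<not> (\<exists>p. pre_digraph.cycle (with_proj ?T) p \<and> 3 \<le> length p)"
  proof
    assume "\<exists>p. pre_digraph.cycle (with_proj ?T) p \<and> 3 \<le> length p"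
    then obtain p u where p: "pre_digraph.awalk (with_proj ?T) u p u" "distinct (tl (pawalk_verts u p))" "3 \<le> length p"
      unfolding pre_digraph.cycle_def awalk_verts_with_proj_eq by blast
    have arcs: "set p \<subseteq> parcs ?T" and cas: "pcas u p u"
      using p(1) unfolding pre_digraph.awalk_def by (auto simp: cas_with_proj_eq)
    let ?l = "length p"
    have ne: "p \<noteq> []" using p(3) by auto
    define s where "s i = snd (p ! i)" for i
    have dist: "s i \<noteq> s j" if "i < ?l" "j < ?l" "i \<noteq> j" for i j
      using p(2) that unfolding pawalk_verts_pcas[OF cas] list.sel s_def by (metis length_map nth_eq_iff_index_eq nth_map)
    have ch: "fst (hd p) = u" "snd (last p) = u" "\<And>i. Suc i < ?l \<Longrightarrow> fst (p ! Suc i) = s i"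
      using pcas_chain[OF cas ne] by (auto simp: s_def)
    have edge: "(s i, s (Suc i mod ?l)) \<in> parcs ?T" if "i < ?l" for i
    proof (cases "Suc i < ?l")
      case True
      then have "p ! Suc i = (s i, s (Suc i))" using ch(3)[OF True] by (simp add: s_def prod_eq_iff)
      then show ?thesis using True arcs nth_mem[OF True] by (metis mod_less subsetD)
    next
      case False
      then have i: "Suc i = ?l" using that by simp
      then have "i = ?l - 1" by simp
      then have "s i = u" using ch(2) ne by (simp add: s_def last_conv_nth)
      then have "p ! 0 = (s i, s 0)" using ch(1) ne by (simp add: s_def hd_conv_nth prod_eq_iff)
      then show ?thesis using i arcs nth_mem[of 0 p] ne by (metis length_greater_0_conv mod_self subsetD)
    qed
    \<comment> \<open>The depth of the \<open>i\<close>-th vertex of the cycle.\<close>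
    define d where "d i = length (from_nat (s i) :: bool list)" for i
    have par: "from_nat y = tl (from_nat x :: bool list)" if e: "(x, y) \<in> parcs ?T \<or> (y, x) \<in> parcs ?T"
        and d: "length (from_nat y :: bool list) \<le> length (from_nat x :: bool list)" for x y
    proof -
      have less: "length (tl q) < length q" if "q \<noteq> []" for q :: "bool list" using that by simp
      consider q :: "bool list" where "q \<noteq> []" "x = to_nat q" "y = to_nat (tl q)" | q :: "bool list" where "q \<noteq> []" "x = to_nat (tl q)" "y = to_nat q"
        using e by (auto simp: path_tree_def)
      then show ?thesis
      proof cases
        case 1 then show ?thesis by simp
      next
        case 2 then show ?thesis using d less[OF 2(1)] unfolding 2(2,3) from_nat_to_nat by linarith
      qed
    qed
    have "finite (d ` {..<?l})" "d ` {..<?l} \<noteq> {}" using ne by auto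
    then obtain i where i: "i < ?l" "\<And>j. j < ?l \<Longrightarrow> d j \<le> d i"
      using Max_in[of "d ` {..<?l}"] Max_ge[of "d ` {..<?l}"] by (metis (no_types, lifting) imageE imageI lessThan_iff)
    define b where "b = Suc i mod ?l"
    define a where "a = (i + ?l - 1) mod ?l"
    have ab: "a < ?l" "b < ?l" using ne by (auto simp: a_def b_def)
    have ai: "Suc a mod ?l = i"
    proof (cases i)
      case 0
      have "a = ?l - 1" using 0 p(3) by (simp add: a_def)
      then have "Suc a = ?l" using p(3) by simp
      then show ?thesis using 0 by simp
    next
      case (Suc k) then show ?thesis using i(1) by (simp add: a_def mod_Suc)
    qed
    have "a \<noteq> b"
    proof
      assume "a = b"
      have "i = Suc (Suc i mod ?l) mod ?l" using ai unfolding \<open>a = b\<close> b_def by simp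
      then have "i = (i + 2) mod ?l" by (simp add: mod_Suc_eq)
      then show False using i(1) p(3) by (cases "i + 2 < ?l") (auto simp: mod_if split: if_splits)
    qed
    have "from_nat (s b) = tl (from_nat (s i) :: bool list)"
      by (rule par) (use edge[OF i(1)] i(2)[OF ab(2)] in \<open>auto simp: b_def d_def\<close>)
    moreover have "from_nat (s a) = tl (from_nat (s i) :: bool list)"
      by (rule par) (use edge[OF ab(1)] i(2)[OF ab(1)] ai in \<open>auto simp: d_def\<close>)
    ultimately have eqn: "(from_nat (s a) :: bool list) = from_nat (s b)" by simp
    have "s a \<in> to_nat ` Pos" "s b \<in> to_nat ` Pos"
      using edge[OF ab(1)] edge[OF ab(2)] sub by (auto simp: path_tree_def)
    then have "s a = s b" using eqn by auto
    then show False using dist[OF ab \<open>a \<noteq> b\<close>] by simp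
  qed
qed

lemma (in sgraph) tree_width_decomposable:
  assumes G: "\<And>x y. (x, y) \<in> parcs G \<Longrightarrow> x \<in> pverts G \<and> y \<in> pverts G \<and> E x y" and dec: "decomposable k (pverts G) W"
  shows "tree_width G \<le> k"
proof -
  obtain Pos bag where D: "rooted_dec k (pverts G) W Pos bag" using dec unfolding decomposable_def by blast
  have fin: "finite Pos" "[] \<in> Pos" and tlP: "\<And>p. p \<in> Pos \<Longrightarrow> tl p \<in> Pos"
    and bags: "\<And>p. p \<in> Pos \<Longrightarrow> bag p \<subseteq> pverts G \<and> card (bag p) \<le> k"
    and edges: "\<And>x y. x \<in> pverts G \<Longrightarrow> y \<in> pverts G \<Longrightarrow> E x y \<Longrightarrow> \<exists>p\<in>Pos. x \<in> bag p \<and> y \<in> bag p"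
    and top: "\<And>v. v \<in> pverts G \<Longrightarrow> \<exists>t\<in>Pos. v \<in> bag t \<and> (\<forall>p\<in>Pos. v \<in> bag p \<and> p \<noteq> t \<longrightarrow> p \<noteq> [] \<and> v \<in> bag (tl p))"
    using D unfolding rooted_dec_def by simp_all
  let ?T = "path_tree Pos" and ?B = "\<lambda>t. bag (from_nat t)"
  have pv: "pverts ?T = to_nat ` Pos" by (simp add: path_tree_def)
  have "tree_decomposition G ?T ?B"
    unfolding tree_decomposition_def
  proof (intro conjI ballI)
    show "undirected_tree ?T" by (rule undirected_tree_path_tree[OF fin tlP])
    show "(\<Union>t\<in>pverts ?T. ?B t) = pverts G" unfolding pv using bags top by fastforce
  next
    fix e assume "e \<in> parcs G"
    then show "case e of (u, v) \<Rightarrow> \<exists>t\<in>pverts ?T. u \<in> ?B t \<and> v \<in> ?B t"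
      unfolding pv using edges G by (cases e) fastforce
  next
    fix v assume "v \<in> pverts G"
    then obtain t where t: "t \<in> Pos" "v \<in> bag t" "\<forall>p\<in>Pos. v \<in> bag p \<and> p \<noteq> t \<longrightarrow> p \<noteq> [] \<and> v \<in> bag (tl p)"
      using top by blast
    have eq: "{t \<in> pverts ?T. v \<in> ?B t} = to_nat ` {p \<in> Pos. v \<in> bag p}" unfolding pv by auto
    show "connected (with_proj ?T \<restriction> {t \<in> pverts ?T. v \<in> ?B t})"
      unfolding eq by (rule path_tree_connected[of _ _ t]) (use t tlP in auto)
  qed
  moreover have "decomposition_width ?T ?B \<le> k"
  proof -
    have "Max ((\<lambda>t. card (?B t)) ` pverts ?T) \<le> k"
      unfolding pv using fin bags by (subst Max_le_iff) auto
    then show ?thesis by (simp add: decomposition_width_def)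
  qed
  moreover have "tree_width G \<le> decomposition_width ?T ?B"
    unfolding tree_width_def by (rule Least_le) (use calculation(1) in blast)
  ultimately show ?thesis by linarith
qed

section \<open>Induced subgraphs and minimal forbidden subgraphs\<close>

definition induced :: "'a pair_pre_digraph \<Rightarrow> 'a set \<Rightarrow> 'a pair_pre_digraph" where
  "induced G S = \<lparr> pverts = S, parcs = {(u, v) \<in> parcs G. u \<in> S \<and> v \<in> S} \<rparr>"

lemma pair_graph_iff:
  "pair_graph G \<longleftrightarrow> finite (pverts G) \<and> parcs G \<subseteq> pverts G \<times> pverts G \<and> sym (parcs G) \<and> (\<forall>x. (x, x) \<notin> parcs G)"
proof
  assume "pair_graph G"
  then interpret pair_graph G .
  show "finite (pverts G) \<and> parcs G \<subseteq> pverts G \<times> pverts G \<and> sym (parcs G) \<and> (\<forall>x. (x, x) \<notin> parcs G)"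
  proof (intro conjI allI)
    fix x show "(x, x) \<notin> parcs G" using no_loops'[of x x] by blast
  qed (use in_arcsD1 in_arcsD2 arcs_symmetric in \<open>auto simp: sym_def\<close>)
next
  assume a: "finite (pverts G) \<and> parcs G \<subseteq> pverts G \<times> pverts G \<and> sym (parcs G) \<and> (\<forall>x. (x, x) \<notin> parcs G)"
  then have "finite (parcs G)" using finite_subset by blast
  then show "pair_graph G" using a
    by unfold_locales (auto simp: symmetric_def)
qed

lemma pair_graph_induced: "pair_graph G \<Longrightarrow> S \<subseteq> pverts G \<Longrightarrow> pair_graph (induced G S)"
  unfolding pair_graph_iff by (auto simp: induced_def sym_def intro: finite_subset)

lemma induced_subgraph_induced: "pair_graph G \<Longrightarrow> S \<subseteq> pverts G \<Longrightarrow> induced_subgraph (with_proj (induced G S)) (with_proj G)"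
proof -
  assume G: "pair_graph G" and S: "S \<subseteq> pverts G"
  interpret G: pair_graph G by fact
  interpret I: pair_graph "induced G S" by (rule pair_graph_induced[OF G S])
  show ?thesis
    unfolding induced_subgraph_def subgraph_def
    using S G.wf_digraph_axioms I.wf_digraph_axioms by (auto simp: induced_def compatible_def)
qed

lemma induced_subgraphD: 
  assumes "induced_subgraph (with_proj H) (with_proj G)"
  shows "H = induced G (pverts H)" "pverts H \<subseteq> pverts G"
proof -
  have a: "pverts H \<subseteq> pverts G" "parcs H = {e \<in> parcs G. fst e \<in> pverts H \<and> snd e \<in> pverts H}"
    using assms unfolding induced_subgraph_def subgraph_def by auto
  show "pverts H \<subseteq> pverts G" by (rule a(1))
  have "parcs H = {(u, v) \<in> parcs G. u \<in> pverts H \<and> v \<in> pverts H}" unfolding a(2) by auto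
  then show "H = induced G (pverts H)" unfolding induced_def by (cases H) simp
qed

text \<open>
  For graphs whose arcs are pairs, a bijection of the vertices that preserves arcs determines the maps on
  arcs and ends that an isomorphism of digraphs consists of.
\<close>
lemma graph_isoI:
  assumes "pair_graph G" "pair_graph H" "inj_on f (pverts G)" "pverts H = f ` pverts G"
    and "parcs H = map_prod f f ` parcs G"
  shows "graph_iso G H"
proof -
  interpret G: pair_graph G by fact
  let ?h = "\<lparr> iso_verts = f, iso_arcs = map_prod f f, iso_head = snd, iso_tail = fst \<rparr>"
  have "parcs G \<subseteq> pverts G \<times> pverts G" using assms(1) by (simp add: pair_graph_iff)
  then have "inj_on (map_prod f f) (parcs G)"
    by (rule inj_on_subset[OF map_prod_inj_on[OF assms(3,3)]])
  then have "pre_digraph.digraph_isomorphism (with_proj G) ?h"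
    unfolding pre_digraph.digraph_isomorphism_def using G.wf_digraph_axioms assms(3) by auto
  moreover have "with_proj H = app_iso ?h (with_proj G)"
    using assms(4,5) by (simp add: app_iso_def with_proj_def)
  ultimately show ?thesis using assms(1,2) unfolding graph_iso_def digraph_iso_def by blast
qed

lemma graph_iso_card: "graph_iso G H \<Longrightarrow> card (pverts G) = card (pverts H)"
proof -
  assume "graph_iso G H"
  then obtain h where "pre_digraph.digraph_isomorphism (with_proj G) h" "with_proj H = app_iso h (with_proj G)"
    unfolding graph_iso_def digraph_iso_def by blast
  then have "inj_on (iso_verts h) (pverts G)" "pverts H = iso_verts h ` pverts G"
    unfolding pre_digraph.digraph_isomorphism_def by (auto simp: app_iso_def with_proj_def)
  then show ?thesis by (simp add: card_image)
qed

definition embeds :: "('a \<Rightarrow> 'b) \<Rightarrow> 'a pair_pre_digraph \<Rightarrow> 'a set \<Rightarrow> 'b pair_pre_digraph \<Rightarrow> bool" where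
  "embeds f H F G \<longleftrightarrow> inj_on f F \<and> f ` F \<subseteq> pverts G \<and>
     (\<forall>u\<in>F. \<forall>v\<in>F. (u, v) \<in> parcs H \<longleftrightarrow> (f u, f v) \<in> parcs G)"

lemma hereditary_embeds:
  assumes C: "hereditary C" "G \<in> C" and H: "pair_graph H" and f: "embeds f H (pverts H) G"
  shows "(H :: nat pair_pre_digraph) \<in> C"
proof -
  have G: "pair_graph G" using C unfolding hereditary_def graph_class_def by blast
  let ?S = "f ` pverts H"
  have S: "?S \<subseteq> pverts G" and inj: "inj_on f (pverts H)" using f by (auto simp: embeds_def)
  have IC: "induced G ?S \<in> C"
    using C induced_subgraph_induced[OF G S] unfolding hereditary_def by blast
  let ?g = "inv_into (pverts H) f"
  have Hs: "parcs H \<subseteq> pverts H \<times> pverts H" using H by (simp add: pair_graph_iff)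
  have "graph_iso (induced G ?S) H"
  proof (rule graph_isoI[of _ _ ?g])
    show "pair_graph (induced G ?S)" "pair_graph H" using pair_graph_induced[OF G S] H by auto
    show "inj_on ?g (pverts (induced G ?S))" by (simp add: induced_def inj_on_inv_into)
    show "pverts H = ?g ` pverts (induced G ?S)" using inj by (auto simp: induced_def image_image)
    have "parcs (induced G ?S) = map_prod f f ` parcs H"
    proof
      show "parcs (induced G ?S) \<subseteq> map_prod f f ` parcs H"
        using f unfolding induced_def embeds_def by force
      show "map_prod f f ` parcs H \<subseteq> parcs (induced G ?S)"
        using f Hs unfolding induced_def embeds_def by auto
    qed
    moreover have "map_prod ?g ?g (map_prod f f e) = e" if "e \<in> parcs H" for e
      using that Hs inj by (cases e) auto
    ultimately show "parcs H = map_prod ?g ?g ` parcs (induced G ?S)" by (simp add: image_image)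
  qed
  then show ?thesis using IC C unfolding hereditary_def graph_class_def by blast
qed

lemma minimal_forbidden_induced:
  assumes C: "hereditary C" and G: "pair_graph G" "G \<notin> C"
  shows "\<exists>S\<subseteq>pverts G. induced G S \<in> minimal_forbidden C"
proof -
  have "induced G (pverts G) = G" using G(1) unfolding pair_graph_iff induced_def by (cases G) auto
  then have ex: "pverts G \<subseteq> pverts G \<and> induced G (pverts G) \<notin> C" using G by simp
  obtain S where S: "S \<subseteq> pverts G \<and> induced G S \<notin> C"
    and min: "\<forall>S'. S' \<subseteq> pverts G \<and> induced G S' \<notin> C \<longrightarrow> card S \<le> card S'"
    using ex_has_least_nat[of "\<lambda>S. S \<subseteq> pverts G \<and> induced G S \<notin> C", OF ex, of card] by auto
  have finS: "finite S" using S G(1) finite_subset by (auto simp: pair_graph_iff)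
  have "H \<in> C" if H: "induced_subgraph (with_proj H) (with_proj (induced G S))" "H \<noteq> induced G S" for H
  proof (rule ccontr)
    assume "H \<notin> C"
    have 1: "pverts H \<subseteq> S" using induced_subgraphD(2)[OF H(1)] by (simp add: induced_def)
    then have "induced (induced G S) (pverts H) = induced G (pverts H)" by (auto simp: induced_def)
    then have 2: "H = induced G (pverts H)" using induced_subgraphD(1)[OF H(1)] by simp
    have "pverts H \<subseteq> pverts G" using 1 S by blast
    moreover have "induced G (pverts H) \<notin> C" using \<open>H \<notin> C\<close> 2 by simp
    ultimately have le: "card S \<le> card (pverts H)" using min by blast
    have "pverts H = S" by (rule card_subset_eq[OF finS 1 le_antisym[OF card_mono[OF finS 1] le]])
    then show False using 2 H(2) by simp
  qed
  then have "induced G S \<in> minimal_forbidden C"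
    unfolding minimal_forbidden_def using S pair_graph_induced[OF G(1)] by blast
  then show ?thesis using S by blast
qed

lemma image_eq_singleton: "a \<in> A \<Longrightarrow> (\<And>x. x \<in> A \<Longrightarrow> f x = c) \<Longrightarrow> f ` A = {c}"
  by auto

lemma bounded_minimal_forbidden:
  assumes "\<not> infinitely_defined C"
  shows "\<exists>n. \<forall>F\<in>minimal_forbidden C. card (pverts F) \<le> n"
proof -
  let ?R = "{(G, H). graph_iso G H} :: (nat pair_pre_digraph \<times> nat pair_pre_digraph) set"
  let ?Q = "minimal_forbidden C // ?R"
  have fin: "finite ?Q" using assms by (simp add: infinitely_defined_def)
  let ?f = "\<lambda>X. Max ((\<lambda>F :: nat pair_pre_digraph. card (pverts F)) ` X)"
  have "card (pverts F) = ?f (?R `` {F})" if F: "F \<in> minimal_forbidden C" for F :: "nat pair_pre_digraph"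
  proof -
    have pg: "pair_graph F" using F by (simp add: minimal_forbidden_def)
    have "graph_iso F F" by (rule graph_isoI[of _ _ id]) (use pg in \<open>simp_all add: map_prod.id\<close>)
    then have "F \<in> ?R `` {F}" by simp
    moreover have "card (pverts H) = card (pverts F)" if "H \<in> ?R `` {F}" for H
      using graph_iso_card[of F H] that by simp
    ultimately have "(\<lambda>F. card (pverts F)) ` (?R `` {F}) = {card (pverts F)}"
      by (rule image_eq_singleton)
    then show ?thesis by simp
  qed
  moreover have "?R `` {F} \<in> ?Q" if "F \<in> minimal_forbidden C" for F using that by (rule quotientI)
  ultimately have "card (pverts F) \<le> Max (?f ` ?Q)" if "F \<in> minimal_forbidden C" for F
    using that fin by (simp add: Max_ge)
  then show ?thesis by blast
qed

text \<open>
  If no copy of \<open>H\<close> belongs to the class, then \<open>H\<close> contains a minimal forbidden induced subgraph, whose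
  size is at most \<open>n\<close>. This is where finite definedness enters.
\<close>
lemma small_nonembedding:
  assumes C: "hereditary C" and n: "\<forall>F\<in>minimal_forbidden C. card (pverts F) \<le> n"
    and H: "pair_graph H" and HC: "\<And>N :: nat pair_pre_digraph. graph_iso H N \<Longrightarrow> N \<notin> C"
  shows "\<exists>F\<subseteq>pverts H. card F \<le> n \<and> (\<forall>G\<in>C. \<forall>f. \<not> embeds f H F G)"
proof -
  have finH: "finite (pverts H)" and Hs: "parcs H \<subseteq> pverts H \<times> pverts H" using H by (auto simp: pair_graph_iff)
  obtain g :: "'a \<Rightarrow> nat" where g: "inj_on g (pverts H)" using finite_imp_inj_to_nat_seg[OF finH] by blast
  define N where "N = \<lparr> pverts = g ` pverts H, parcs = map_prod g g ` parcs H \<rparr>"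
  have edge: "(g u, g v) \<in> parcs N \<longleftrightarrow> (u, v) \<in> parcs H" if "u \<in> pverts H" "v \<in> pverts H" for u v
  proof
    assume "(g u, g v) \<in> parcs N"
    then obtain a b where ab: "(a, b) \<in> parcs H" "g u = g a" "g v = g b" unfolding N_def by auto
    then have "u = a" "v = b" using that Hs inj_onD[OF g] by blast+
    then show "(u, v) \<in> parcs H" using ab by simp
  qed (force simp: N_def)
  have pN: "pair_graph N"
    unfolding pair_graph_iff
  proof (intro conjI allI)
    show "finite (pverts N)" using finH by (simp add: N_def)
    show "parcs N \<subseteq> pverts N \<times> pverts N" using Hs by (auto simp: N_def)
    show "sym (parcs N)" using H unfolding pair_graph_iff by (auto simp: N_def sym_def)
    fix x show "(x, x) \<notin> parcs N"
    proof
      assume "(x, x) \<in> parcs N"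
      then obtain u v where "(u, v) \<in> parcs H" "x = g u" "x = g v" by (auto simp: N_def)
      then show False using g Hs H by (auto simp: inj_on_def pair_graph_iff)
    qed
  qed
  have "graph_iso H N" by (rule graph_isoI[OF H pN g]) (auto simp: N_def)
  then have "N \<notin> C" by (rule HC)
  then obtain S where S: "S \<subseteq> pverts N" "induced N S \<in> minimal_forbidden C"
    using minimal_forbidden_induced[OF C pN] by blast
  have cS: "card S \<le> n" using n S(2) by (force simp: induced_def)
  define F where "F = {v \<in> pverts H. g v \<in> S}"
  have gF: "g ` F = S" using S(1) by (auto simp: F_def N_def)
  have gi: "inj_on g F" by (rule inj_on_subset[OF g]) (auto simp: F_def)
  have "card F \<le> n" using card_image[OF gi] gF cS by simp
  moreover have "\<not> embeds f H F G" if G: "G \<in> C" for G f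
  proof
    assume f: "embeds f H F G"
    let ?h = "f \<circ> inv_into F g"
    have inv: "inv_into F g (g v) = v" if "v \<in> F" for v using gi that by simp
    have "embeds ?h (induced N S) (pverts (induced N S)) G"
      unfolding embeds_def
    proof (intro conjI ballI)
      have "inj_on (inv_into F g) S" using gF inj_on_inv_into[of S g F] by simp
      moreover have "inv_into F g ` S = F" using gF inv by force
      ultimately show "inj_on ?h (pverts (induced N S))" using f by (auto simp: induced_def embeds_def intro: comp_inj_on)
      show "?h ` pverts (induced N S) \<subseteq> pverts G"
        using f inv gF[symmetric] by (auto simp: induced_def embeds_def)
    next
      fix x y assume "x \<in> pverts (induced N S)" "y \<in> pverts (induced N S)"
      then obtain u v where uv: "x = g u" "y = g v" "u \<in> F" "v \<in> F" using gF by (auto simp: induced_def)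
      have "(x, y) \<in> parcs (induced N S) \<longleftrightarrow> (u, v) \<in> parcs H"
        using edge[of u v] uv gF by (auto simp: induced_def F_def)
      also have "\<dots> \<longleftrightarrow> (?h x, ?h y) \<in> parcs G" using f uv inv by (simp add: embeds_def)
      finally show "(x, y) \<in> parcs (induced N S) \<longleftrightarrow> (?h x, ?h y) \<in> parcs G" .
    qed
    then have "induced N S \<in> C"
      using hereditary_embeds[OF C G] pair_graph_induced[OF pN S(1)] by blast
    then show False using S(2) by (simp add: minimal_forbidden_def)
  qed
  ultimately show ?thesis by (intro exI[of _ F]) (auto simp: F_def)
qed

section \<open>Subdivisions\<close>

definition consec :: "'a list \<Rightarrow> ('a \<times> 'a) set" where
  "consec xs = set (zip xs (tl xs))"

lemma consec_Cons: "consec (x # y # xs) = insert (x, y) (consec (y # xs))"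
  by (simp add: consec_def)

lemma consec_sub: "consec xs \<subseteq> set xs \<times> set xs"
proof -
  have "set (tl xs) \<subseteq> set xs" by (cases xs) auto
  then show ?thesis unfolding consec_def by (auto dest: set_zip_leftD set_zip_rightD)
qed

lemma consec_nth: "consec xs = {(xs ! i, xs ! Suc i) | i. Suc i < length xs}"
  unfolding consec_def set_zip by (auto simp: nth_tl)

text \<open>
  A simple graph given by an orientation of its edges. The orientation makes it possible to speak about
  the first and the last inner vertex of a subdivided edge.
\<close>
locale oriented =
  fixes V0 :: "'a set" and E0 :: "('a \<times> 'a) set"
  assumes finV: "finite V0" and EV: "E0 \<subseteq> V0 \<times> V0"
    and noloop: "(x, x) \<notin> E0" and asym: "(x, y) \<in> E0 \<Longrightarrow> (y, x) \<notin> E0"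
begin

definition seg :: "('a \<times> 'a \<Rightarrow> 'a list) \<Rightarrow> 'a \<times> 'a \<Rightarrow> 'a list" where
  "seg inner e = fst e # inner e @ [snd e]"

definition subdiv_graph :: "('a \<times> 'a \<Rightarrow> 'a list) \<Rightarrow> 'a pair_pre_digraph" where
  "subdiv_graph inner = \<lparr> pverts = V0 \<union> (\<Union>e\<in>E0. set (inner e)),
     parcs = (\<Union>e\<in>E0. consec (seg inner e)) \<union> (\<Union>e\<in>E0. consec (seg inner e))\<inverse> \<rparr>"

definition subdividing :: "('a \<times> 'a \<Rightarrow> 'a list) \<Rightarrow> bool" where
  "subdividing inner \<longleftrightarrow> (\<forall>e\<in>E0. distinct (inner e) \<and> set (inner e) \<inter> V0 = {} \<and> (\<forall>f\<in>E0. e \<noteq> f \<longrightarrow> set (inner e) \<inter> set (inner f) = {}))"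

lemma finE: "finite E0" using EV finV finite_subset by blast

lemma base_graph: "subdiv_graph (\<lambda>_. []) = \<lparr> pverts = V0, parcs = E0 \<union> E0\<inverse> \<rparr>"
proof -
  have "(\<Union>e\<in>E0. consec (seg (\<lambda>_. []) e)) = E0" by (auto simp: seg_def consec_def)
  then show ?thesis by (simp add: subdiv_graph_def)
qed

lemma pair_graph_base: "pair_graph (subdiv_graph (\<lambda>_. []))"
  unfolding base_graph pair_graph_iff using finV EV noloop by (auto simp: sym_def)

text \<open>
  Adding one more vertex at the beginning of a subdivided edge \<open>e\<close> is a single subdivision step: it removes the arc from the
  origin of \<open>e\<close> to the next vertex \<open>h\<close> of its path, which occurs nowhere else.
\<close>
lemma subdivision_insert:
  assumes g: "subdividing inner" and e: "e \<in> E0" and ie: "inner e = w # ws"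
    and sd: "subdivision_pair (subdiv_graph (\<lambda>_. [])) (subdiv_graph (inner(e := ws)))"
  shows "subdivision_pair (subdiv_graph (\<lambda>_. [])) (subdiv_graph inner)"
proof -
  obtain x y where xy: "e = (x, y)" by (cases e)
  let ?i = "inner(e := ws)"
  obtain h r where hr: "ws @ [y] = h # r" by (cases "ws @ [y]") auto
  let ?O = "\<Union>f\<in>E0 - {e}. consec (seg inner f)"
  let ?S = "?O \<union> consec (h # r)"
  have ins: "E0 = insert e (E0 - {e})" using e by blast
  have others: "(\<Union>f\<in>E0 - {e}. consec (seg ?i f)) = ?O" by (auto simp: seg_def)
  have P': "parcs (subdiv_graph ?i) = insert (x, h) ?S \<union> (insert (x, h) ?S)\<inverse>"
  proof -
    have "consec (seg ?i e) = insert (x, h) (consec (h # r))" using hr xy by (simp add: seg_def consec_Cons)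
    then have "(\<Union>f\<in>E0. consec (seg ?i f)) = insert (x, h) ?S"
      by (subst ins, subst UN_insert) (simp add: others Un_commute)
    then show ?thesis by (simp add: subdiv_graph_def)
  qed
  have P: "parcs (subdiv_graph inner) = insert (x, w) (insert (w, h) ?S) \<union> (insert (x, w) (insert (w, h) ?S))\<inverse>"
  proof -
    have "consec (seg inner e) = insert (x, w) (insert (w, h) (consec (h # r)))"
      using hr xy ie by (simp add: seg_def consec_Cons)
    then have "(\<Union>f\<in>E0. consec (seg inner f)) = insert (x, w) (insert (w, h) ?S)"
      by (subst ins, subst UN_insert) (simp add: Un_commute)
    then show ?thesis by (simp add: subdiv_graph_def)
  qed
  have xV: "x \<in> V0" "y \<in> V0" "x \<noteq> y" using e EV noloop xy by auto
  have inn: "distinct (w # ws)" "set (w # ws) \<inter> V0 = {}" using g e ie unfolding subdividing_def by metis+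
  have hset: "set (h # r) = insert y (set ws)" using hr[symmetric] by simp
  have xhr: "x \<notin> set (h # r)" unfolding hset using xV inn by auto
  have hmem: "h \<in> insert y (set ws)" using hset by auto
  have no1: "(x, h) \<notin> consec (h # r)" "(h, x) \<notin> consec (h # r)" using xhr consec_sub[of "h # r"] by blast+
  have no2: "(x, h) \<notin> consec (seg inner f) \<and> (h, x) \<notin> consec (seg inner f)" if f: "f \<in> E0" "f \<noteq> e" for f
  proof (rule ccontr)
    assume "\<not> ?thesis"
    then have a: "(x, h) \<in> consec (seg inner f) \<or> (h, x) \<in> consec (seg inner f)" by blast
    then have "h \<in> set (seg inner f)" using consec_sub[of "seg inner f"] by blast
    moreover have "set (inner f) \<inter> set (inner e) = {}" "set (inner f) \<inter> V0 = {}" using g f e unfolding subdividing_def by blast+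
    moreover have fV: "fst f \<in> V0" "snd f \<in> V0" using EV f by auto
    ultimately have "h = y \<and> ws = []"
      using hmem inn ie hr by (cases ws) (auto simp: seg_def)
    then have a': "(x, y) \<in> consec (seg inner f) \<or> (y, x) \<in> consec (seg inner f)" using a by simp
    have nf: "set (inner f) \<inter> V0 = {}" using g f unfolding subdividing_def by blast
    show False
    proof (cases "inner f")
      case Nil
      then have "consec (seg inner f) = {f}" by (simp add: seg_def consec_def)
      then show False using a' f xy e asym by auto
    next
      case (Cons v vs)
      have "\<not> (a \<in> V0 \<and> b \<in> V0)" if "(a, b) \<in> consec (seg inner f)" for a b
      proof -
        obtain i where i: "a = seg inner f ! i" "b = seg inner f ! Suc i" "Suc i < length (seg inner f)"
          using \<open>(a, b) \<in> consec (seg inner f)\<close> unfolding consec_nth by blast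
        have len: "length (seg inner f) = Suc (Suc (length (inner f)))" by (simp add: seg_def)
        show ?thesis
        proof (cases i)
          case 0
          then have "b = v" using i Cons by (simp add: seg_def)
          then show ?thesis using nf Cons by auto
        next
          case (Suc j)
          then have "j < length (inner f)" using i(3) len by simp
          then have "a \<in> set (inner f)" using i(1) Suc by (simp add: seg_def nth_append)
          then show ?thesis using nf by blast
        qed
      qed
      then show False using a' xV by blast
    qed
  qed
  have notS: "(x, h) \<notin> ?S" "(h, x) \<notin> ?S" using no1 no2 by auto
  have "x \<noteq> h" using xhr by auto
  have w: "w \<notin> pverts (subdiv_graph ?i)"
  proof -
    have "w \<notin> set (?i f)" if "f \<in> E0" for f
    proof (cases "f = e")
      case True then show ?thesis using inn by simp
    next
      case False
      then have "set (inner e) \<inter> set (inner f) = {}" using g e that unfolding subdividing_def by blast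
      then show ?thesis using False ie by auto
    qed
    then show ?thesis using inn by (auto simp: subdiv_graph_def)
  qed
  have eq: "subdiv_graph inner = subdivide (subdiv_graph ?i) (x, h) w"
  proof (rule pair_pre_digraph.equality)
    have "(\<Union>f\<in>E0. set (inner f)) = set (inner e) \<union> (\<Union>f\<in>E0 - {e}. set (inner f))" using e by blast
    moreover have "(\<Union>f\<in>E0. set (?i f)) = set (?i e) \<union> (\<Union>f\<in>E0 - {e}. set (inner f))"
      using e by (auto split: if_splits)
    ultimately show "pverts (subdiv_graph inner) = pverts (subdivide (subdiv_graph ?i) (x, h) w)"
      using ie by (simp add: subdiv_graph_def)
    have "insert (x, w) (insert (w, h) S) \<union> (insert (x, w) (insert (w, h) S))\<inverse>
        = (insert (x, h) S \<union> (insert (x, h) S)\<inverse>) - {(x, h), (h, x)} \<union> {(x, w), (w, x), (w, h), (h, w)}"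
      if "(x, h) \<notin> S" "(h, x) \<notin> S" for S :: "('a \<times> 'a) set" using that by auto
    from this[OF notS] show "parcs (subdiv_graph inner) = parcs (subdivide (subdiv_graph ?i) (x, h) w)"
      unfolding arcs_subdivide P P' .
  qed simp
  have "(x, h) \<in> parcs (subdiv_graph ?i)" unfolding P' by simp
  then show ?thesis unfolding eq by (rule subdivision_pair_divide[OF _ w sd])
qed

lemma subdividing_upd: "subdividing inner \<Longrightarrow> e \<in> E0 \<Longrightarrow> inner e = w # ws \<Longrightarrow> subdividing (inner(e := ws))"
proof -
  assume g: "subdividing inner" and e: "e \<in> E0" and ie: "inner e = w # ws"
  have sub: "set ((inner(e := ws)) f) \<subseteq> set (inner f)" for f using ie by auto
  have dis: "distinct ((inner(e := ws)) f)" if "f \<in> E0" for f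
    using g that ie e unfolding subdividing_def by (cases "f = e") (metis distinct.simps(2) fun_upd_same, simp)
  show "subdividing (inner(e := ws))" unfolding subdividing_def
  proof (intro ballI conjI impI)
    fix f assume f: "f \<in> E0"
    show "distinct ((inner(e := ws)) f)" by (rule dis[OF f])
    show "set ((inner(e := ws)) f) \<inter> V0 = {}" using g f sub[of f] unfolding subdividing_def by blast
    fix f' assume "f' \<in> E0" "f \<noteq> f'"
    then have "set (inner f) \<inter> set (inner f') = {}" using g f unfolding subdividing_def by blast
    then show "set ((inner(e := ws)) f) \<inter> set ((inner(e := ws)) f') = {}" using sub[of f] sub[of f'] by blast
  qed
qed

lemma subdivision_subdiv_graph:
  "subdividing inner \<Longrightarrow> subdivision_pair (subdiv_graph (\<lambda>_. [])) (subdiv_graph inner)"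
proof (induction "\<Sum>e\<in>E0. length (inner e)" arbitrary: inner rule: less_induct)
  case less
  show ?case
  proof (cases "\<exists>e\<in>E0. inner e \<noteq> []")
    case True
    then obtain e w ws where e: "e \<in> E0" "inner e = w # ws" by (metis list.exhaust)
    have "(\<Sum>f\<in>E0. length ((inner(e := ws)) f)) < (\<Sum>f\<in>E0. length (inner f))"
      by (rule sum_strict_mono_ex1[OF finE]) (use e in auto)
    then have "subdivision_pair (subdiv_graph (\<lambda>_. [])) (subdiv_graph (inner(e := ws)))"
      by (rule less.hyps) (rule subdividing_upd[OF less.prems e])
    then show ?thesis by (rule subdivision_insert[OF less.prems e])
  next
    case False
    then have "subdiv_graph inner = subdiv_graph (\<lambda>_. [])" by (simp add: subdiv_graph_def seg_def)
    moreover have "pair_bidirected_digraph (subdiv_graph (\<lambda>_. []))"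
      using pair_graph_base pair_graph.axioms by (meson pair_bidirected_digraph_def pair_digraph_def pair_graph_def pair_pseudo_graph_def)
    ultimately show ?thesis
      using subdivision_base[OF pair_bidirected_digraph.bidirected_digraph] by simp
  qed
qed

end

section \<open>Cutting long subdivisions into tripods\<close>

text \<open>
  The vertices of a subdivided graph, named independently of the vertices chosen for the subdivision:
  the original vertices, and the \<open>i\<close>-th inner vertex of an edge.
\<close>
datatype ('b) node = Branch 'b | Inner "'b \<times> 'b" nat

text \<open>
  In a graph of maximum degree three, the edges at each vertex can be numbered by ports
  such that different edges have different ports. The maps \<open>pt0\<close> and \<open>pt1\<close> give the port of an edge at its origin and
  at its target.
\<close>
locale ported = oriented V0 E0 for V0 :: "'a set" and E0 :: "('a \<times> 'a) set" +
  fixes pt0 pt1 :: "'a \<times> 'a \<Rightarrow> nat"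
  assumes pt3: "e \<in> E0 \<Longrightarrow> pt0 e < 3" "e \<in> E0 \<Longrightarrow> pt1 e < 3"
    and pt00: "e \<in> E0 \<Longrightarrow> f \<in> E0 \<Longrightarrow> fst e = fst f \<Longrightarrow> pt0 e = pt0 f \<Longrightarrow> e = f"
    and pt11: "e \<in> E0 \<Longrightarrow> f \<in> E0 \<Longrightarrow> snd e = snd f \<Longrightarrow> pt1 e = pt1 f \<Longrightarrow> e = f"
    and pt01: "e \<in> E0 \<Longrightarrow> f \<in> E0 \<Longrightarrow> fst e = snd f \<Longrightarrow> pt0 e \<noteq> pt1 f"
begin

text \<open>
  A subdivided edge \<open>e\<close> consists of \<open>n\<close> items and is cut at the item \<open>ct e\<close>. The two remaining pieces become legs of
  tripods at the two ends of the edge: an item is described by the branch vertex \<open>x\<close> of its leg, the number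
  of the leg, and the distance from its beginning.
\<close>
definition arm_coord :: "nat \<Rightarrow> ('a \<times> 'a \<Rightarrow> nat) \<Rightarrow> 'a \<times> 'a \<Rightarrow> nat \<Rightarrow> 'a \<times> nat \<times> nat" where
  "arm_coord n ct e i = (if i < ct e then (fst e, pt0 e, i) else (snd e, pt1 e, n - 1 - i))"

lemma arm_coord_same:
  assumes "e \<in> E0" "f \<in> E0" "i < n" "j < n" "i \<noteq> ct e" "j \<noteq> ct f"
    and "arm_coord n ct e i = (x, a, k)" "arm_coord n ct f j = (x, a, l)"
  shows "e = f \<and> ((i < ct e) = (j < ct f)) \<and> (k = l \<longleftrightarrow> i = j) \<and> ((k = Suc l \<or> l = Suc k) \<longleftrightarrow> (i = Suc j \<or> j = Suc i))"
proof (cases "i < ct e"; cases "j < ct f")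
  assume c: "i < ct e" "j < ct f"
  then have "fst e = fst f" "pt0 e = pt0 f" "k = i" "l = j" using assms(7,8) by (simp_all add: arm_coord_def)
  then show ?thesis using pt00[OF assms(1,2)] c by simp
next
  assume c: "i < ct e" "\<not> j < ct f"
  then have "fst e = snd f" "pt0 e = pt1 f" using assms(7,8) by (simp_all add: arm_coord_def)
  then show ?thesis using pt01[OF assms(1,2)] by simp
next
  assume c: "\<not> i < ct e" "j < ct f"
  then have "fst f = snd e" "pt0 f = pt1 e" using assms(7,8) by (simp_all add: arm_coord_def)
  then show ?thesis using pt01[OF assms(2,1)] by simp
next
  assume c: "\<not> i < ct e" "\<not> j < ct f"
  then have "snd e = snd f" "pt1 e = pt1 f" and kl: "k = n - 1 - i" "l = n - 1 - j"
    using assms(7,8) by (simp_all add: arm_coord_def)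
  then have "e = f" using pt11[OF assms(1,2)] by simp
  moreover have "k = l \<longleftrightarrow> i = j" "(k = Suc l \<or> l = Suc k) \<longleftrightarrow> (i = Suc j \<or> j = Suc i)"
    using kl assms(3,4) by arith+
  ultimately show ?thesis using c by simp
qed

lemma arm_coord_consec:
  assumes "e \<in> E0" "i < n" "j < n" "i \<noteq> ct e" "j \<noteq> ct e" "i = Suc j \<or> j = Suc i"
    and "arm_coord n ct e i = (x, a, k)" "arm_coord n ct e j = (y, b, l)"
  shows "x = y \<and> a = b \<and> (k = Suc l \<or> l = Suc k)"
  using assms by (auto simp: arm_coord_def split: if_splits)

lemma arm_coord_end:
  assumes "e \<in> E0" "i < n" "2 \<le> n" "i \<noteq> ct e" "ct e < n" "arm_coord n ct e i = (x, a, k)"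
  shows "(k = 0 \<and> x = z) \<longleftrightarrow> (i = 0 \<and> z = fst e) \<or> (i = n - 1 \<and> z = snd e)"
  using assms by (auto simp: arm_coord_def split: if_splits)

lemma arm_coord_bounds:
  assumes "e \<in> E0" "i < n" "i \<noteq> ct e" "ct e < n" "arm_coord n ct e i = (x, a, k)"
  shows "x \<in> V0" "a < 3" "k < n - 1"
  using assms pt3[of e] EV by (auto simp: arm_coord_def split: if_splits)

lemma find_cut:
  assumes "finite X" "card X < n"
  shows "\<exists>ct. \<forall>e. ct e < n \<and> (e, ct e) \<notin> (X :: (('a \<times> 'a) \<times> nat) set)"
proof -
  have "\<exists>i<n. (e, i) \<notin> X" for e
  proof (rule ccontr)
    assume "\<not> ?thesis"
    then have "Pair e ` {..<n} \<subseteq> X" by auto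
    then have "card (Pair e ` {..<n}) \<le> card X" by (rule card_mono[OF assms(1)])
    then show False using assms(2) by (simp add: card_image inj_on_def)
  qed
  then show ?thesis by metis
qed

text \<open>
  The \<open>i\<close>-th vertex on the path that replaces \<open>e\<close>, where both ends are included and thus \<open>i \<le> Suc q\<close>.
\<close>
definition segN :: "nat \<Rightarrow> 'a \<times> 'a \<Rightarrow> nat \<Rightarrow> 'a node" where
  "segN q e i = (if i = 0 then Branch (fst e) else if i \<le> q then Inner e (i - 1) else Branch (snd e))"

definition nd :: "('a \<times> 'a \<Rightarrow> 'a list) \<Rightarrow> 'a node \<Rightarrow> 'a" where
  "nd inner u = (case u of Branch x \<Rightarrow> x | Inner e i \<Rightarrow> inner e ! i)"

definition nodes :: "nat \<Rightarrow> 'a node set" where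
  "nodes q = Branch ` V0 \<union> {Inner e i | e i. e \<in> E0 \<and> i < q}"

lemma nodes_Branch: "Branch x \<in> nodes q \<longleftrightarrow> x \<in> V0"
  by (auto simp: nodes_def)

lemma nodes_Inner: "Inner e i \<in> nodes q \<longleftrightarrow> e \<in> E0 \<and> i < q"
  unfolding nodes_def by blast

lemma segN_in: "e \<in> E0 \<Longrightarrow> i \<le> Suc q \<Longrightarrow> segN q e i \<in> nodes q"
  using EV by (auto simp: segN_def nodes_def)

lemma segN_eq:
  assumes "i \<le> Suc q" "j \<le> Suc q" "segN q e i = segN q f j"
  shows "(e = f \<and> i = j) \<or> (i \<in> {0, Suc q} \<and> j \<in> {0, Suc q} \<and>
     (if i = 0 then fst e else snd e) = (if j = 0 then fst f else snd f))"
  using assms by (auto simp: segN_def split: if_splits)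

context
  fixes inner q
  assumes gd: "subdividing inner" and len: "\<And>e. e \<in> E0 \<Longrightarrow> length (inner e) = q" and q2: "2 \<le> q"
begin

abbreviation "H \<equiv> subdiv_graph inner"

lemma nd_inj: "inj_on (nd inner) (nodes q)"
proof (rule inj_onI)
  fix u v assume u: "u \<in> nodes q" and v: "v \<in> nodes q" and eq: "nd inner u = nd inner v"
  have inn: "inner e ! i \<in> set (inner e)" if "e \<in> E0" "i < q" for e i using that len by simp
  have nV: "inner e ! i \<notin> V0" if "e \<in> E0" "i < q" for e i
    using inn[OF that] gd that(1) unfolding subdividing_def by blast
  show "u = v"
  proof (cases u; cases v)
    fix e i f j assume uv: "u = Inner e i" "v = Inner f j"
    then have ef: "e \<in> E0" "i < q" "f \<in> E0" "j < q" using u v by (auto simp: nodes_Inner)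
    have e: "inner e ! i = inner f ! j" using eq uv by (simp add: nd_def)
    have "e = f"
    proof (rule ccontr)
      assume "e \<noteq> f"
      then have "set (inner e) \<inter> set (inner f) = {}" using gd ef unfolding subdividing_def by blast
      then show False using inn[OF ef(1,2)] inn[OF ef(3,4)] e by auto
    qed
    moreover have "distinct (inner e)" using gd ef unfolding subdividing_def by blast
    ultimately have "i = j" using e ef len[OF ef(1)] nth_eq_iff_index_eq[of "inner e" i j] by simp
    then show "u = v" using uv \<open>e = f\<close> by simp
  qed (use u v eq nV in \<open>auto simp: nodes_def nd_def\<close>)
qed

lemma nd_image: "nd inner ` nodes q = pverts H"
proof -
  have "nd inner ` {Inner e i | e i. e \<in> E0 \<and> i < q} = (\<Union>e\<in>E0. set (inner e))"
  proof (intro equalityI subsetI)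
    fix x assume "x \<in> nd inner ` {Inner e i | e i. e \<in> E0 \<and> i < q}"
    then obtain e i where e: "e \<in> E0" "i < q" "x = inner e ! i" by (auto simp: nd_def)
    then have "x \<in> set (inner e)" using len[OF e(1)] by simp
    then show "x \<in> (\<Union>e\<in>E0. set (inner e))" using e(1) by blast
  next
    fix x assume "x \<in> (\<Union>e\<in>E0. set (inner e))"
    then obtain e i where "e \<in> E0" "i < q" "x = inner e ! i" using len by (metis UN_E in_set_conv_nth)
    then show "x \<in> nd inner ` {Inner e i | e i. e \<in> E0 \<and> i < q}"
    proof (intro image_eqI[of _ _ "Inner e i"])
      show "x = nd inner (Inner e i)" using \<open>x = inner e ! i\<close> by (simp add: nd_def)
    qed (use \<open>e \<in> E0\<close> \<open>i < q\<close> in blast)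
  qed
  moreover have "nd inner ` Branch ` V0 = V0" by (auto simp: nd_def image_image)
  ultimately show ?thesis by (simp add: nodes_def image_Un subdiv_graph_def)
qed

lemma seg_nd: "e \<in> E0 \<Longrightarrow> i \<le> Suc q \<Longrightarrow> seg inner e ! i = nd inner (segN q e i)"
  using len[of e] by (cases i) (auto simp: seg_def nd_def segN_def nth_append le_Suc_eq)

lemma consec_seg: "e \<in> E0 \<Longrightarrow> consec (seg inner e) = {(nd inner (segN q e i), nd inner (segN q e (Suc i))) | i. i \<le> q}"
proof -
  assume e: "e \<in> E0"
  have l: "length (seg inner e) = Suc (Suc q)" using len[OF e] by (simp add: seg_def)
  have "(seg inner e ! i, seg inner e ! Suc i) = (nd inner (segN q e i), nd inner (segN q e (Suc i)))" if "i \<le> q" for i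
    using seg_nd[OF e, of i] seg_nd[OF e, of "Suc i"] that by simp
  then show ?thesis unfolding consec_nth l by (auto simp: less_Suc_eq_le) metis+
qed

lemma parcs_H: "parcs H = {(x, y). \<exists>e\<in>E0. \<exists>i\<le>q. {x, y} = nd inner ` {segN q e i, segN q e (Suc i)} }"
proof -
  have "(x, y) \<in> parcs H \<longleftrightarrow> (\<exists>e\<in>E0. \<exists>i\<le>q. {x, y} = nd inner ` {segN q e i, segN q e (Suc i)})" for x y
  proof -
    have "(x, y) \<in> parcs H \<longleftrightarrow> (\<exists>e\<in>E0. (x, y) \<in> consec (seg inner e) \<or> (y, x) \<in> consec (seg inner e))"
      by (auto simp: subdiv_graph_def)
    also have "\<dots> \<longleftrightarrow> (\<exists>e\<in>E0. \<exists>i\<le>q. {x, y} = nd inner ` {segN q e i, segN q e (Suc i)})"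
      by (rule bex_cong[OF refl]) (auto simp: consec_seg doubleton_eq_iff)
    finally show ?thesis .
  qed
  then show ?thesis by auto
qed

lemma adj_nodes:
  assumes "u \<in> nodes q" "v \<in> nodes q"
  shows "(nd inner u, nd inner v) \<in> parcs H \<longleftrightarrow> (\<exists>e\<in>E0. \<exists>i\<le>q. {u, v} = {segN q e i, segN q e (Suc i)})"
proof -
  have eq: "{nd inner u, nd inner v} = nd inner ` {segN q e i, segN q e (Suc i)} \<longleftrightarrow> {u, v} = {segN q e i, segN q e (Suc i)}"
    if "e \<in> E0" "i \<le> q" for e i
    using inj_on_image_eq_iff[OF nd_inj, of "{u, v}" "{segN q e i, segN q e (Suc i)}"]
      assms segN_in[OF that(1), of i q] segN_in[OF that(1), of "Suc i" q] that(2) by simp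
  have "(\<exists>e\<in>E0. \<exists>i\<le>q. {nd inner u, nd inner v} = nd inner ` {segN q e i, segN q e (Suc i)}) \<longleftrightarrow>
      (\<exists>e\<in>E0. \<exists>i\<le>q. {u, v} = {segN q e i, segN q e (Suc i)})"
    by (rule bex_cong[OF refl], rule ex_cong1, rule conj_cong[OF refl], rule eq)
  then show ?thesis unfolding parcs_H by simp
qed

lemma adj_branch_branch: "x \<in> V0 \<Longrightarrow> y \<in> V0 \<Longrightarrow> (nd inner (Branch x), nd inner (Branch y)) \<notin> parcs H"
  using adj_nodes[of "Branch x" "Branch y"] q2 by (auto simp: nodes_def doubleton_eq_iff segN_def split: if_splits)

lemma adj_branch_inner:
  assumes "x \<in> V0" "e \<in> E0" "i < q"
  shows "(nd inner (Branch x), nd inner (Inner e i)) \<in> parcs H \<longleftrightarrow> (i = 0 \<and> x = fst e) \<or> (i = q - 1 \<and> x = snd e)"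
proof
  assume "(nd inner (Branch x), nd inner (Inner e i)) \<in> parcs H"
  then obtain f j where f: "f \<in> E0" "j \<le> q" "{Branch x, Inner e i} = {segN q f j, segN q f (Suc j)}"
    using adj_nodes[of "Branch x" "Inner e i"] assms unfolding nodes_Branch nodes_Inner by blast
  then show "(i = 0 \<and> x = fst e) \<or> (i = q - 1 \<and> x = snd e)"
    using q2 by (auto simp: doubleton_eq_iff segN_def split: if_splits)
next
  assume "(i = 0 \<and> x = fst e) \<or> (i = q - 1 \<and> x = snd e)"
  then have "{Branch x, Inner e i} = {segN q e 0, segN q e (Suc 0)} \<or> {Branch x, Inner e i} = {segN q e q, segN q e (Suc q)}"
    using q2 by (auto simp: segN_def)
  then have "\<exists>g\<in>E0. \<exists>k\<le>q. {Branch x, Inner e i} = {segN q g k, segN q g (Suc k)}"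
    using assms(2) by (meson le0 order_refl)
  then show "(nd inner (Branch x), nd inner (Inner e i)) \<in> parcs H"
    using adj_nodes[of "Branch x" "Inner e i"] assms unfolding nodes_Branch nodes_Inner by blast
qed

lemma adj_inner_inner:
  assumes "e \<in> E0" "i < q" "f \<in> E0" "j < q"
  shows "(nd inner (Inner e i), nd inner (Inner f j)) \<in> parcs H \<longleftrightarrow> e = f \<and> (i = Suc j \<or> j = Suc i)"
proof
  assume "(nd inner (Inner e i), nd inner (Inner f j)) \<in> parcs H"
  then obtain g k where f: "g \<in> E0" "k \<le> q" "{Inner e i, Inner f j} = {segN q g k, segN q g (Suc k)}"
    using adj_nodes[of "Inner e i" "Inner f j"] assms unfolding nodes_Inner by blast
  then show "e = f \<and> (i = Suc j \<or> j = Suc i)"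
    by (auto simp: doubleton_eq_iff segN_def split: if_splits)
next
  assume a: "e = f \<and> (i = Suc j \<or> j = Suc i)"
  then have "{Inner e i, Inner f j} = {segN q e (Suc i), segN q e (Suc (Suc i))} \<or>
      {Inner e i, Inner f j} = {segN q e (Suc j), segN q e (Suc (Suc j))}"
    using assms by (auto simp: segN_def)
  moreover have "Suc i \<le> q" "Suc j \<le> q" using assms by auto
  ultimately have "\<exists>g\<in>E0. \<exists>k\<le>q. {Inner e i, Inner f j} = {segN q g k, segN q g (Suc k)}" using assms(1) by blast
  then show "(nd inner (Inner e i), nd inner (Inner f j)) \<in> parcs H"
    using adj_nodes[of "Inner e i" "Inner f j"] assms unfolding nodes_Inner by blast
qed

text \<open>
  The \<open>i\<close>-th edge of the path that replaces \<open>e\<close>, which is a vertex of the line graph.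
\<close>
definition edge_of :: "'a \<times> 'a \<Rightarrow> nat \<Rightarrow> 'a set" where
  "edge_of e i = nd inner ` {segN q e i, segN q e (Suc i)}"

lemma edge_sets_H: "edge_sets H = {edge_of e i | e i. e \<in> E0 \<and> i \<le> q}"
proof (intro equalityI subsetI)
  fix s assume "s \<in> edge_sets H"
  then obtain u v where "s = {u, v}" "(u, v) \<in> parcs H" by (auto simp: edge_sets_def)
  then show "s \<in> {edge_of e i | e i. e \<in> E0 \<and> i \<le> q}" unfolding parcs_H edge_of_def by auto
next
  fix s assume "s \<in> {edge_of e i | e i. e \<in> E0 \<and> i \<le> q}"
  then obtain e i where "e \<in> E0" "i \<le> q" "s = {nd inner (segN q e i), nd inner (segN q e (Suc i))}" by (auto simp: edge_of_def)
  then show "s \<in> edge_sets H" unfolding edge_sets_def parcs_H by auto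
qed

lemma edge_of_meet:
  assumes "e \<in> E0" "i \<le> q" "f \<in> E0" "j \<le> q" "(e, i) \<noteq> (f, j)"
  shows "edge_of e i \<inter> edge_of f j \<noteq> {} \<longleftrightarrow> (e = f \<and> (i = Suc j \<or> j = Suc i)) \<or>
    (\<exists>z. ((i = 0 \<and> z = fst e) \<or> (i = q \<and> z = snd e)) \<and> ((j = 0 \<and> z = fst f) \<or> (j = q \<and> z = snd f)))"
proof -
  have "edge_of e i \<inter> edge_of f j = nd inner ` ({segN q e i, segN q e (Suc i)} \<inter> {segN q f j, segN q f (Suc j)})"
    unfolding edge_of_def
    by (rule inj_on_image_Int[OF nd_inj, symmetric]) (use assms segN_in in auto)
  then have *: "edge_of e i \<inter> edge_of f j \<noteq> {} \<longleftrightarrow> (\<exists>i'\<in>{i, Suc i}. \<exists>j'\<in>{j, Suc j}. segN q e i' = segN q f j')" by auto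
  show ?thesis unfolding *
  proof
    assume "\<exists>i'\<in>{i, Suc i}. \<exists>j'\<in>{j, Suc j}. segN q e i' = segN q f j'"
    then obtain i' j' where ij: "i' \<in> {i, Suc i}" "j' \<in> {j, Suc j}" "segN q e i' = segN q f j'" by blast
    have "i' \<le> Suc q" "j' \<le> Suc q" using ij assms by auto
    from segN_eq[OF this ij(3)] show "(e = f \<and> (i = Suc j \<or> j = Suc i)) \<or>
      (\<exists>z. ((i = 0 \<and> z = fst e) \<or> (i = q \<and> z = snd e)) \<and> ((j = 0 \<and> z = fst f) \<or> (j = q \<and> z = snd f)))"
      using ij assms by (auto split: if_splits)
  next
    assume "(e = f \<and> (i = Suc j \<or> j = Suc i)) \<or>
      (\<exists>z. ((i = 0 \<and> z = fst e) \<or> (i = q \<and> z = snd e)) \<and> ((j = 0 \<and> z = fst f) \<or> (j = q \<and> z = snd f)))"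
    then show "\<exists>i'\<in>{i, Suc i}. \<exists>j'\<in>{j, Suc j}. segN q e i' = segN q f j'"
      by (auto simp: segN_def)
  qed
qed

text \<open>
  A set of fewer than \<open>q\<close> vertices misses an inner vertex of every subdivided edge. Without these missed
  vertices the graph falls apart into tripods around the branch vertices, with legs shorter than \<open>q\<close>; hence it
  embeds into a disjoint union of claws, one for each branch vertex.
\<close>
lemma claw_embed:
  assumes E: "sgraph (\<lambda>u v. (u, v) \<in> parcs G)"
    and A: "\<And>x. x \<in> V0 \<Longrightarrow> sgraph.claw (\<lambda>u v. (u, v) \<in> parcs G) q (A x) \<and> A x \<subseteq> pverts G"
    and an: "\<And>x y. x \<in> V0 \<Longrightarrow> y \<in> V0 \<Longrightarrow> x \<noteq> y \<Longrightarrow> sgraph.apart (\<lambda>u v. (u, v) \<in> parcs G) (A x) (A y)"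
    and F: "F \<subseteq> pverts H" "finite F" "card F < q"
  shows "\<exists>f. embeds f H F G"
proof -
  interpret sgraph "\<lambda>u v. (u, v) \<in> parcs G" by (rule E)
  let ?E = "\<lambda>u v. (u, v) \<in> parcs G"
  have "\<exists>c L. (\<forall>i<3. length (L i) = q \<and> ipath (c # L i)) \<and>
     (\<forall>i<3. \<forall>j<3. i \<noteq> j \<longrightarrow> apart (set (L i)) (set (L j))) \<and> A x = insert c (\<Union>i<3::nat. set (L i))" if "x \<in> V0" for x
    using A[OF that] unfolding claw_def by blast
  then obtain cs Ls where L: "\<And>x a. x \<in> V0 \<Longrightarrow> a < 3 \<Longrightarrow> length (Ls x a) = q \<and> ipath (cs x # Ls x a)"
    and La: "\<And>x a b. x \<in> V0 \<Longrightarrow> a < 3 \<Longrightarrow> b < 3 \<Longrightarrow> a \<noteq> b \<Longrightarrow> apart (set (Ls x a)) (set (Ls x b))"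
    and LA: "\<And>x. x \<in> V0 \<Longrightarrow> A x = insert (cs x) (\<Union>i<3::nat. set (Ls x i))"
    by metis
  have csA: "cs x \<in> A x" if "x \<in> V0" for x using LA[OF that] by simp
  have lsA: "Ls x a ! k \<in> A x" if "x \<in> V0" "a < 3" "k < q" for x a k
  proof -
    have "Ls x a ! k \<in> set (Ls x a)" using L[OF that(1,2)] that(3) by simp
    moreover have "set (Ls x a) \<subseteq> A x" unfolding LA[OF that(1)] using that(2) by blast
    ultimately show ?thesis by blast
  qed
  have t1: "cs x \<noteq> cs y \<and> \<not> ?E (cs x) (cs y)" if "x \<in> V0" "y \<in> V0" "x \<noteq> y" for x y
    using an[OF that] csA[OF that(1)] csA[OF that(2)] unfolding apart_def by blast
  have t2: "cs x \<noteq> Ls y a ! k \<and> (?E (cs x) (Ls y a ! k) \<longleftrightarrow> k = 0 \<and> y = x)" if "x \<in> V0" "y \<in> V0" "a < 3" "k < q" for x y a k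
  proof (cases "x = y")
    case True
    have ip: "ipath (cs x # Ls x a)" "length (Ls x a) = q" using L[OF that(1,3)] by auto
    then have "cs x \<notin> set (Ls x a)" by (auto simp: ipath_def)
    then have "cs x \<noteq> Ls x a ! k" using ip(2) that(4) nth_mem by metis
    then show ?thesis using True ipath_nthE[OF ip(1), of 0 "Suc k"] ip(2) that(4) by auto
  next
    case False
    then show ?thesis using an[OF that(1,2)] csA[OF that(1)] lsA[OF that(2-4)] unfolding apart_def by blast
  qed
  have t3: "(Ls x a ! k = Ls y b ! l \<longleftrightarrow> (x, a, k) = (y, b, l)) \<and> (?E (Ls x a ! k) (Ls y b ! l) \<longleftrightarrow> x = y \<and> a = b \<and> (k = Suc l \<or> l = Suc k))"
    if "x \<in> V0" "a < 3" "k < q" "y \<in> V0" "b < 3" "l < q" for x a k y b l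
  proof (cases "x = y")
    case True
    have ip: "ipath (cs x # Ls x a)" "length (Ls x a) = q" using L[OF that(1,2)] by auto
    show ?thesis
    proof (cases "a = b")
      case ab: True
      have "Ls x a ! k = Ls x a ! l \<longleftrightarrow> k = l" using ip that nth_eq_iff_index_eq[of "Ls x a" k l] by (simp add: ipath_def)
      then show ?thesis using True ab ipath_nthE[OF ip(1), of "Suc k" "Suc l"] ip(2) that by auto
    next
      case ab: False
      have "Ls x a ! k \<in> set (Ls x a)" "Ls x b ! l \<in> set (Ls x b)" using L[OF that(1,2)] L[OF that(1,5)] that by auto
      then show ?thesis using La[OF that(1,2,5) ab] True ab unfolding apart_def by blast
    qed
  next
    case False
    then show ?thesis using an[OF that(1,4)] lsA[OF that(1-3)] lsA[OF that(4-6)] unfolding apart_def by blast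
  qed
  let ?nof = "inv_into (nodes q) (nd inner)"
  have nof: "?nof v \<in> nodes q" "nd inner (?nof v) = v" if "v \<in> F" for v
    using that F(1) nd_image inv_into_into[of v "nd inner" "nodes q"] f_inv_into_f[of v "nd inner" "nodes q"] by auto
  \<comment> \<open>The inner vertices in use; each edge is cut at one that is not in use.\<close>
  define X where "X = {(e, i). Inner e i \<in> ?nof ` F}"
  have inX: "inj_on (\<lambda>(e, i). Inner e i) X" by (auto simp: inj_on_def)
  have sX: "(\<lambda>(e, i). Inner e i) ` X \<subseteq> ?nof ` F" by (auto simp: X_def)
  have finX: "finite X" using inj_on_finite[OF inX sX] F(2) by blast
  have "card X \<le> card F"
    using card_inj_on_le[OF inX sX] card_image_le[OF F(2), of ?nof] F(2) by simp
  then obtain ct where ct: "\<And>e. ct e < q \<and> (e, ct e) \<notin> X" using find_cut[OF finX, of q] F(3) by auto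
  define g where "g u = (case u of Branch x \<Rightarrow> cs x | Inner e i \<Rightarrow> (case arm_coord q ct e i of (x, a, k) \<Rightarrow> Ls x a ! k))" for u
  let ?N = "?nof ` F"
  have NB: "x \<in> V0" if "Branch x \<in> ?N" for x
    using that nof(1) nodes_Branch[of x q] by fastforce
  have NI: "e \<in> E0 \<and> i < q \<and> i \<noteq> ct e" if "Inner e i \<in> ?N" for e i
  proof -
    have "(e, i) \<in> X" using that by (simp add: X_def)
    then have "i \<noteq> ct e" using ct[of e] by auto
    moreover have "Inner e i \<in> nodes q" using that nof(1) by auto
    ultimately show ?thesis by (simp add: nodes_Inner)
  qed
  have main: "(g u = g v \<longleftrightarrow> u = v) \<and> (?E (g u) (g v) \<longleftrightarrow> (nd inner u, nd inner v) \<in> parcs H)" if u: "u \<in> ?N" and v: "v \<in> ?N" for u v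
  proof -
    have BI: "(g (Branch z) \<noteq> g (Inner e i)) \<and> (?E (g (Branch z)) (g (Inner e i)) \<longleftrightarrow> (nd inner (Branch z), nd inner (Inner e i)) \<in> parcs H)"
      if z: "Branch z \<in> ?N" and e: "Inner e i \<in> ?N" for z e i
    proof -
      obtain x a k where h: "arm_coord q ct e i = (x, a, k)" by (cases "arm_coord q ct e i")
      note e' = NI[OF e] and c = ct[of e, THEN conjunct1]
      have b: "x \<in> V0" "a < 3" "k < q - 1" using arm_coord_bounds[of e i q ct x a k] e' c h by auto
      have "k < q" using b by simp
      have g: "g (Branch z) = cs z" "g (Inner e i) = Ls x a ! k" by (simp_all add: g_def h)
      show ?thesis unfolding g adj_branch_inner[OF NB[OF z] e'[THEN conjunct1] e'[THEN conjunct2, THEN conjunct1]]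
        using t2[OF NB[OF z] b(1,2) \<open>k < q\<close>] arm_coord_end[of e i q ct x a k z] e' c h q2 by simp
    qed
    show ?thesis
    proof (cases u; cases v)
      fix x y assume uv: "u = Branch x" "v = Branch y"
      have xy: "x \<in> V0" "y \<in> V0" using NB u v uv by auto
      show ?thesis using adj_branch_branch[OF xy] t1[OF xy] irrefl uv by (cases "x = y") (auto simp: g_def)
    next
      fix x e i assume "u = Branch x" "v = Inner e i"
      then show ?thesis using BI u v by auto
    next
      fix x e i assume uv: "u = Inner e i" "v = Branch x"
      have "(nd inner u, nd inner v) \<in> parcs H \<longleftrightarrow> (nd inner v, nd inner u) \<in> parcs H"
        by (auto simp: subdiv_graph_def)
      then show ?thesis using BI[of x e i] u v uv E_commute[of "g u" "g v"] by auto
    next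
      fix e i f j assume uv: "u = Inner e i" "v = Inner f j"
      note e' = NI[OF u[unfolded uv]] and f' = NI[OF v[unfolded uv]]
      have c: "ct e < q" "ct f < q" using ct by auto
      obtain x a k where h: "arm_coord q ct e i = (x, a, k)" by (cases "arm_coord q ct e i")
      obtain y b l where h': "arm_coord q ct f j = (y, b, l)" by (cases "arm_coord q ct f j")
      have b1: "x \<in> V0" "a < 3" "k < q - 1" using arm_coord_bounds[of e i q ct x a k] e' c h by auto
      have b2: "y \<in> V0" "b < 3" "l < q - 1" using arm_coord_bounds[of f j q ct y b l] f' c h' by auto
      have kl: "k < q" "l < q" using b1 b2 by auto
      have g: "g u = Ls x a ! k" "g v = Ls y b ! l" by (simp_all add: g_def uv h h')
      have same: "e = f \<and> (k = l \<longleftrightarrow> i = j) \<and> ((k = Suc l \<or> l = Suc k) \<longleftrightarrow> (i = Suc j \<or> j = Suc i))" if "x = y" "a = b"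
        using arm_coord_same[of e f i q j ct x a k l] e' f' h h' that by auto
      have cons: "x = y \<and> a = b \<and> (k = Suc l \<or> l = Suc k)" if "e = f" "i = Suc j \<or> j = Suc i"
        using arm_coord_consec[of e i q j ct x a k y b l] e' f' h h' that by auto
      have idx: "x = y \<and> a = b \<and> k = l" if "e = f" "i = j" using h h' that by simp
      have 1: "g u = g v \<longleftrightarrow> u = v" unfolding g
        using t3[OF b1(1,2) kl(1) b2(1,2) kl(2)] same idx uv by auto
      have 2: "?E (g u) (g v) \<longleftrightarrow> (nd inner u, nd inner v) \<in> parcs H" unfolding g
        using t3[OF b1(1,2) kl(1) b2(1,2) kl(2)] same cons uv
          adj_inner_inner[OF e'[THEN conjunct1] e'[THEN conjunct2, THEN conjunct1] f'[THEN conjunct1] f'[THEN conjunct2, THEN conjunct1]] by auto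
      show ?thesis using 1 2 by blast
    qed
  qed
  have gG: "g u \<in> pverts G" if u: "u \<in> ?N" for u
  proof (cases u)
    case (Branch x)
    then have "x \<in> V0" using NB u by auto
    then show ?thesis using csA[of x] A[of x] Branch by (auto simp: g_def)
  next
    case (Inner e i)
    note e' = NI[OF u[unfolded Inner]]
    obtain x a k where h: "arm_coord q ct e i = (x, a, k)" by (cases "arm_coord q ct e i")
    have b1: "x \<in> V0" "a < 3" "k < q - 1" using arm_coord_bounds[of e i q ct x a k] e' ct[of e] h by auto
    then have "Ls x a ! k \<in> A x" using lsA by simp
    then show ?thesis using A[OF b1(1)] Inner h by (auto simp: g_def)
  qed
  have "embeds (g \<circ> ?nof) H F G"
    unfolding embeds_def
  proof (intro conjI ballI)
    show "inj_on (g \<circ> ?nof) F"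
    proof (rule inj_onI)
      fix u v assume uv: "u \<in> F" "v \<in> F" "(g \<circ> ?nof) u = (g \<circ> ?nof) v"
      then have "?nof u = ?nof v" using main[of "?nof u" "?nof v"] by auto
      then show "u = v" using nof(2)[OF uv(1)] nof(2)[OF uv(2)] by metis
    qed
    show "(g \<circ> ?nof) ` F \<subseteq> pverts G" using gG by auto
    fix u v assume uv: "u \<in> F" "v \<in> F"
    then show "(u, v) \<in> parcs H \<longleftrightarrow> ((g \<circ> ?nof) u, (g \<circ> ?nof) v) \<in> parcs G"
      using main[of "?nof u" "?nof v"] nof(2)[OF uv(1)] nof(2)[OF uv(2)] by auto
  qed
  then show ?thesis by blast
qed

text \<open>
  The analogue for the line graph: when an edge of every path is missing, it falls apart
  into triangles with three paths, one for each branch vertex.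
\<close>
lemma line_claw_embed:
  assumes E: "sgraph (\<lambda>u v. (u, v) \<in> parcs G)"
    and A: "\<And>x. x \<in> V0 \<Longrightarrow> sgraph.line_claw (\<lambda>u v. (u, v) \<in> parcs G) q (A x) \<and> A x \<subseteq> pverts G"
    and an: "\<And>x y. x \<in> V0 \<Longrightarrow> y \<in> V0 \<Longrightarrow> x \<noteq> y \<Longrightarrow> sgraph.apart (\<lambda>u v. (u, v) \<in> parcs G) (A x) (A y)"
    and F: "F \<subseteq> pverts (line_graph H)" "finite F" "card F < q"
  shows "\<exists>f. embeds f (line_graph H) F G"
proof -
  interpret sgraph "\<lambda>u v. (u, v) \<in> parcs G" by (rule E)
  let ?E = "\<lambda>u v. (u, v) \<in> parcs G"
  define P where "P x L \<longleftrightarrow> (\<forall>i<3. length (L i) = q \<and> ipath (L i)) \<and>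
     (\<forall>i<3. \<forall>j<3. i \<noteq> j \<longrightarrow> (\<forall>a<q. \<forall>b<q. L i ! a \<noteq> L j ! b \<and> (?E (L i ! a) (L j ! b) \<longleftrightarrow> a = 0 \<and> b = 0))) \<and>
     A x = (\<Union>i<3::nat. set (L i))" for x L
  have "\<forall>x\<in>V0. \<exists>L. P x L" using A unfolding line_claw_def P_def by blast
  then obtain Ls where Ls: "\<forall>x\<in>V0. P x (Ls x)" using bchoice[of V0 P] by blast
  have P: "P x (Ls x)" if "x \<in> V0" for x using Ls that by blast
  have L: "length (Ls x a) = q \<and> ipath (Ls x a)" if "x \<in> V0" "a < 3" for x a
    using P[OF that(1)] that(2) unfolding P_def by blast
  have La: "Ls x a ! k \<noteq> Ls x b ! l \<and> (?E (Ls x a ! k) (Ls x b ! l) \<longleftrightarrow> k = 0 \<and> l = 0)"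
    if "x \<in> V0" "a < 3" "b < 3" "a \<noteq> b" "k < q" "l < q" for x a b k l
    using P[OF that(1)] that(2-6) unfolding P_def by simp
  have LA: "A x = (\<Union>i<3::nat. set (Ls x i))" if "x \<in> V0" for x
    using P[OF that] unfolding P_def by blast
  have lsA: "Ls x a ! k \<in> A x" if "x \<in> V0" "a < 3" "k < q" for x a k
  proof -
    have "Ls x a ! k \<in> set (Ls x a)" using L[OF that(1,2)] that(3) by simp
    moreover have "set (Ls x a) \<subseteq> A x" unfolding LA[OF that(1)] using that(2) by blast
    ultimately show ?thesis by blast
  qed
  have t3: "(Ls x a ! k = Ls y b ! l \<longleftrightarrow> (x, a, k) = (y, b, l)) \<and>
     (?E (Ls x a ! k) (Ls y b ! l) \<longleftrightarrow> x = y \<and> ((a = b \<and> (k = Suc l \<or> l = Suc k)) \<or> (a \<noteq> b \<and> k = 0 \<and> l = 0)))"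
    if "x \<in> V0" "a < 3" "k < q" "y \<in> V0" "b < 3" "l < q" for x a k y b l
  proof (cases "x = y")
    case True
    have ip: "ipath (Ls x a)" "length (Ls x a) = q" using L[OF that(1,2)] by auto
    show ?thesis
    proof (cases "a = b")
      case ab: True
      have "Ls x a ! k = Ls x a ! l \<longleftrightarrow> k = l" using ip that nth_eq_iff_index_eq[of "Ls x a" k l] by (simp add: ipath_def)
      then show ?thesis using True ab ipath_nthE[OF ip(1), of k l] ip(2) that by auto
    next
      case ab: False
      then show ?thesis using La[OF that(1,2,5) ab that(3,6)] True by auto
    qed
  next
    case False
    then show ?thesis using an[OF that(1,4)] lsA[OF that(1-3)] lsA[OF that(4-6)] unfolding apart_def by blast
  qed
  have FE: "\<exists>e i. e \<in> E0 \<and> i \<le> q \<and> s = edge_of e i" if "s \<in> F" for s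
  proof -
    have "s \<in> edge_sets H" using that F(1) by (auto simp: line_graph_def)
    then show ?thesis unfolding edge_sets_H by blast
  qed
  then obtain ie ii where it: "\<And>s. s \<in> F \<Longrightarrow> ie s \<in> E0 \<and> ii s \<le> q \<and> s = edge_of (ie s) (ii s)" by metis
  let ?X = "(\<lambda>s. (ie s, ii s)) ` F"
  have "card ?X < Suc q" using card_image_le[OF F(2), of "\<lambda>s. (ie s, ii s)"] F(3) by simp
  then obtain ct where ct: "\<And>e. ct e < Suc q \<and> (e, ct e) \<notin> ?X" using find_cut[of ?X "Suc q"] F(2) by blast
  define f where "f s = (case arm_coord (Suc q) ct (ie s) (ii s) of (x, a, k) \<Rightarrow> Ls x a ! k)" for s
  have coord: "\<exists>x a k. arm_coord (Suc q) ct (ie s) (ii s) = (x, a, k) \<and> f s = Ls x a ! k \<and> x \<in> V0 \<and> a < 3 \<and> k < q \<and> ii s \<noteq> ct (ie s) \<and> ie s \<in> E0 \<and> ii s < Suc q"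
    if s: "s \<in> F" for s
  proof -
    obtain x a k where h: "arm_coord (Suc q) ct (ie s) (ii s) = (x, a, k)" by (cases "arm_coord (Suc q) ct (ie s) (ii s)")
    have "ii s \<noteq> ct (ie s)" using ct[of "ie s"] s by auto
    then show ?thesis using arm_coord_bounds[of "ie s" "ii s" "Suc q" ct x a k] it[OF s] ct[of "ie s"] h by (auto simp: f_def)
  qed
  have main: "(f s = f r \<longrightarrow> s = r) \<and> (s \<noteq> r \<longrightarrow> (?E (f s) (f r) \<longleftrightarrow> s \<inter> r \<noteq> {}))" if s: "s \<in> F" and r: "r \<in> F" for s r
  proof -
    let ?e = "ie s" and ?i = "ii s" and ?g = "ie r" and ?j = "ii r"
    obtain x a k where h: "arm_coord (Suc q) ct ?e ?i = (x, a, k)" "f s = Ls x a ! k" "x \<in> V0" "a < 3" "k < q" "?i \<noteq> ct ?e" "?e \<in> E0" "?i < Suc q"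
      using coord[OF s] by blast
    obtain y b l where h': "arm_coord (Suc q) ct ?g ?j = (y, b, l)" "f r = Ls y b ! l" "y \<in> V0" "b < 3" "l < q" "?j \<noteq> ct ?g" "?g \<in> E0" "?j < Suc q"
      using coord[OF r] by blast
    have c: "ct ?e < Suc q" "ct ?g < Suc q" using ct by auto
    have same: "?e = ?g \<and> (k = l \<longleftrightarrow> ?i = ?j) \<and> ((k = Suc l \<or> l = Suc k) \<longleftrightarrow> (?i = Suc ?j \<or> ?j = Suc ?i))" if "x = y" "a = b"
      using arm_coord_same[of ?e ?g ?i "Suc q" ?j ct x a k l] h h' that by auto
    have cons: "x = y \<and> a = b \<and> (k = Suc l \<or> l = Suc k)" if "?e = ?g" "?i = Suc ?j \<or> ?j = Suc ?i"
      using arm_coord_consec[of ?e ?i "Suc q" ?j ct x a k y b l] h h' that by auto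
    have end1: "(k = 0 \<and> x = z) \<longleftrightarrow> (?i = 0 \<and> z = fst ?e) \<or> (?i = q \<and> z = snd ?e)" for z
      using arm_coord_end[of ?e ?i "Suc q" ct x a k z] h c q2 by simp
    have end2: "(l = 0 \<and> y = z) \<longleftrightarrow> (?j = 0 \<and> z = fst ?g) \<or> (?j = q \<and> z = snd ?g)" for z
      using arm_coord_end[of ?g ?j "Suc q" ct y b l z] h' c q2 by simp
    note tt = t3[OF h(3-5) h'(3-5)]
    have "s = r" if "f s = f r"
    proof -
      have "x = y" "a = b" "k = l" using tt that h(2) h'(2) by auto
      then have "?e = ?g" "?i = ?j" using same by auto
      then show ?thesis using it[OF s] it[OF r] by metis
    qed
    moreover have "?E (f s) (f r) \<longleftrightarrow> s \<inter> r \<noteq> {}" if "s \<noteq> r"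
    proof -
      have ne: "(?e, ?i) \<noteq> (?g, ?j)" using that it[OF s] it[OF r] by (metis Pair_inject)
      have "s \<inter> r \<noteq> {} \<longleftrightarrow> edge_of ?e ?i \<inter> edge_of ?g ?j \<noteq> {}" using it[OF s] it[OF r] by simp
      also have "\<dots> \<longleftrightarrow> (?e = ?g \<and> (?i = Suc ?j \<or> ?j = Suc ?i)) \<or> (\<exists>z. (k = 0 \<and> x = z) \<and> (l = 0 \<and> y = z))"
        unfolding end1 end2 by (rule edge_of_meet) (use h h' ne in auto)
      also have "\<dots> \<longleftrightarrow> x = y \<and> ((a = b \<and> (k = Suc l \<or> l = Suc k)) \<or> (a \<noteq> b \<and> k = 0 \<and> l = 0))"
        using same cons ne by auto
      also have "\<dots> \<longleftrightarrow> ?E (f s) (f r)" using tt h(2) h'(2) by simp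
      finally show ?thesis by simp
    qed
    ultimately show ?thesis by blast
  qed
  have "embeds f (line_graph H) F G"
    unfolding embeds_def
  proof (intro conjI ballI)
    show "inj_on f F" using main by (auto intro: inj_onI)
    show "f ` F \<subseteq> pverts G"
    proof
      fix w assume "w \<in> f ` F"
      then obtain s where s: "s \<in> F" "w = f s" by blast
      obtain x a k where "f s = Ls x a ! k" "x \<in> V0" "a < 3" "k < q" using coord[OF s(1)] by blast
      then show "w \<in> pverts G" using lsA[of x a k] A[of x] s by auto
    qed
    fix s r assume sr: "s \<in> F" "r \<in> F"
    then have "s \<in> edge_sets H" "r \<in> edge_sets H" using F(1) by (auto simp: line_graph_def)
    then have "(s, r) \<in> parcs (line_graph H) \<longleftrightarrow> s \<noteq> r \<and> s \<inter> r \<noteq> {}" by (simp add: line_graph_def)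
    also have "\<dots> \<longleftrightarrow> (f s, f r) \<in> parcs G" using main[OF sr] irrefl by (cases "s = r") auto
    finally show "(s, r) \<in> parcs (line_graph H) \<longleftrightarrow> (f s, f r) \<in> parcs G" .
  qed
  then show ?thesis by blast
qed

end

end

section \<open>Hereditary classes and walls\<close>

lemma sgraph_pair_graph: "pair_graph G \<Longrightarrow> sgraph (\<lambda>u v. (u, v) \<in> parcs G)"
  unfolding pair_graph_iff by unfold_locales (auto dest: symD)

lemma pair_graph_line_graph:
  assumes "pair_graph G" shows "pair_graph (line_graph G)"
proof -
  have fin: "finite (pverts G)" "parcs G \<subseteq> pverts G \<times> pverts G" using assms by (auto simp: pair_graph_iff)
  then have "edge_sets G \<subseteq> Pow (pverts G)" by (auto simp: edge_sets_def)
  then have "finite (edge_sets G)" using fin(1) finite_subset by blast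
  then show ?thesis unfolding pair_graph_iff by (auto simp: line_graph_def sym_def)
qed

text \<open>
  By Ramsey's theorem, either side of a sufficiently large biclique contains a clique or an independent set
  of \<open>t\<close> vertices, and two independent sides form an induced complete bipartite graph.
\<close>
lemma nobiclique_class:
  assumes C: "hereditary C" and t: "\<And>G. G \<in> C \<Longrightarrow> \<not> K\<^bsub>t\<^esub> (with_proj G) \<and> \<not> K\<^bsub>t,t\<^esub> (with_proj G)"
  shows "\<exists>s. \<forall>G\<in>C. sgraph.nobiclique (\<lambda>u v. (u, v) \<in> parcs G) s (pverts G)"
proof -
  obtain r :: nat where r: "r \<ge> 1" "\<And>(V :: nat set) E :: nat set set. finite V \<Longrightarrow> card V \<ge> r \<Longrightarrow>
      \<exists>R\<subseteq>V. card R = t \<and> clique R E \<or> card R = t \<and> indep R E"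
    using ramsey2[of t t, where 'a = nat] by blast
  show ?thesis
  proof (intro exI[of _ r] ballI)
    fix G assume G: "G \<in> C"
    have pg: "pair_graph G" using C G unfolding hereditary_def graph_class_def by blast
    have ind: "induced G S \<in> C" if "S \<subseteq> pverts G" for S
      using C G induced_subgraph_induced[OF pg that] unfolding hereditary_def by blast
    interpret sgraph "\<lambda>u v. (u, v) \<in> parcs G" by (rule sgraph_pair_graph[OF pg])
    let ?E = "edge_sets G"
    have E: "{u, v} \<in> ?E \<longleftrightarrow> (u, v) \<in> parcs G" for u v
      unfolding edge_sets_def using sym by (auto simp: doubleton_eq_iff)
    have fin: "finite S" if "S \<subseteq> pverts G" for S using pg that finite_subset by (auto simp: pair_graph_iff)
    have half: "\<exists>R\<subseteq>X. card R = t \<and> (\<forall>u\<in>R. \<forall>v\<in>R. (u, v) \<notin> parcs G)" if X: "X \<subseteq> pverts G" "card X = r" for X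
    proof -
      obtain R where R: "R \<subseteq> X" "card R = t" "clique R ?E \<or> indep R ?E"
        using r(2)[OF fin[OF X(1)], of ?E] X(2) by auto
      have RV: "R \<subseteq> pverts G" using R X by blast
      have "\<not> clique R ?E"
      proof
        assume cl: "clique R ?E"
        have "K\<^bsub>t\<^esub> (with_proj (induced G R))"
          unfolding complete_digraph_pair_def using R(2) fin[OF RV] cl E irrefl
          by (auto simp: induced_def clique_def)
        then show False using t[OF ind[OF RV]] by blast
      qed
      then have "indep R ?E" using R(3) by blast
      then have "\<forall>u\<in>R. \<forall>v\<in>R. (u, v) \<notin> parcs G" using E irrefl unfolding indep_def by metis
      then show ?thesis using R by blast
    qed
    show "nobiclique r (pverts G)"
      unfolding nobiclique_def
    proof
      assume "\<exists>X Y. X \<subseteq> pverts G \<and> Y \<subseteq> pverts G \<and> card X = r \<and> card Y = r \<and> (\<forall>x\<in>X. \<forall>y\<in>Y. (x, y) \<in> parcs G)"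
      then obtain X Y where XY: "X \<subseteq> pverts G" "Y \<subseteq> pverts G" "card X = r" "card Y = r" "\<forall>x\<in>X. \<forall>y\<in>Y. (x, y) \<in> parcs G" by blast
      obtain R where R: "R \<subseteq> X" "card R = t" "\<forall>u\<in>R. \<forall>v\<in>R. (u, v) \<notin> parcs G" using half[OF XY(1,3)] by blast
      obtain Q where Q: "Q \<subseteq> Y" "card Q = t" "\<forall>u\<in>Q. \<forall>v\<in>Q. (u, v) \<notin> parcs G" using half[OF XY(2,4)] by blast
      have RQ: "\<forall>u\<in>R. \<forall>v\<in>Q. (u, v) \<in> parcs G \<and> (v, u) \<in> parcs G" using XY(5) R(1) Q(1) sym by blast
      have sub: "R \<union> Q \<subseteq> pverts G" using R Q XY by blast
      have "parcs (induced G (R \<union> Q)) = R \<times> Q \<union> Q \<times> R"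
        using RQ R(3) Q(3) by (auto simp: induced_def)
      moreover have "R \<inter> Q = {}" using RQ irrefl by blast
      moreover have "pverts (induced G (R \<union> Q)) = R \<union> Q" by (simp add: induced_def)
      moreover have "finite (pverts (induced G (R \<union> Q)))" using fin[OF sub] by (simp add: induced_def)
      ultimately have "K\<^bsub>t,t\<^esub> (with_proj (induced G (R \<union> Q)))"
        unfolding complete_bipartite_digraph_pair_def using R(2) Q(2) by (intro conjI exI[of _ R] exI[of _ Q])
      then show False using t[OF ind[OF sub]] by blast
    qed
  qed
qed

lemma large_tree_width_many:
  assumes C: "hereditary C" "unbounded_tree_width C"
    and s: "\<And>G. G \<in> C \<Longrightarrow> sgraph.nobiclique (\<lambda>u v. (u, v) \<in> parcs G) s (pverts G)"
  shows "\<exists>G\<in>C. sgraph.has_tripods (\<lambda>u v. (u, v) \<in> parcs G) p m (pverts G)"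
proof -
  obtain \<kappa> where \<kappa>: "\<And>c. \<exists>N. \<forall>E (V :: nat set) W. tangled E V W \<kappa> c \<longrightarrow> N \<le> card W \<longrightarrow>
    sgraph.nobiclique E s V \<longrightarrow> sgraph.has_tripods E p m V" using many_tripods[where s = s and p = p and m = m and 'a = nat] by blast
  define K where "K = max \<kappa> 1"
  obtain N where N: "\<And>E (V :: nat set) W. tangled E V W \<kappa> (2 * K) \<Longrightarrow> N \<le> card W \<Longrightarrow>
    sgraph.nobiclique E s V \<Longrightarrow> sgraph.has_tripods E p m V" using \<kappa>[of "2 * K"] by blast
  \<comment> \<open>The summand \<open>6 * K + 1\<close> makes a linked set large enough for a tangle with \<open>c = 2 * K\<close>.\<close>
  define n where "n = N + 6 * K + 1"
  obtain G where G: "G \<in> C" "n + K < tree_width G"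
    using C(2) unfolding unbounded_tree_width_def by (meson not_le)
  have pg: "pair_graph G" using C(1) G(1) unfolding hereditary_def graph_class_def by blast
  then have finG: "finite (pverts G)" and subG: "parcs G \<subseteq> pverts G \<times> pverts G" by (auto simp: pair_graph_iff)
  interpret sgraph "\<lambda>u v. (u, v) \<in> parcs G" by (rule sgraph_pair_graph[OF pg])
  have "\<not> decomposable (n + K) (pverts G) {}"
    using tree_width_decomposable[of G "n + K" "{}"] subG G(2) by auto
  moreover have "1 \<le> K" "K \<le> n" by (auto simp: K_def n_def)
  ultimately have "\<not> (\<forall>V' W. V' \<subseteq> pverts G \<longrightarrow> W \<subseteq> V' \<longrightarrow> card W = n \<longrightarrow> \<not> linked K V' W)"
    using linked_or_decomposable[OF finG, of K n "{}"] by (metis card.empty empty_subsetI le0)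
  then obtain V W where V: "V \<subseteq> pverts G" "W \<subseteq> V" "card W = n" "linked K V W" by blast
  have finV: "finite V" using V(1) finG finite_subset by blast
  have T: "tangled (\<lambda>u v. (u, v) \<in> parcs G) V W K (2 * K)"
    by (rule linked_tangled[OF finV V(2) _ _ V(4)]) (auto simp: K_def V(3) n_def)
  interpret T: tangled "\<lambda>u v. (u, v) \<in> parcs G" V W K "2 * K" by (rule T)
  have "tangled (\<lambda>u v. (u, v) \<in> parcs G) V W \<kappa> (2 * K)"
  proof unfold_locales
    fix Y assume "Y \<subseteq> V" "card Y \<le> \<kappa>"
    then show "\<exists>C\<subseteq>V - Y. conn C \<and> (\<forall>x\<in>C. \<forall>y\<in>V - Y. (x, y) \<in> parcs G \<longrightarrow> y \<in> C) \<and> card (W - C) \<le> 2 * K"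
      by (intro T.comp) (auto simp: K_def)
  qed (rule T.fin T.WV T.Wbig)+
  then have "has_tripods p m V"
    by (rule N) (use V(3) nobiclique_mono[OF s[OF G(1)] V(1)] in \<open>auto simp: n_def\<close>)
  then have "has_tripods p m (pverts G)" unfolding has_tripods_def using V(1) by (meson order_trans)
  then show ?thesis using G(1) by blast
qed

lemma pigeonhole_two:
  assumes "\<And>i. i < 2 * m \<Longrightarrow> P i \<or> Q i"
  shows "(\<exists>S \<subseteq> {..<2 * m}. card S = m \<and> (\<forall>i\<in>S. P i)) \<or> (\<exists>S \<subseteq> {..<2 * m :: nat}. card S = m \<and> (\<forall>i\<in>S. Q i))"
proof -
  let ?P = "{i. i < 2 * m \<and> P i}" and ?Q = "{i. i < 2 * m \<and> Q i}"
  have "{..<2 * m} \<subseteq> ?P \<union> ?Q" using assms by auto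
  then have "2 * m \<le> card (?P \<union> ?Q)" using card_mono[of "?P \<union> ?Q" "{..<2 * m}"] by simp
  then have "2 * m \<le> card ?P + card ?Q" using card_Un_le[of ?P ?Q] by linarith
  then have "m \<le> card ?P \<or> m \<le> card ?Q" by linarith
  then show ?thesis
  proof
    assume "m \<le> card ?P"
    then obtain S where "S \<subseteq> ?P" "card S = m" by (meson obtain_subset_with_card_n)
    then show ?thesis by blast
  next
    assume "m \<le> card ?Q"
    then obtain S where "S \<subseteq> ?Q" "card S = m" by (meson obtain_subset_with_card_n)
    then show ?thesis by blast
  qed
qed

definition wall_verts :: "nat \<Rightarrow> (nat \<times> nat) set" where
  "wall_verts t = {(x, y). x \<le> 2 * t + 1 \<and> y \<le> t}"

definition wall_edges :: "nat \<Rightarrow> ((nat \<times> nat) \<times> (nat \<times> nat)) set" where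
  "wall_edges t = {((x, y), (x + 1, y)) | x y. (x, y) \<in> wall_verts t \<and> (x + 1, y) \<in> wall_verts t} \<union>
     {((x, y), (x, y + 1)) | x y. (x, y) \<in> wall_verts t \<and> (x, y + 1) \<in> wall_verts t \<and> even (x + y)}"

lemma wall_eq: "wall t t = \<lparr> pverts = wall_verts t, parcs = wall_edges t \<union> (wall_edges t)\<inverse> \<rparr>"
  by (simp add: wall_def Let_def wall_verts_def wall_edges_def)

text \<open>
  Ports of a wall: \<open>0\<close> towards the right, \<open>1\<close> towards the left, \<open>2\<close> vertically. A vertical edge goes up from a vertex with even sum of
  coordinates, so that no vertex has two of them.
\<close>
definition wall_pt :: "nat \<Rightarrow> (nat \<times> nat) \<times> (nat \<times> nat) \<Rightarrow> nat" where
  "wall_pt b e = (if snd (fst e) = snd (snd e) then b else 2)"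

interpretation wall: ported "wall_verts t" "wall_edges t" "wall_pt 0" "wall_pt 1" for t
proof unfold_locales
  have "wall_verts t = {..2 * t + 1} \<times> {..t}" by (auto simp: wall_verts_def)
  then show "finite (wall_verts t)" by simp
  show "wall_edges t \<subseteq> wall_verts t \<times> wall_verts t" by (auto simp: wall_edges_def)
  show "(x, x) \<notin> wall_edges t" for x by (auto simp: wall_edges_def)
  show "(y, x) \<notin> wall_edges t" if "(x, y) \<in> wall_edges t" for x y using that by (auto simp: wall_edges_def)
  fix e f assume e: "e \<in> wall_edges t"
  show "wall_pt 0 e < 3" "wall_pt 1 e < 3" by (auto simp: wall_pt_def)
  assume f: "f \<in> wall_edges t"
  show "e = f" if "fst e = fst f" "wall_pt 0 e = wall_pt 0 f"
    using e f that by (auto simp: wall_edges_def wall_pt_def)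
  show "e = f" if "snd e = snd f" "wall_pt 1 e = wall_pt 1 f"
    using e f that by (auto simp: wall_edges_def wall_pt_def)
  show "wall_pt 0 e \<noteq> wall_pt 1 f" if "fst e = snd f"
    using e f that by (auto simp: wall_edges_def wall_pt_def)
qed

text \<open>
  The shift of the first coordinate keeps the new vertices outside the wall.
\<close>
definition wall_inner :: "nat \<Rightarrow> nat \<Rightarrow> (nat \<times> nat) \<times> (nat \<times> nat) \<Rightarrow> (nat \<times> nat) list" where
  "wall_inner t q e = map (\<lambda>i. (2 * t + 2 + to_nat e, i)) [0..<q]"

lemma wall_inner_good: "wall.subdividing t (wall_inner t q)"
  unfolding wall.subdividing_def
proof (intro ballI conjI impI)
  fix e f :: "(nat \<times> nat) \<times> (nat \<times> nat)"
  show "distinct (wall_inner t q e)" by (simp add: wall_inner_def distinct_map inj_on_def)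
  show "set (wall_inner t q e) \<inter> wall_verts t = {}" by (auto simp: wall_inner_def wall_verts_def)
  assume "e \<noteq> f"
  then show "set (wall_inner t q e) \<inter> set (wall_inner t q f) = {}" by (auto simp: wall_inner_def)
qed

theorem theorem5p11:
  fixes C :: "nat pair_pre_digraph set"
  assumes "hereditary C"
    and "unbounded_tree_width C"
    and "KKW_free C"
  shows "infinitely_defined C"
proof (rule ccontr)
  assume "\<not> infinitely_defined C"
  then obtain n where n: "\<forall>F\<in>minimal_forbidden C. card (pverts F) \<le> n" using bounded_minimal_forbidden by blast
  obtain t where K: "\<And>G. G \<in> C \<Longrightarrow> \<not> K\<^bsub>t\<^esub> (with_proj G) \<and> \<not> K\<^bsub>t,t\<^esub> (with_proj G)"
    and W: "\<And>G. G \<in> C \<Longrightarrow> \<not> (\<exists>H. subdivision_pair (wall t t) H \<and> graph_iso H G)"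
    and LW: "\<And>G. G \<in> C \<Longrightarrow> \<not> (\<exists>H. subdivision_pair (wall t t) H \<and> graph_iso (line_graph H) G)"
    using assms(3) unfolding KKW_free_def by blast
  \<comment> \<open>The edges of the wall become so long that a graph with \<open>n\<close> vertices misses an inner vertex of each of them.\<close>
  define q where "q = n + 2"
  define H where "H = wall.subdiv_graph t (wall_inner t q)"
  have len: "length (wall_inner t q e) = q" for e by (simp add: wall_inner_def)
  have q2: "2 \<le> q" by (simp add: q_def)
  have base: "wall.subdiv_graph t (\<lambda>_. []) = wall t t" unfolding wall.base_graph wall_eq ..
  have sd: "subdivision_pair (wall t t) H"
    using wall.subdivision_subdiv_graph[OF wall_inner_good, of t q] unfolding base H_def .
  have "pair_graph (wall t t)" using wall.pair_graph_base[of t] unfolding base .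
  then have pH: "pair_graph H" using pair_graph.pair_graph_subdivision[OF _ sd] by blast
  have pL: "pair_graph (line_graph H)" by (rule pair_graph_line_graph[OF pH])
  obtain F1 where F1: "F1 \<subseteq> pverts H" "card F1 \<le> n" "\<forall>G\<in>C. \<forall>f. \<not> embeds f H F1 G"
    using small_nonembedding[OF assms(1) n pH] W sd by blast
  obtain F2 where F2: "F2 \<subseteq> pverts (line_graph H)" "card F2 \<le> n" "\<forall>G\<in>C. \<forall>f. \<not> embeds f (line_graph H) F2 G"
    using small_nonembedding[OF assms(1) n pL] LW sd by blast
  have fin: "finite F1" "finite F2" using F1(1) F2(1) pH pL finite_subset unfolding pair_graph_iff by blast+
  obtain s where s: "\<forall>G\<in>C. sgraph.nobiclique (\<lambda>u v. (u, v) \<in> parcs G) s (pverts G)"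
    using nobiclique_class[OF assms(1) K] by blast
  \<comment> \<open>One tripod for each branch vertex; among twice as many, half are of the same kind.\<close>
  define m where "m = card (wall_verts t)"
  obtain G where G: "G \<in> C" "sgraph.has_tripods (\<lambda>u v. (u, v) \<in> parcs G) q (2 * m) (pverts G)"
    using large_tree_width_many[OF assms(1,2), of s q "2 * m"] s by blast
  have pg: "pair_graph G" using assms(1) G(1) unfolding hereditary_def graph_class_def by blast
  interpret sgraph "\<lambda>u v. (u, v) \<in> parcs G" by (rule sgraph_pair_graph[OF pg])
  obtain A where A: "\<And>i. i < 2 * m \<Longrightarrow> A i \<subseteq> pverts G \<and> tripod q (A i)"
    and an: "\<And>i j. i < 2 * m \<Longrightarrow> j < 2 * m \<Longrightarrow> i \<noteq> j \<Longrightarrow> apart (A i) (A j)"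
    using G(2) unfolding has_tripods_def by blast
  have pick: "\<exists>h. bij_betw h (wall_verts t) S" if "S \<subseteq> {..<2 * m}" "card S = m" for S :: "nat set"
    using that wall.finV finite_subset[OF that(1)] finite_same_card_bij[of "wall_verts t" S] by (simp add: m_def)
  have hS: "h x < 2 * m \<and> h x \<in> S" if "bij_betw h (wall_verts t) S" "S \<subseteq> {..<2 * m}" "x \<in> wall_verts t" for h S x
    using that by (auto simp: bij_betw_def)
  have hne: "h x \<noteq> h y" if "bij_betw h (wall_verts t) S" "x \<in> wall_verts t" "y \<in> wall_verts t" "x \<noteq> y" for h S x y
    using that by (auto simp: bij_betw_def inj_on_def)
  have "(\<exists>S \<subseteq> {..<2 * m}. card S = m \<and> (\<forall>i\<in>S. claw q (A i))) \<or> (\<exists>S \<subseteq> {..<2 * m}. card S = m \<and> (\<forall>i\<in>S. line_claw q (A i)))"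
    by (rule pigeonhole_two) (use A in \<open>auto simp: tripod_def\<close>)
  then show False
  proof
    assume "\<exists>S \<subseteq> {..<2 * m}. card S = m \<and> (\<forall>i\<in>S. claw q (A i))"
    then obtain S where S: "S \<subseteq> {..<2 * m}" "card S = m" "\<forall>i\<in>S. claw q (A i)" by blast
    obtain h where h: "bij_betw h (wall_verts t) S" using pick[OF S(1,2)] by blast
    have "\<exists>f. embeds f (wall.subdiv_graph t (wall_inner t q)) F1 G"
    proof (rule wall.claw_embed[OF wall_inner_good len q2 sgraph_axioms])
      show "claw q (A (h x)) \<and> A (h x) \<subseteq> pverts G" if "x \<in> wall_verts t" for x
        using A S(3) hS[OF h S(1) that] by blast
      show "apart (A (h x)) (A (h y))" if "x \<in> wall_verts t" "y \<in> wall_verts t" "x \<noteq> y" for x y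
        using an hS[OF h S(1) that(1)] hS[OF h S(1) that(2)] hne[OF h that] by blast
      show "F1 \<subseteq> pverts (wall.subdiv_graph t (wall_inner t q))" using F1(1) by (simp add: H_def)
      show "finite F1" "card F1 < q" using fin F1(2) by (auto simp: q_def)
    qed
    then show False using F1(3) G(1) unfolding H_def by blast
  next
    assume "\<exists>S \<subseteq> {..<2 * m}. card S = m \<and> (\<forall>i\<in>S. line_claw q (A i))"
    then obtain S where S: "S \<subseteq> {..<2 * m}" "card S = m" "\<forall>i\<in>S. line_claw q (A i)" by blast
    obtain h where h: "bij_betw h (wall_verts t) S" using pick[OF S(1,2)] by blast
    have "\<exists>f. embeds f (line_graph (wall.subdiv_graph t (wall_inner t q))) F2 G"
    proof (rule wall.line_claw_embed[OF wall_inner_good len q2 sgraph_axioms])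
      show "line_claw q (A (h x)) \<and> A (h x) \<subseteq> pverts G" if "x \<in> wall_verts t" for x
        using A S(3) hS[OF h S(1) that] by blast
      show "apart (A (h x)) (A (h y))" if "x \<in> wall_verts t" "y \<in> wall_verts t" "x \<noteq> y" for x y
        using an hS[OF h S(1) that(1)] hS[OF h S(1) that(2)] hne[OF h that] by blast
      show "F2 \<subseteq> pverts (line_graph (wall.subdiv_graph t (wall_inner t q)))" using F2(1) by (simp add: H_def)
      show "finite F2" "card F2 < q" using fin F2(2) by (auto simp: q_def)
    qed
    then show False using F2(3) G(1) unfolding H_def by blast
  qed
qed

end
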